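(* Let $q\in\mathbb C$ with $0<|q|<1$. Let $a_1,\dots,a_6$ be generic nonzero complex numbers (see context) and let $N_1,\dots,N_6$ be integers satisfying $$a_1a_2\cdots a_6=q\qquad\text{and}\qquad N_1+N_2+\dots+N_6=0.$$ Then $$\sum_{m=-\infty}^\infty\oint \prod_{j=1}^6\frac{(q^{1+m/2}/(a_jz);q)_\infty\,(q^{1-m/2}z/a_j;q)_\infty}{(q^{N_j+m/2}a_jz;q)_\infty\,(q^{N_j-m/2}a_j/z;q)_\infty}\;\frac{(1-q^mz^2)(1-q^mz^{-2})}{q^mz^{6m}}\;\frac{dz}{2\pi \mathrm i z} =\frac{2}{\prod_{j=1}^6q^{\binom{N_j}{2}}a_j^{N_j}}\prod_{1\leq j<k\leq 6}\frac{(q/(a_ja_k);q)_\infty}{(a_ja_kq^{N_j+N_k};q)_\infty}.$$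
   Context: Notation: $(a;q)_\infty=\prod_{i=0}^\infty(1-aq^i)$; $\binom{N}{2}=N(N-1)/2$ for every integer $N$ (possibly negative). A square root $q^{1/2}$ of $q$ is fixed and $q^{m/2}=(q^{1/2})^m$ for $m\in\mathbb Z$. Genericity: the parameters are such that, for each $m$, the zeros of the denominator of the integrand split into geometric sequences tending to $0$, namely $z=q^{N_j-m/2+k}a_j$ ($1\le j\le 6$, $k\ge 0$), and geometric sequences tending to $\infty$, namely $z=q^{-N_j-m/2-k}/a_j$ ($1\le j\le 6$, $k\geq 0$), with no point in common; that is, $a_ia_jq^{N_i+N_j}\notin\{q^{-n}:n=0,1,2,\dots\}$ for all $1\le i,j\le 6$. Contour: for each $m$, the integral is over a positively oriented closed contour in $\mathbb C\setminus\{0\}$ separating these two types of points: it has winding number $1$ around $0$ and around every point of the sequences tending to $0$, and winding number $0$ around every point of the sequences tending to $\infty$. *)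

theory Defs
  imports "HOL-Complex_Analysis.Complex_Analysis"
begin

definition qpoch_inf :: "complex \<Rightarrow> complex \<Rightarrow> complex" where
  "qpoch_inf a q = (\<Prod>i. 1 - a * q ^ i)"

text \<open>
  Below, \<open>s\<close> is the fixed square root of \<open>q\<close>, so that \<open>q\<^bsup>m/2\<^esup>\<close> is \<open>s powi m\<close>.
  The families \<open>a\<close> and \<open>N\<close> are only used at the indices \<open>1, \<dots>, 6\<close>.
\<close>

definition poles_to_zero ::
    "complex \<Rightarrow> complex \<Rightarrow> (nat \<Rightarrow> complex) \<Rightarrow> (nat \<Rightarrow> int) \<Rightarrow> int \<Rightarrow> complex set" where
  "poles_to_zero q s a N m =
     {q powi N j * s powi (- m) * q ^ k * a j | j k. j \<in> {1..6}}"

definition poles_to_infinity ::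
    "complex \<Rightarrow> complex \<Rightarrow> (nat \<Rightarrow> complex) \<Rightarrow> (nat \<Rightarrow> int) \<Rightarrow> int \<Rightarrow> complex set" where
  "poles_to_infinity q s a N m =
     {q powi (- N j) * s powi (- m) * q powi (- int k) / a j | j k. j \<in> {1..6}}"

definition generic_params :: "complex \<Rightarrow> (nat \<Rightarrow> complex) \<Rightarrow> (nat \<Rightarrow> int) \<Rightarrow> bool" where
  "generic_params q a N \<longleftrightarrow>
     (\<forall>i\<in>{1..6}. \<forall>j\<in>{1..6}. \<forall>n::nat. a i * a j * q powi (N i + N j) \<noteq> q powi (- int n))"

definition separating_contour ::
    "complex \<Rightarrow> complex \<Rightarrow> (nat \<Rightarrow> complex) \<Rightarrow> (nat \<Rightarrow> int) \<Rightarrow> int \<Rightarrow> (real \<Rightarrow> complex) \<Rightarrow> bool" where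
  "separating_contour q s a N m \<gamma> \<longleftrightarrow>
     valid_path \<gamma> \<and> pathfinish \<gamma> = pathstart \<gamma> \<and>
     path_image \<gamma> \<inter> ({0} \<union> poles_to_zero q s a N m \<union> poles_to_infinity q s a N m) = {} \<and>
     (\<forall>p \<in> {0} \<union> poles_to_zero q s a N m. winding_number \<gamma> p = 1) \<and>
     (\<forall>p \<in> poles_to_infinity q s a N m. winding_number \<gamma> p = 0)"

definition integrand ::
    "complex \<Rightarrow> complex \<Rightarrow> (nat \<Rightarrow> complex) \<Rightarrow> (nat \<Rightarrow> int) \<Rightarrow> int \<Rightarrow> complex \<Rightarrow> complex" where
  "integrand q s a N m z =
     (\<Prod>j=1..6.
        (qpoch_inf (q * s powi m / (a j * z)) q * qpoch_inf (q * s powi (- m) * z / a j) q) /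
        (qpoch_inf (q powi N j * s powi m * a j * z) q *
         qpoch_inf (q powi N j * s powi (- m) * a j / z) q))
     * ((1 - q powi m * z ^ 2) * (1 - q powi m * z powi (- 2)) / (q powi m * z powi (6 * m)))"

end

theory Submission
  imports Defs
begin

text \<open>
  In the variable \<open>u = q\<^bsup>m/2\<^esup> z\<close> the denominators of the integrands no longer depend on \<open>m\<close>, so
  the left hand side is a single contour integral of a weight times a bilateral sum \<open>S u\<close>.
  The sum satisfies \<open>S (q u) = q\<^sup>-\<^sup>4 u\<^sup>-\<^sup>6 S u\<close> and \<open>S (1 / u) = - u\<^sup>2 S u\<close>, which forces
  \<open>S u = u\<^sup>-\<^sup>2 \<theta>(u\<^sup>2) (\<alpha> \<theta>(a\<^sub>4 u, a\<^sub>4 / u) + \<beta> \<theta>(a\<^sub>5 u, a\<^sub>5 / u))\<close>. Each of the two terms turns the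
  integral into a Nassrallah-Rahman integral, which is evaluated by a telescoping recurrence
  in its parameters; the answers are proportional to \<open>\<alpha>\<close> and \<open>\<beta>\<close>, and only one linear
  combination of \<open>\<alpha>\<close> and \<open>\<beta>\<close> enters. To find it, move the contour of the Nassrallah-Rahman
  integral with parameters \<open>a\<^sub>1, \<dots>, a\<^sub>5\<close> towards \<open>0\<close>: the residues sum up to the values
  \<open>S a\<^sub>1, \<dots>, S a\<^sub>5\<close>, and partial fractions of theta functions reduce these to the required
  combination. Parameters for which some \<open>a\<^sub>i a\<^sub>j\<close> or \<open>a\<^sub>i / a\<^sub>j\<close> is a power of \<open>q\<close> are reached by
  continuity.
\<close>

subsection \<open>Infinite q-shifted factorials and theta functions\<close>

text \<open>The integers \<open>N j\<close> sit only in the denominators of the weight, which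
  involve \<open>b j = q powi N j * a j\<close>; the bilateral sum involves \<open>a j\<close>
  alone. As the \<open>N j\<close> add up to 0, the \<open>b j\<close> also have product
  \<open>q\<close>. So when \<open>theta_pm (b 4) u\<close> cancels the two denominators of index 4,
  the numerators left over have parameter \<open>q / b 4\<close>, the product of the other five:
  exactly the balance of a Nassrallah-Rahman integral. Returning from \<open>b\<close> to
  \<open>a\<close>, in the theta function of the expansion and in the theta products of the answer
  together, costs the same factor for index 4 as for index 5. Hence the combination of \<alpha> and
  \<beta> that has to be found does not depend on \<open>N\<close>, and one residue computation
  without shifts settles all cases.

  In the series the quadratic exponents of the six factors cancel against the explicit power of
  \<open>q\<close>; the value of the product of the \<open>a j\<close> then leaves the rate
  \<open>norm q ^ n\<close>.

  The \<open>a j\<close> may have any size, so a circle need not separate the poles. The geometry is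
  therefore expressed by winding numbers around zeros of \<open>qp\<close>, and contours are
  compared only through these.\<close>

locale nome =
  fixes q :: complex
  assumes q_nz [simp]: "q \<noteq> 0" and q_lt: "norm q < 1"
begin

abbreviation qp :: "complex \<Rightarrow> complex" where "qp x \<equiv> qpoch_inf x q"

definition theta :: "complex \<Rightarrow> complex" where
  "theta x = qp x * qp (q / x)"

lemma summable_qp: "summable (\<lambda>i. norm (a * q ^ i))"
  using q_lt by (auto simp: norm_mult norm_power intro!: summable_mult summable_geometric)

lemma qp_has_prod: "(\<lambda>i. 1 - a * q ^ i) has_prod qp a"
proof -
  have "abs_convergent_prod (\<lambda>i. 1 - a * q ^ i)"
    unfolding abs_convergent_prod_conv_summable using summable_qp[of a] by simp
  thus ?thesis
    by (simp add: abs_convergent_prod_imp_convergent_prod convergent_prod_has_prod qpoch_inf_def)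
qed

lemma qp_LIMSEQ: "(\<lambda>n. \<Prod>i<n. 1 - a * q ^ i) \<longlonglongrightarrow> qp a"
  using has_prod_imp_tendsto'[OF qp_has_prod] .

lemma qp_0 [simp]: "qp 0 = 1"
  by (simp add: qpoch_inf_def)

lemma qp_rec: "qp x = (1 - x) * qp (q * x)"
proof -
  have "(\<lambda>n. (1 - x) * (\<Prod>i<n. 1 - (q * x) * q ^ i)) \<longlonglongrightarrow> (1 - x) * qp (q * x)"
    by (intro tendsto_intros qp_LIMSEQ)
  moreover have "(\<lambda>n. (1 - x) * (\<Prod>i<n. 1 - (q * x) * q ^ i)) = (\<lambda>n. \<Prod>i<Suc n. 1 - x * q ^ i)"
    by (subst prod.lessThan_Suc_shift) (simp add: mult_ac)
  moreover have "(\<lambda>n. \<Prod>i<Suc n. 1 - x * q ^ i) \<longlonglongrightarrow> qp x"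
    using qp_LIMSEQ[of x] by (rule LIMSEQ_Suc)
  ultimately show ?thesis
    using LIMSEQ_unique by metis
qed

lemma qp_eq_0_iff: "qp x = 0 \<longleftrightarrow> (\<exists>n::nat. x * q ^ n = 1)"
  using has_prod_eq_0_iff[OF qp_has_prod, of x] by (auto simp: image_iff)

lemma qp_neq_0: "norm x < 1 \<Longrightarrow> qp x \<noteq> 0"
proof
  assume x: "norm x < 1" and "qp x = 0"
  then obtain n where "x * q ^ n = 1" by (auto simp: qp_eq_0_iff)
  hence "norm x * norm q ^ n = 1" by (metis norm_mult norm_one norm_power)
  moreover have "norm x * norm q ^ n \<le> norm x * 1"
    using q_lt by (intro mult_left_mono power_le_one) auto
  ultimately show False using x by simp
qed

lemma qp_q_neq_0 [simp]: "qp q \<noteq> 0"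
  by (rule qp_neq_0[OF q_lt])

text \<open>The bound is independent of \<open>n\<close>. It serves for \<open>qp\<close> itself by
  passage to the limit, and for the finite products that split off when an argument is divided by
  \<open>q ^ n\<close>.\<close>

lemma norm_qp_finite_le: "norm (\<Prod>i<n. 1 - x * q ^ i) \<le> exp (norm x / (1 - norm q))"
proof -
  have "norm (\<Prod>i<n. 1 - x * q ^ i) \<le> (\<Prod>i<n. 1 + norm (x * q ^ i))"
    unfolding prod_norm[symmetric] by (intro prod_mono) (metis norm_ge_zero norm_one norm_triangle_ineq4)
  also have "\<dots> \<le> exp (\<Sum>i<n. norm (x * q ^ i))"
    by (rule prod_le_exp_sum) auto
  also have "(\<Sum>i<n. norm (x * q ^ i)) \<le> (\<Sum>i. norm (x * q ^ i))"
    by (rule sum_le_suminf[OF summable_qp]) auto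
  also have "(\<Sum>i. norm (x * q ^ i)) = norm x / (1 - norm q)"
    using q_lt by (simp add: norm_mult norm_power suminf_mult summable_geometric suminf_geometric)
  finally show ?thesis by simp
qed

lemma norm_qp_le: "norm (qp x) \<le> exp (norm x / (1 - norm q))"
  by (rule Lim_bounded[OF tendsto_norm[OF qp_LIMSEQ]]) (use norm_qp_finite_le in auto)

lemma qp_uniform_limit:
  "uniform_limit (cball 0 r) (\<lambda>n x. \<Prod>i<n. 1 - x * q ^ i) qp sequentially"
proof -
  have "uniformly_convergent_on (cball 0 r) (\<lambda>n x. \<Prod>i<n. 1 - x * q ^ i)"
  proof (rule uniformly_convergent_on_prod')
    show "uniformly_convergent_on (cball 0 r) (\<lambda>N x. \<Sum>n<N. norm (1 - x * q ^ n - 1))"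
    proof (rule Weierstrass_m_test')
      show "norm (norm (1 - x * q ^ n - 1)) \<le> r * norm q ^ n" if "x \<in> cball 0 r" for n x
        using that by (auto simp: norm_mult norm_power intro!: mult_right_mono)
      show "summable (\<lambda>n. r * norm q ^ n)"
        using q_lt by (auto intro!: summable_mult summable_geometric)
    qed
  qed (auto intro!: continuous_intros)
  then obtain l where l: "uniform_limit (cball 0 r) (\<lambda>n x. \<Prod>i<n. 1 - x * q ^ i) l sequentially"
    by (auto simp: uniformly_convergent_on_def)
  have "l x = qp x" if "x \<in> cball 0 r" for x
    using tendsto_uniform_limitI[OF l that] qp_LIMSEQ LIMSEQ_unique by blast
  thus ?thesis using l by (subst (asm) uniform_limit_cong'[where g = "\<lambda>n x. \<Prod>i<n. 1 - x * q ^ i" and i = qp]) auto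
qed

lemma qp_holomorphic_UNIV: "qp holomorphic_on UNIV"
proof -
  have "qp holomorphic_on ball 0 (norm z + 1)" for z
    by (rule holomorphic_uniform_limit[OF _ qp_uniform_limit[of "norm z + 1"]])
       (auto intro!: always_eventually continuous_intros holomorphic_intros)
  hence "qp field_differentiable (at z)" for z
    by (rule holomorphic_on_imp_differentiable_at[where s = "ball 0 (norm z + 1)"]) auto
  thus ?thesis
    by (auto simp: holomorphic_on_def intro: field_differentiable_at_within)
qed

lemma qp_holomorphic [holomorphic_intros]:
  "f holomorphic_on A \<Longrightarrow> (\<lambda>x. qp (f x)) holomorphic_on A"
  using holomorphic_on_compose_gen[OF _ qp_holomorphic_UNIV, of f A] by (simp add: o_def)

lemma qp_continuous [continuous_intros]:
  "continuous_on A f \<Longrightarrow> continuous_on A (\<lambda>x. qp (f x))"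
  using continuous_on_compose2[OF holomorphic_on_imp_continuous_on[OF qp_holomorphic_UNIV], of A f]
  by simp

lemma qp_tendsto [tendsto_intros]:
  "(f \<longlongrightarrow> l) F \<Longrightarrow> ((\<lambda>x. qp (f x)) \<longlongrightarrow> qp l) F"
  by (rule continuous_on_tendsto_compose[OF holomorphic_on_imp_continuous_on[OF qp_holomorphic_UNIV]])
     auto

lemma theta_holomorphic [holomorphic_intros]:
  "f holomorphic_on A \<Longrightarrow> (\<And>x. x \<in> A \<Longrightarrow> f x \<noteq> 0) \<Longrightarrow> (\<lambda>x. theta (f x)) holomorphic_on A"
  unfolding theta_def by (intro holomorphic_intros) auto

lemma theta_inverse:
  assumes "x \<noteq> 0"
  shows "theta (1 / x) = - theta x / x"
proof -
  have "theta (1 / x) = (1 - 1 / x) * qp (q / x) * qp (q * x)"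
    using qp_rec[of "1 / x"] by (simp add: theta_def)
  also have "\<dots> = - ((1 - x) * qp (q * x)) * qp (q / x) / x"
    using assms by (simp add: field_simps)
  also have "(1 - x) * qp (q * x) = qp x"
    by (rule qp_rec[symmetric])
  finally show ?thesis by (simp add: theta_def)
qed

lemma theta_q: "x \<noteq> 0 \<Longrightarrow> theta (q * x) = - theta x / x"
  using theta_inverse[of x] by (simp add: theta_def mult_ac)

lemma theta_q_div: "x \<noteq> 0 \<Longrightarrow> theta (q / x) = theta x"
  by (simp add: theta_def)

text \<open>Step number \<open>i\<close> of the iteration of \<open>theta_q\<close> contributes the
  factor \<open>- 1 / (q powi i * x)\<close>, and the exponents \<open>i\<close> add up to a
  triangular number. One step is proved as an equivalence, so that the same computation also carries
  the induction to negative integers.\<close>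

lemma theta_powi:
  assumes "x \<noteq> 0"
  shows "theta (q powi n * x) = (-1) powi n * q powi (- (n * (n - 1) div 2)) * x powi (- n) * theta x"
    (is "?P n")
proof -
  have step: "?P (n + 1) \<longleftrightarrow> ?P n" for n
  proof -
    have ev: "(n + 1) * (n + 1 - 1) div 2 = n * (n - 1) div 2 + n" for n :: int
    proof -
      have "(n + 1) * (n + 1 - 1) = n * (n - 1) + n * 2" by (simp add: algebra_simps)
      thus ?thesis by simp
    qed
    have "theta (q powi (n + 1) * x) = theta (q * (q powi n * x))"
      by (simp add: power_int_add mult_ac)
    also have "\<dots> = - theta (q powi n * x) / (q powi n * x)"
      using assms by (subst theta_q) auto
    finally have 1: "theta (q powi (n + 1) * x) = - theta (q powi n * x) / (q powi n * x)" .
    have 2: "(-1) powi (n+1) * q powi (- ((n + 1) * (n + 1 - 1) div 2)) * x powi (- (n+1)) * theta x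
       = - ((-1) powi n * q powi (- (n * (n - 1) div 2)) * x powi (- n) * theta x) / (q powi n * x)"
      unfolding ev minus_add_distrib using assms
      by (simp only: power_int_add power_int_minus mult_eq_0_iff q_nz power_int_1_right simp_thms
           disj_not1 neg_equal_zero one_neq_zero) (simp add: divide_simps power_int_add)
    show ?thesis
      unfolding 1 2 using assms by simp
  qed
  show ?thesis
  proof (induction n rule: int_induct[where k = 0])
    case base show ?case by simp
  next
    case (step1 i) thus ?case using step[of i] by simp
  next
    case (step2 i) thus ?case using step[of "i - 1"] by simp
  qed
qed

lemma theta_eq_0_iff:
  assumes "x \<noteq> 0"
  shows "theta x = 0 \<longleftrightarrow> (\<exists>k::int. x = q powi k)"
proof
  assume "theta x = 0"
  then consider n :: nat where "x * q ^ n = 1" | n :: nat where "q / x * q ^ n = 1"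
    by (auto simp: theta_def qp_eq_0_iff)
  thus "\<exists>k::int. x = q powi k"
  proof cases
    case 1
    thus ?thesis by (intro exI[of _ "- int n"]) (auto simp: power_int_minus field_simps)
  next
    case 2
    thus ?thesis using assms
      by (intro exI[of _ "int (Suc n)"]) (simp only: power_int_of_nat, simp add: field_simps)
  qed
next
  assume "\<exists>k::int. x = q powi k"
  then obtain k where "x = q powi k * 1" by auto
  moreover have "theta 1 = 0" by (simp add: theta_def qp_eq_0_iff exI[of _ 0])
  ultimately show "theta x = 0" using theta_powi[of 1 k] by simp
qed

end

subsection \<open>Contour integrals and quasi-periodic functions\<close>

lemma holomorphic_on_imp_isCont:
  "f holomorphic_on S \<Longrightarrow> open S \<Longrightarrow> z \<in> S \<Longrightarrow> isCont f z"
  by (blast intro: field_differentiable_imp_continuous_at holomorphic_on_imp_differentiable_at)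

lemma isCont_eventually_nonzero:
  fixes f :: "complex \<Rightarrow> complex"
  assumes "isCont f z" "f z \<noteq> 0"
  shows "\<forall>\<^sub>F w in nhds z. f w \<noteq> 0"
  using assms by (intro tendsto_imp_eventually_ne[of f "f z"])
    (auto simp: isCont_def tendsto_at_iff_tendsto_nhds)

text \<open>The connecting path \<open>p\<close> is run through in both directions, so its
  contributions cancel. Winding numbers are the special case of the integrand
  \<open>1 / (w - z)\<close>.\<close>

lemma join_closed_paths:
  assumes S: "open S" "connected S"
    and g1: "valid_path g1" "pathfinish g1 = pathstart g1" "path_image g1 \<subseteq> S"
    and g2: "valid_path g2" "pathfinish g2 = pathstart g2" "path_image g2 \<subseteq> S"
  obtains g where "valid_path g" "pathfinish g = pathstart g" "path_image g \<subseteq> S"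
    "\<And>z. z \<notin> S \<Longrightarrow> winding_number g z = winding_number g1 z + winding_number g2 z"
    "\<And>f. f holomorphic_on S \<Longrightarrow>
       contour_integral g f = contour_integral g1 f + contour_integral g2 f"
proof -
  have "pathstart g1 \<in> S" "pathstart g2 \<in> S" using g1 g2 by auto
  then obtain p where p: "polynomial_function p" "path_image p \<subseteq> S"
      "pathstart p = pathstart g1" "pathfinish p = pathstart g2"
    using connected_open_polynomial_connected[OF S] by metis
  have vp: "valid_path p" using p by (simp add: valid_path_polynomial_function)
  define g where "g = g1 +++ (p +++ (g2 +++ reversepath p))"
  have v: "valid_path g" "pathfinish g = pathstart g"
    unfolding g_def using g1 g2 p vp by (auto intro!: valid_path_join)
  have im: "path_image g \<subseteq> S"
    unfolding g_def using g1 g2 p by (auto simp: path_image_join)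
  have int: "contour_integral g f = contour_integral g1 f + contour_integral g2 f"
    if f: "f holomorphic_on S" for f
  proof -
    have i: "f contour_integrable_on h" if "valid_path h" "path_image h \<subseteq> S" for h
      using contour_integrable_holomorphic_simple[OF f S(1) that] .
    have [simp]: "f contour_integrable_on g1" "f contour_integrable_on g2"
        "f contour_integrable_on p" "f contour_integrable_on (reversepath p)"
      using g1 g2 p vp by (auto intro!: i)
    show ?thesis
      unfolding g_def using g1 g2 p vp
      by (simp add: contour_integral_reversepath)
  qed
  have wn: "winding_number g z = winding_number g1 z + winding_number g2 z" if z: "z \<notin> S" for z
  proof -
    have "(\<lambda>w. 1 / (w - z)) holomorphic_on S"
      using z by (intro holomorphic_intros) auto
    from int[OF this] show ?thesis
      using z g1 g2 v im by (subst (1 2 3) winding_number_valid_path) (auto simp: algebra_simps add_divide_distrib)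
  qed
  show ?thesis using that[OF v im wn int] by blast
qed

text \<open>This is the residue theorem for \<open>g1\<close> joined with the reverse of
  \<open>g2\<close>. Only the joined curve needs winding number 0 off \<open>S\<close>; each of the
  two curves alone may wind around points outside \<open>S\<close>, such as 0.\<close>

lemma contour_integral_diff_residues:
  assumes S: "open S" "connected S" and pts: "finite pts"
    and f: "f holomorphic_on S - pts"
    and g1: "valid_path g1" "pathfinish g1 = pathstart g1" "path_image g1 \<subseteq> S - pts"
    and g2: "valid_path g2" "pathfinish g2 = pathstart g2" "path_image g2 \<subseteq> S - pts"
    and eq: "\<And>z. z \<notin> S \<Longrightarrow> winding_number g1 z = winding_number g2 z"
  shows "contour_integral g1 f - contour_integral g2 f =
    2 * pi * \<i> * (\<Sum>p\<in>pts. (winding_number g1 p - winding_number g2 p) * residue f p)"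
proof -
  have S': "open (S - pts)" "connected (S - pts)"
    using S pts by (auto intro!: open_Diff finite_imp_closed connected_open_delete_finite)
  obtain g where g: "valid_path g" "pathfinish g = pathstart g" "path_image g \<subseteq> S - pts"
    and wn: "\<And>z. z \<notin> S - pts \<Longrightarrow> winding_number g z = winding_number g1 z + winding_number (reversepath g2) z"
    and int: "\<And>f. f holomorphic_on S - pts \<Longrightarrow>
       contour_integral g f = contour_integral g1 f + contour_integral (reversepath g2) f"
    using join_closed_paths[OF S' g1, of "reversepath g2"] g2 by auto
  have wn': "winding_number g z = winding_number g1 z - winding_number g2 z" if "z \<notin> S - pts" for z
    using wn[OF that] that g2
    by (subst (asm) winding_number_reversepath) (auto simp: valid_path_imp_path)
  have "contour_integral g f = 2 * pi * \<i> * (\<Sum>p\<in>pts. winding_number g p * residue f p)"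
    by (rule Residue_theorem[OF S pts f g]) (use wn' eq in auto)
  thus ?thesis
    using int[OF f] g2 wn' by (simp add: contour_integral_reversepath)
qed

lemma contour_integral_homologous:
  assumes "open S" "connected S" "f holomorphic_on S"
    and "valid_path g1" "pathfinish g1 = pathstart g1" "path_image g1 \<subseteq> S"
    and "valid_path g2" "pathfinish g2 = pathstart g2" "path_image g2 \<subseteq> S"
    and "\<And>z. z \<notin> S \<Longrightarrow> winding_number g1 z = winding_number g2 z"
  shows "contour_integral g1 f = contour_integral g2 f"
  using contour_integral_diff_residues[of S "{}" f g1 g2] assms by simp

text \<open>The factor \<open>c\<close> can be taken out of the derivative only where the path is
  differentiable; the finitely many remaining times do not affect the integral.\<close>

lemma contour_integral_scale:
  assumes "valid_path g" "c \<noteq> 0"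
  shows "contour_integral (\<lambda>t. c * g t) f = contour_integral g (\<lambda>z. c * f (c * z))"
proof -
  have "((\<lambda>t. c * g t) has_vector_derivative c * vector_derivative g (at t)) (at t)"
    if "g differentiable (at t)" for t
    using that by (intro has_vector_derivative_mult_right vector_derivative_works[THEN iffD1])
  hence vd: "vector_derivative (\<lambda>t. c * g t) (at t) = c * vector_derivative g (at t)"
    if "g differentiable (at t)" for t
    using that vector_derivative_at by blast
  obtain N where N: "finite N" "\<forall>t\<in>{0..1} - N. g differentiable at t"
    using assms unfolding valid_path_def piecewise_C1_differentiable_on_def C1_differentiable_on_eq
    by auto
  show ?thesis
    unfolding contour_integral_integral
    by (rule integral_spike[of N]) (use N in \<open>auto simp: negligible_finite vd mult_ac\<close>)
qed

lemma valid_path_scale: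
  fixes g :: "real \<Rightarrow> complex"
  assumes "valid_path g"
  shows "valid_path (\<lambda>t. c * g t)"
proof -
  have "valid_path ((\<lambda>z. c * z) \<circ> g)"
    using assms by (intro valid_path_compose_holomorphic[of g "\<lambda>z. c * z" UNIV])
      (auto intro!: holomorphic_intros)
  thus ?thesis by (simp add: o_def)
qed

lemma path_image_scale: "path_image (\<lambda>t. c * g t) = (\<lambda>z. c * z) ` path_image g"
  by (auto simp: path_image_def)

lemma winding_number_scale:
  assumes "valid_path g" "c \<noteq> 0" "z \<notin> path_image g"
  shows "winding_number (\<lambda>t. c * g t) (c * z) = winding_number g z"
proof -
  have "c * z \<notin> path_image (\<lambda>t. c * g t)"
    using assms by (auto simp: path_image_scale)
  hence "winding_number (\<lambda>t. c * g t) (c * z) =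
      1 / (2 * pi * \<i>) * contour_integral g (\<lambda>w. c * (1 / (c * w - c * z)))"
    using assms by (subst winding_number_valid_path) (auto intro!: valid_path_scale simp: contour_integral_scale)
  also have "(\<lambda>w. c * (1 / (c * w - c * z))) = (\<lambda>w. 1 / (w - z))"
    using assms by (auto simp: fun_eq_iff right_diff_distrib[symmetric])
  finally show ?thesis
    using assms by (subst winding_number_valid_path) auto
qed

section \<open>Limits and parameters under the integral sign\<close>

lemma contour_integral_uniform_limit_holomorphic:
  assumes S: "open S" "valid_path g" "path_image g \<subseteq> S"
    and f: "\<forall>\<^sub>F n in F. f n holomorphic_on S" and l: "l holomorphic_on S"
    and ul: "uniform_limit S f l F"
  shows "((\<lambda>n. contour_integral g (f n)) \<longlongrightarrow> contour_integral g l) F"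
proof -
  obtain L where L: "L > 0" "\<And>f B. f holomorphic_on S \<Longrightarrow> (\<forall>z\<in>S. norm (f z) \<le> B) \<Longrightarrow>
      norm (contour_integral g f) \<le> L * B"
    using contour_integral_bound_exists[OF S] by blast
  show ?thesis
  proof (rule tendstoI)
    fix e :: real assume e: "e > 0"
    hence "e / (2 * L) > 0" using L by simp
    from uniform_limitD[OF ul this] f
    show "\<forall>\<^sub>F n in F. dist (contour_integral g (f n)) (contour_integral g l) < e"
    proof eventually_elim
      case (elim n)
      have "norm (contour_integral g (\<lambda>z. f n z - l z)) \<le> L * (e / (2 * L))"
        using elim l by (intro L) (auto intro!: holomorphic_intros less_imp_le simp: dist_norm)
      also have "contour_integral g (\<lambda>z. f n z - l z) = contour_integral g (f n) - contour_integral g l"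
        using elim l S by (intro contour_integral_diff contour_integrable_holomorphic_simple)
      finally show ?case using L e by (simp add: dist_norm)
    qed
  qed
qed

text \<open>A tube lemma: compactness of the path gives one radius \<open>e\<close> for all its
  points. Half of it is spent on the second coordinate, where the closure of the
  \<open>e/4\<close>-neighbourhood stays inside the \<open>e/2\<close>-neighbourhood, and half on
  the parameter.\<close>

lemma path_image_tube:
  fixes W :: "(complex \<times> complex) set"
  assumes g: "path g" and W: "open W" "\<And>z. z \<in> path_image g \<Longrightarrow> (p, z) \<in> W"
  obtains d V where "d > 0" "open V" "path_image g \<subseteq> V" "compact (closure V)"
    "cball p d \<times> closure V \<subseteq> W"
proof -
  have c: "compact ({p} \<times> path_image g)"
    using g by (intro compact_Times) (auto simp: compact_path_image)
  have "{p} \<times> path_image g \<subseteq> W" using W by auto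
  then obtain e where e: "e > 0" "(\<Union>x\<in>{p} \<times> path_image g. ball x e) \<subseteq> W"
    using compact_subset_open_imp_ball_epsilon_subset[OF c W(1)] by blast
  define V where "V = (\<Union>z\<in>path_image g. ball z (e/4))"
  have cV: "closure V \<subseteq> (\<Union>z\<in>path_image g. ball z (e/2))"
  proof
    fix x assume "x \<in> closure V"
    then obtain y where y: "y \<in> V" "dist y x < e/4"
      using e by (meson closure_approachable zero_less_divide_iff zero_less_numeral)
    then obtain z where "z \<in> path_image g" "dist z y < e/4" by (auto simp: V_def)
    thus "x \<in> (\<Union>z\<in>path_image g. ball z (e/2))"
      using y dist_triangle[of z x y] by (intro UN_I[of z]) auto
  qed
  have "bounded (path_image g)" using g by (simp add: bounded_path_image)
  then obtain R where R: "\<And>x. x \<in> path_image g \<Longrightarrow> norm x \<le> R" by (auto simp: bounded_iff)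
  have "norm x \<le> R + e/4" if "x \<in> V" for x
  proof -
    obtain z where "z \<in> path_image g" "dist z x < e/4" using \<open>x \<in> V\<close> by (auto simp: V_def)
    thus ?thesis using R[of z] norm_triangle_ineq2[of x z] by (auto simp: dist_norm norm_minus_commute)
  qed
  hence "bounded V" by (auto simp: bounded_iff)
  show ?thesis
  proof (rule that[of "e/2" V])
    show "cball p (e/2) \<times> closure V \<subseteq> W"
    proof clarify
      fix a b assume a: "a \<in> cball p (e/2)" and "b \<in> closure V"
      then obtain z where z: "z \<in> path_image g" "dist z b < e/2" using cV by auto
      have "dist (p, z) (a, b) \<le> dist p a + dist z b"
        unfolding dist_Pair_Pair by (rule sqrt_sum_squares_le_sum) auto
      also have "\<dots> < e" using a z by auto
      finally have "(a, b) \<in> ball (p, z) e" by simp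
      thus "(a, b) \<in> W" using e z by blast
    qed
    show "path_image g \<subseteq> V" unfolding V_def using e by auto
    show "compact (closure V)" using \<open>bounded V\<close> by simp
  qed (use e in \<open>auto simp: V_def\<close>)
qed

text \<open>On a compact tube around the path, joint continuity is uniform, so \<open>f x\<close>
  converges to \<open>f p\<close> uniformly on a neighbourhood of the path. Holomorphy in the second
  variable supplies integrability and the bound for the integral.\<close>

lemma contour_integral_param_tendsto:
  fixes W :: "(complex \<times> complex) set"
  assumes g: "valid_path g" and W: "open W" "\<And>z. z \<in> path_image g \<Longrightarrow> (p, z) \<in> W"
    and cont: "continuous_on W (\<lambda>(x, z). f x z)"
    and hol: "\<And>x. f x holomorphic_on {z. (x, z) \<in> W}"
  shows "((\<lambda>x. contour_integral g (f x)) \<longlongrightarrow> contour_integral g (f p)) (nhds p)"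
proof -
  obtain d V where d: "d > 0" and V: "open V" "path_image g \<subseteq> V" "compact (closure V)"
    and sub: "cball p d \<times> closure V \<subseteq> W"
    using path_image_tube[OF valid_path_imp_path[OF g] W] by metis
  have hol': "f x holomorphic_on V" if "x \<in> cball p d" for x
    using hol by (rule holomorphic_on_subset) (use sub that closure_subset[of V] in auto)
  have uc: "uniformly_continuous_on (cball p d \<times> closure V) (\<lambda>(x, z). f x z)"
    using V sub by (intro compact_uniformly_continuous continuous_on_subset[OF cont] compact_Times) auto
  have ev: "\<forall>\<^sub>F x in nhds p. x \<in> cball p d"
    using d by (auto simp: eventually_nhds_metric dist_commute intro!: exI[of _ d])
  show ?thesis
  proof (rule contour_integral_uniform_limit_holomorphic[OF V(1) g V(2)])
    show "\<forall>\<^sub>F x in nhds p. f x holomorphic_on V"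
      using ev by eventually_elim (rule hol')
    show "f p holomorphic_on V" using d by (intro hol') auto
    show "uniform_limit V f (f p) (nhds p)"
    proof (rule uniform_limitI)
      fix e :: real assume "e > 0"
      then obtain d' where d': "d' > 0" "\<And>x y. x \<in> cball p d \<times> closure V \<Longrightarrow>
          y \<in> cball p d \<times> closure V \<Longrightarrow> dist y x < d' \<Longrightarrow>
          dist ((\<lambda>(x, z). f x z) y) ((\<lambda>(x, z). f x z) x) < e"
        using uc unfolding uniformly_continuous_on_def by metis
      have "\<forall>\<^sub>F x in nhds p. dist x p < d'"
        using d' by (auto simp: eventually_nhds_metric)
      with ev show "\<forall>\<^sub>F x in nhds p. \<forall>z\<in>V. dist (f x z) (f p z) < e"
      proof eventually_elim
        case (elim x)
        show ?case
        proof
          fix z assume "z \<in> V"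
          hence "z \<in> closure V" using closure_subset by blast
          thus "dist (f x z) (f p z) < e"
            using d'(2)[of "(p, z)" "(x, z)"] d elim by (simp add: dist_Pair_Pair)
        qed
      qed
    qed
  qed
qed

text \<open>At a common zero \<open>z0\<close> the quotient gets the value from l'Hopital's rule.
  Dividing both functions by \<open>z - z0\<close> shows that this is holomorphic, because the zero
  of \<open>D\<close> is simple and the divided denominator does not vanish.\<close>

lemma holomorphic_quotient_simple_zeros:
  assumes S: "open S" and phi: "\<phi> holomorphic_on S" and D: "D holomorphic_on S"
    and zeros: "\<And>z. z \<in> S \<Longrightarrow> D z = 0 \<Longrightarrow> \<phi> z = 0 \<and> deriv D z \<noteq> 0"
  obtains r where "r holomorphic_on S" "\<And>z. z \<in> S \<Longrightarrow> \<phi> z = r z * D z"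
proof -
  define r where "r = (\<lambda>z. if D z = 0 then deriv \<phi> z / deriv D z else \<phi> z / D z)"
  have ex_h: "\<exists>h. h field_differentiable at z0 \<and> (\<forall>\<^sub>F z in nhds z0. r z = h z)" if z0: "z0 \<in> S" for z0
  proof (cases "D z0 = 0")
    case False
    have "isCont D z0" by (rule holomorphic_on_imp_isCont[OF D S z0])
    hence "\<forall>\<^sub>F z in nhds z0. D z \<noteq> 0"
      using False by (rule isCont_eventually_nonzero)
    hence "\<forall>\<^sub>F z in nhds z0. r z = \<phi> z / D z" by eventually_elim (simp add: r_def)
    moreover have "(\<lambda>z. \<phi> z / D z) field_differentiable at z0"
      using False phi D S z0
      by (intro field_differentiable_divide) (auto intro: holomorphic_on_imp_differentiable_at)
    ultimately show ?thesis by blast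
  next
    case True
    define E where "E = (\<lambda>z. if z = z0 then deriv D z0 else (D z - D z0) / (z - z0))"
    define F where "F = (\<lambda>z. if z = z0 then deriv \<phi> z0 else (\<phi> z - \<phi> z0) / (z - z0))"
    have E: "E holomorphic_on S" and F: "F holomorphic_on S"
      unfolding E_def F_def by (rule pole_lemma_open[OF D S] pole_lemma_open[OF phi S])+
    have "E z0 \<noteq> 0" using zeros[OF z0 True] by (simp add: E_def)
    moreover have "isCont E z0" by (rule holomorphic_on_imp_isCont[OF E S z0])
    ultimately have "\<forall>\<^sub>F z in nhds z0. E z \<noteq> 0"
      by (blast intro: isCont_eventually_nonzero)
    hence "\<forall>\<^sub>F z in nhds z0. r z = F z / E z"
      by eventually_elim
        (use True zeros[OF z0 True] in \<open>auto simp: r_def E_def F_def\<close>)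
    moreover have "(\<lambda>z. F z / E z) field_differentiable at z0"
      using \<open>E z0 \<noteq> 0\<close> E F S z0
      by (intro field_differentiable_divide) (auto intro: holomorphic_on_imp_differentiable_at)
    ultimately show ?thesis by blast
  qed
  have "r field_differentiable at z" if z: "z \<in> S" for z
  proof -
    obtain h d where "(h has_field_derivative d) (at z)" "\<forall>\<^sub>F w in nhds z. r w = h w"
      using ex_h[OF z] unfolding field_differentiable_def by auto
    hence "(r has_field_derivative d) (at z)"
      using DERIV_cong_ev[of z z r h d d] by simp
    thus ?thesis unfolding field_differentiable_def by blast
  qed
  hence "r holomorphic_on S"
    by (auto simp: holomorphic_on_def intro: field_differentiable_at_within)
  moreover have "\<phi> z = r z * D z" if "z \<in> S" for z
    using zeros[OF that] by (auto simp: r_def)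
  ultimately show ?thesis using that by blast
qed

text \<open>Periodicity brings every value to a compact annulus, so the function is bounded.
  Composition with \<open>exp\<close> makes it entire, and Liouville's theorem applies.\<close>

lemma multiplicatively_periodic_constant:
  assumes q: "q \<noteq> 0" "norm q < 1" and r: "r holomorphic_on -{0}"
    and per: "\<And>z. z \<noteq> 0 \<Longrightarrow> r (q * z) = r z"
  obtains c where "\<And>z. z \<noteq> 0 \<Longrightarrow> r z = c"
proof -
  define K where "K = cball (0 :: complex) 1 - ball 0 (norm q)"
  have "compact K" unfolding K_def by (intro compact_diff compact_cball open_ball)
  moreover have "K \<subseteq> -{0}" using q by (auto simp: K_def)
  ultimately have "bounded (r ` K)"
    by (intro compact_imp_bounded compact_continuous_image)
       (auto intro: holomorphic_on_imp_continuous_on holomorphic_on_subset[OF r])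
  then obtain B where B: "\<And>z. z \<in> K \<Longrightarrow> norm (r z) \<le> B" by (auto simp: bounded_iff)
  have pn: "r (q ^ n * z) = r z" if "z \<noteq> 0" for n z
    by (induction n) (use that q per in \<open>auto simp: mult.assoc\<close>)
  have bd: "norm (r z) \<le> B" if z: "z \<noteq> 0" for z
  proof -
    \<comment> \<open>Each unit of \<open>k\<close> adds \<open>ln (norm q)\<close> to the logarithm
      of the norm; this \<open>k\<close> puts it between \<open>ln (norm q)\<close> and 0, that is,
      \<open>w\<close> into \<open>K\<close>.\<close>
    define k where "k = \<lfloor>ln (norm z) / - ln (norm q)\<rfloor> + 1"
    define w where "w = q powi k * z"
    have lq: "ln (norm q) < 0" using q by simp
    have nw: "ln (norm w) = k * ln (norm q) + ln (norm z)"
      using q z by (simp add: w_def norm_mult norm_power_int ln_mult ln_powr flip: powr_real_of_int')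
    have "ln (norm z) / - ln (norm q) \<le> k" "k \<le> ln (norm z) / - ln (norm q) + 1"
      unfolding k_def by linarith+
    hence "ln (norm w) \<le> 0" "ln (norm q) \<le> ln (norm w)"
      unfolding nw using lq by (auto simp: field_simps)
    hence "w \<in> K" using q z by (auto simp: K_def w_def)
    have "r w = r z"
    proof (cases "k \<ge> 0")
      case True
      thus ?thesis using pn[OF z, of "nat k"] by (simp add: w_def power_int_def)
    next
      case False
      have "w \<noteq> 0" using q z by (simp add: w_def)
      moreover have "q ^ nat (-k) * w = z" using False q by (simp add: w_def power_int_def power_inverse)
      ultimately show ?thesis using pn[of w "nat (-k)"] by simp
    qed
    thus ?thesis using B[OF \<open>w \<in> K\<close>] by simp
  qed
  have "(r \<circ> exp) holomorphic_on UNIV"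
    by (rule holomorphic_on_compose_gen[OF _ r]) (auto intro: holomorphic_intros)
  moreover have "bounded (range (r \<circ> exp))"
    unfolding bounded_iff using bd by (intro exI[of _ B]) auto
  ultimately obtain c where c: "\<And>z. (r \<circ> exp) z = c"
    using Liouville_theorem[of "r \<circ> exp"] unfolding constant_on_def by auto
  have "r z = c" if "z \<noteq> 0" for z using c[of "Ln z"] that by simp
  thus ?thesis by (rule that)
qed

text \<open>Equal multipliers make the quotient periodic, and since \<phi> vanishes at the simple
  zeros of \<open>D\<close> the quotient has no poles. This replaces counting zeros in a fundamental
  annulus.\<close>

lemma quasiperiodic_eq_cmult:
  assumes q: "q \<noteq> 0" "norm q < 1"
    and phi: "\<phi> holomorphic_on -{0}" and D: "D holomorphic_on -{0}"
    and m: "\<And>z. z \<noteq> 0 \<Longrightarrow> \<phi> (q * z) = m z * \<phi> z" "\<And>z. z \<noteq> 0 \<Longrightarrow> D (q * z) = m z * D z"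
      "\<And>z. z \<noteq> 0 \<Longrightarrow> m z \<noteq> 0"
    and zeros: "\<And>z. z \<noteq> 0 \<Longrightarrow> D z = 0 \<Longrightarrow> \<phi> z = 0 \<and> deriv D z \<noteq> 0"
  obtains c where "\<And>z. z \<noteq> 0 \<Longrightarrow> \<phi> z = c * D z"
proof -
  obtain r where r: "r holomorphic_on -{0}" "\<And>z. z \<noteq> 0 \<Longrightarrow> \<phi> z = r z * D z"
    using holomorphic_quotient_simple_zeros[of "-{0}" \<phi> D] phi D zeros by auto
  have nz: "r (q * z) = r z" if "z \<noteq> 0" "D z \<noteq> 0" for z
    using r(2)[of z] r(2)[of "q * z"] m[of z] that q by auto
  have per: "r (q * z) = r z" if z: "z \<noteq> 0" for z
  proof (cases "D z = 0")
    \<comment> \<open>At a zero of \<open>D\<close> the periodicity of \<open>r\<close> cannot be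
      obtained by division. A simple zero is isolated, so the relation holds nearby and extends by
      continuity.\<close>
    case True
    have "D field_differentiable at z"
      using D z by (auto intro: holomorphic_on_imp_differentiable_at)
    hence "((\<lambda>w. (D w - D z) / (w - z)) \<longlongrightarrow> deriv D z) (at z)"
      by (simp add: DERIV_deriv_iff_field_differentiable flip: has_field_derivative_iff)
    from tendsto_imp_eventually_ne[OF this, of 0]
    have "\<forall>\<^sub>F w in at z. (D w - D z) / (w - z) \<noteq> 0"
      using zeros[OF z True] by blast
    hence "\<forall>\<^sub>F w in at z. D w \<noteq> D z"
      by eventually_elim auto
    moreover have "\<forall>\<^sub>F w in at z. w \<noteq> 0"
      by (rule tendsto_imp_eventually_ne[OF tendsto_ident_at z])
    ultimately have ev: "\<forall>\<^sub>F w in at z. r (q * w) = r w"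
      by eventually_elim (use nz True in auto)
    have cont: "isCont r w" if "w \<noteq> 0" for w
      using that by (intro holomorphic_on_imp_isCont[OF r(1)]) auto
    have "(r \<longlongrightarrow> r z) (at z)" using cont[OF z] by (simp add: isCont_def)
    moreover have "isCont (\<lambda>w. r (q * w)) z"
      using z q by (intro isCont_o2[of z "\<lambda>w. q * w" r] cont) auto
    hence "((\<lambda>w. r (q * w)) \<longlongrightarrow> r (q * z)) (at z)" by (simp add: isCont_def)
    hence "(r \<longlongrightarrow> r (q * z)) (at z)" by (rule Lim_transform_eventually) (use ev in simp)
    ultimately show ?thesis by (metis LIM_unique)
  qed (use nz z in auto)
  obtain c where "\<And>z. z \<noteq> 0 \<Longrightarrow> r z = c"
    using multiplicatively_periodic_constant[OF q r(1) per] by metis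
  thus ?thesis using that[of c] r(2) by simp
qed

lemma deriv_mult_at_simple_zero:
  fixes f g :: "complex \<Rightarrow> complex"
  assumes "f field_differentiable at z" "g field_differentiable at z"
    and "f z = 0 \<Longrightarrow> deriv f z \<noteq> 0" "g z = 0 \<Longrightarrow> deriv g z \<noteq> 0"
    and "f z \<noteq> 0 \<or> g z \<noteq> 0" and "f z * g z = 0"
  shows "deriv (\<lambda>z. f z * g z) z \<noteq> 0"
  using assms by (auto simp: deriv_mult)

section \<open>Simplicity of the zeros of theta functions\<close>

context nome
begin

text \<open>The quasi-periodicity moves the zero \<open>x = q powi k\<close> to 1, where
  \<open>qp\<close> has the explicit factor \<open>1 - z / x\<close>. The cofactor \<open>H\<close>
  takes at \<open>x\<close> a value with the factor \<open>(qp q)^2\<close>, which is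
  nonzero.\<close>

lemma theta_simple_zeros:
  assumes "x \<noteq> 0" "theta x = 0"
  shows "deriv theta x \<noteq> 0"
proof -
  obtain k where k: "x = q powi k" using assms theta_eq_0_iff by blast
  define H where "H = (\<lambda>z. (-1) powi k * q powi (- (k * (k - 1) div 2)) * (z / x) powi (- k) *
      (- 1 / x) * qp (q * (z / x)) * qp (q / (z / x)))"
  have eq: "theta z = (z - x) * H z" if "z \<noteq> 0" for z
  proof -
    have "theta z = theta (q powi k * (z / x))" using k by simp
    also have "\<dots> = (-1) powi k * q powi (- (k * (k - 1) div 2)) * (z / x) powi (- k) * theta (z / x)"
      using that assms by (intro theta_powi) auto
    also have "theta (z / x) = (1 - z / x) * qp (q * (z / x)) * qp (q / (z / x))"
      unfolding theta_def using qp_rec[of "z / x"] by simp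
    also have "1 - z / x = (z - x) * (- 1 / x)" using assms by (simp add: field_simps)
    finally show ?thesis by (simp only: H_def mult_ac)
  qed
  have "H holomorphic_on -{0}" unfolding H_def using assms by (intro holomorphic_intros) auto
  hence "H field_differentiable at x"
    using assms by (auto intro: holomorphic_on_imp_differentiable_at)
  hence "((\<lambda>z. (z - x) * H z) has_field_derivative H x) (at x)"
    by (auto intro!: derivative_eq_intros simp: DERIV_deriv_iff_field_differentiable[symmetric])
  moreover have "\<forall>\<^sub>F z in nhds x. theta z = (z - x) * H z"
    using t1_space_nhds[of x 0] assms by (auto elim: eventually_mono intro: eq)
  ultimately have "(theta has_field_derivative H x) (at x)"
    using DERIV_cong_ev[of x x theta "\<lambda>z. (z - x) * H z" "H x" "H x"] by simp
  hence "deriv theta x = H x" by (rule DERIV_imp_deriv)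
  moreover have "H x \<noteq> 0" using assms by (simp add: H_def)
  ultimately show ?thesis by simp
qed

lemma theta_field_differentiable: "x \<noteq> 0 \<Longrightarrow> theta field_differentiable at x"
  using theta_holomorphic[of "\<lambda>x. x" "-{0}"]
  by (auto intro: holomorphic_on_imp_differentiable_at)

lemma theta_compose_simple_zeros:
  assumes "(h has_field_derivative h') (at z)" "h z \<noteq> 0" "h' \<noteq> 0" "theta (h z) = 0"
  shows "deriv (\<lambda>z. theta (h z)) z \<noteq> 0"
proof -
  have "(theta has_field_derivative deriv theta (h z)) (at (h z))"
    using theta_field_differentiable[OF assms(2)] by (simp add: DERIV_deriv_iff_field_differentiable)
  from DERIV_chain2[OF this assms(1)] have "deriv (\<lambda>z. theta (h z)) z = deriv theta (h z) * h'"
    by (rule DERIV_imp_deriv)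
  thus ?thesis using assms theta_simple_zeros by simp
qed

subsection \<open>Separating contours\<close>

text \<open>Stated through \<open>qp\<close> and not through lists of points, so that the
  nonvanishing of denominators is at hand in proofs of holomorphy. A parameter 0 imposes no
  condition because \<open>qp 0 = 1\<close>.\<close>

definition regular_set :: "complex set \<Rightarrow> complex set" where
  "regular_set T = {z. z \<noteq> 0 \<and> (\<forall>t\<in>T. qp (t * z) \<noteq> 0 \<and> qp (t / z) \<noteq> 0)}"

text \<open>The zeros of \<open>qp (t / z)\<close> are the points \<open>t * q ^ k\<close> that tend
  to 0, those of \<open>qp (t * z)\<close> the points that tend to infinity. The winding number is
  thus prescribed at every point off \<open>regular_set T\<close>, which makes integrals independent
  of the choice of the curve.\<close>

definition separates :: "complex set \<Rightarrow> (real \<Rightarrow> complex) \<Rightarrow> bool" where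
  "separates T \<gamma> \<longleftrightarrow> valid_path \<gamma> \<and> pathfinish \<gamma> = pathstart \<gamma> \<and> path_image \<gamma> \<subseteq> regular_set T \<and>
     winding_number \<gamma> 0 = 1 \<and>
     (\<forall>t\<in>T. \<forall>z. z \<noteq> 0 \<longrightarrow> (qp (t / z) = 0 \<longrightarrow> winding_number \<gamma> z = 1) \<and>
                        (qp (t * z) = 0 \<longrightarrow> winding_number \<gamma> z = 0))"

lemma open_regular_set:
  assumes "finite T"
  shows "open (regular_set T)"
proof -
  have "open (-{0} \<inter> (\<lambda>z. \<Prod>t\<in>T. qp (t * z) * qp (t / z)) -` (-{0}))"
    by (rule continuous_open_preimage) (auto intro!: continuous_intros)
  also have "-{0} \<inter> (\<lambda>z. \<Prod>t\<in>T. qp (t * z) * qp (t / z)) -` (-{0}) = regular_set T"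
    using assms by (auto simp: regular_set_def)
  finally show ?thesis .
qed

text \<open>The excluded points accumulate at 0, so finiteness fails; countability still gives a
  connected complement in the plane, and leaves radii free for circles that avoid all these
  points.\<close>

lemma countable_Compl_regular_set:
  assumes "finite T"
  shows "countable (- regular_set T)"
proof (rule countable_subset)
  show "- regular_set T \<subseteq> {0} \<union> (\<Union>t\<in>T. range (\<lambda>n. t * q ^ n) \<union> range (\<lambda>n. 1 / (t * q ^ n)))"
  proof
    fix z assume z: "z \<in> - regular_set T"
    from z consider "z = 0" | t where "t \<in> T" "qp (t * z) = 0" | t where "t \<in> T" "qp (t / z) = 0"
      by (auto simp: regular_set_def)
    thus "z \<in> {0} \<union> (\<Union>t\<in>T. range (\<lambda>n. t * q ^ n) \<union> range (\<lambda>n. 1 / (t * q ^ n)))"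
    proof cases
      case (2 t)
      then obtain n where "t * z * q ^ n = 1" by (auto simp: qp_eq_0_iff)
      hence "z = 1 / (t * q ^ n)" by (intro eq_divide_imp) (auto simp: mult_ac)
      thus ?thesis using 2 by auto
    next
      case (3 t)
      then obtain n where "t / z * q ^ n = 1" by (auto simp: qp_eq_0_iff)
      hence "z = t * q ^ n" by (cases "z = 0") (auto simp: field_simps)
      thus ?thesis using 3 by auto
    qed simp
  qed
  show "countable ({0} \<union> (\<Union>t\<in>T. range (\<lambda>n. t * q ^ n) \<union> range (\<lambda>n. 1 / (t * q ^ n))))"
    using assms by (intro countable_Un countable_UN) (auto intro: countable_finite)
qed

lemma connected_regular_set:
  assumes "finite T"
  shows "connected (regular_set T)"
  using path_connected_complement_countable[OF _ countable_Compl_regular_set[OF assms]]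
  by (simp add: path_connected_imp_connected)

lemma separates_winding_eq:
  assumes "separates T g1" "separates T g2" "z \<notin> regular_set T"
  shows "winding_number g1 z = winding_number g2 z"
proof -
  consider "z = 0" | t where "z \<noteq> 0" "t \<in> T" "qp (t * z) = 0" | t where "z \<noteq> 0" "t \<in> T" "qp (t / z) = 0"
    using assms(3) by (auto simp: regular_set_def)
  thus ?thesis using assms(1,2) unfolding separates_def by cases simp_all
qed

lemma separates_integral_eq:
  assumes "finite T" "separates T g1" "separates T g2" "f holomorphic_on regular_set T"
  shows "contour_integral g1 f = contour_integral g2 f"
  using assms separates_winding_eq[OF assms(2,3)]
  by (intro contour_integral_homologous[OF open_regular_set connected_regular_set, of T])
     (auto simp: separates_def)

lemma qp_q_power_mult_neq_0: "qp x \<noteq> 0 \<Longrightarrow> qp (q ^ n * x) \<noteq> 0"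
  by (auto simp: qp_eq_0_iff) (metis mult.assoc mult.commute power_add)

text \<open>Passing from \<open>t\<close> to \<open>q ^ n * t\<close> only drops points from both
  sequences, and 0 has no points at all. So one curve serves for a whole recurrence in the
  parameters, including its limit.\<close>

lemma separates_mono:
  assumes "separates T g" and sub: "\<And>t'. t' \<in> T' \<Longrightarrow> t' = 0 \<or> (\<exists>t\<in>T. \<exists>n. t' = q ^ n * t)"
  shows "separates T' g"
proof -
  have 1: "\<exists>t\<in>T. qp (t * z) = 0" if t': "t' \<in> T'" and z: "qp (t' * z) = 0" for t' z
  proof -
    have "t' \<noteq> 0" using z by auto
    then obtain t n where t: "t \<in> T" "t' = q ^ n * t" using sub[OF t'] by auto
    have "qp (t * z) = 0" using qp_q_power_mult_neq_0[of "t * z" n] t(2) z by (auto simp: mult_ac)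
    thus ?thesis using t(1) by blast
  qed
  have 2: "\<exists>t\<in>T. qp (t / z) = 0" if "t' \<in> T'" "qp (t' / z) = 0" for t' z
    using 1[OF that(1), of "1 / z"] that(2) by simp
  have "regular_set T \<subseteq> regular_set T'"
    using 1 2 unfolding regular_set_def by blast
  thus ?thesis
    using assms(1) 1 2 unfolding separates_def by blast
qed

text \<open>The inner points accumulate only at 0, so a small circle around 0 encloses all but
  finitely many of them. Each remaining one gets its own small circle, attached by
  \<open>join_closed_paths\<close>. The last hypothesis keeps inner and outer points apart.\<close>

lemma separates_exists:
  assumes T: "finite T" "\<And>t. t \<in> T \<Longrightarrow> t \<noteq> 0"
    and sep: "\<And>t t' n. t \<in> T \<Longrightarrow> t' \<in> T \<Longrightarrow> t * t' * q ^ n \<noteq> 1"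
  obtains g where "separates T g"
proof -
  define I where "I = {z. z \<noteq> 0 \<and> (\<exists>t\<in>T. qp (t / z) = 0)}"
  have I_iff: "z \<in> I \<longleftrightarrow> (\<exists>t\<in>T. \<exists>n. z = t * q ^ n)" for z
    using T by (auto simp: I_def qp_eq_0_iff field_simps)
  \<comment> \<open>For \<open>norm z \<le> R\<close> all \<open>t * z\<close> have norm below 1, so
    this disc contains no outer point.\<close>
  define R where "R = 1 / (1 + (\<Sum>t\<in>T. norm t))"
  have sum_nn: "(\<Sum>t\<in>T. norm t) \<ge> 0" by (intro sum_nonneg) auto
  hence R: "R > 0" by (simp add: R_def)
  have tR: "norm t * R < 1" if "t \<in> T" for t
  proof -
    have "norm t \<le> (\<Sum>t\<in>T. norm t)" using that T by (intro member_le_sum) auto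
    thus ?thesis using sum_nn by (simp add: R_def)
  qed
  \<comment> \<open>Only countably many radii meet an inner point, so one below \<open>R\<close> can
    be chosen that meets none.\<close>
  have "countable (norm ` I)"
    using countable_Compl_regular_set[OF T(1)]
    by (intro countable_image) (rule countable_subset, auto simp: regular_set_def I_def)
  moreover have "uncountable {0<..<R}" using R by (simp add: uncountable_open_interval)
  ultimately obtain r where r: "0 < r" "r < R" "r \<notin> norm ` I"
    by (metis countable_subset greaterThanLessThan_iff subsetI)
  have out: "norm z > r" if "t \<in> T" "qp (t * z) = 0" for t z
  proof (rule ccontr)
    assume "\<not> norm z > r"
    hence "norm t * norm z \<le> norm t * R" using r by (intro mult_left_mono) auto
    also have "\<dots> < 1" by (rule tR) fact
    finally show False using qp_neq_0[of "t * z"] that by (simp add: norm_mult)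
  qed
  have reg_r: "z \<in> regular_set T" if z: "norm z = r" for z
  proof -
    have "z \<noteq> 0" "z \<notin> I" using z r by auto
    moreover have "qp (t * z) \<noteq> 0" if "t \<in> T" for t
      using out[OF that, of z] z by auto
    ultimately show ?thesis unfolding regular_set_def I_def by blast
  qed
  have circ: "path_image (circlepath 0 r) \<subseteq> regular_set T"
    using r reg_r by auto
  define F where "F = {z \<in> I. norm z > r}"
  have "finite F"
  proof (rule finite_subset)
    show "F \<subseteq> (\<Union>t\<in>T. (\<lambda>n. t * q ^ n) ` {n. norm (t * q ^ n) > r})"
      by (auto simp: F_def I_iff)
    have "finite {n. norm (t * q ^ n) > r}" for t
    proof -
      have "(\<lambda>n. norm (t * q ^ n)) \<longlonglongrightarrow> 0"
        by (rule summable_LIMSEQ_zero[OF summable_qp])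
      hence "\<forall>\<^sub>F n in sequentially. norm (t * q ^ n) < r"
        using r by (auto dest: order_tendstoD)
      then obtain n0 where "\<And>n. n \<ge> n0 \<Longrightarrow> norm (t * q ^ n) < r"
        by (auto simp: eventually_sequentially)
      hence "{n. norm (t * q ^ n) > r} \<subseteq> {..<n0}"
        by (auto simp: not_le[symmetric]) (meson less_imp_le not_le)
      thus ?thesis by (rule finite_subset) auto
    qed
    thus "finite (\<Union>t\<in>T. (\<lambda>n. t * q ^ n) ` {n. norm (t * q ^ n) > r})"
      using T by auto
  qed
  have circ_wn: "winding_number (circlepath p d) z = (if dist p z < d then 1 else 0)"
    if "d > 0" "dist p z \<noteq> d" for p z d
  proof (cases "dist p z < d")
    case True
    thus ?thesis by (simp add: winding_number_circlepath dist_norm norm_minus_commute)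
  next
    case False
    hence "z \<notin> cball p d" using that by auto
    thus ?thesis using that False
      by (auto intro!: winding_number_zero_outside[of _ "cball p d"])
  qed
  \<comment> \<open>Induction on the set of inner points outside the circle that are already
    enclosed. The winding number is controlled only off \<open>regular_set T\<close>, which suffices
    and lets the connecting paths be arbitrary.\<close>
  have "\<exists>g. valid_path g \<and> pathfinish g = pathstart g \<and> path_image g \<subseteq> regular_set T \<and>
      (\<forall>z. z \<notin> regular_set T \<longrightarrow> winding_number g z =
         (if norm z < r then 1 else 0) + (if z \<in> F' then 1 else 0))"
    if "F' \<subseteq> F" for F'
    using finite_subset[OF that \<open>finite F\<close>] that
  proof (induction F' rule: finite_induct)
    case empty
    have "norm z \<noteq> r" if "z \<notin> regular_set T" for z
      using that reg_r by blast
    hence "winding_number (circlepath 0 r) z = (if norm z < r then 1 else 0)"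
      if "z \<notin> regular_set T" for z using that circ_wn[of r 0 z] r by simp
    thus ?case using circ by (intro exI[of _ "circlepath 0 r"]) auto
  next
    case (insert p F')
    then obtain g where g: "valid_path g" "pathfinish g = pathstart g" "path_image g \<subseteq> regular_set T"
      and wn: "\<And>z. z \<notin> regular_set T \<Longrightarrow> winding_number g z =
         (if norm z < r then 1 else 0) + (if z \<in> F' then 1 else 0)" by auto
    have p: "p \<in> I" using insert by (auto simp: F_def)
    define Z where "Z = (\<lambda>z. \<Prod>t\<in>T. qp (t * z) * qp (t / z))"
    have Z: "Z z = 0 \<longleftrightarrow> z \<notin> regular_set T" if "z \<noteq> 0" for z
      using T that by (auto simp: Z_def regular_set_def)
    have "of_real r \<in> path_image (circlepath 0 r)" using r by simp
    hence rr: "of_real r \<in> regular_set T" using circ by blast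
    obtain d where d: "d > 0" "ball p d \<subseteq> -{0}" "\<And>z. z \<in> ball p d - {p} \<Longrightarrow> Z z \<noteq> 0"
    proof (rule isolated_zeros[of Z "-{0}" p "of_real r"])
      show "Z holomorphic_on - {0}" unfolding Z_def by (intro holomorphic_intros) auto
      show "Z p = 0" using p Z[of p] by (auto simp: I_def regular_set_def)
      show "Z (of_real r) \<noteq> 0" using Z[of "of_real r"] rr r by auto
      show "connected (-{0::complex})" by (intro connected_punctured_universe) auto
    qed (use p r in \<open>auto simp: I_def\<close>)
    have dreg: "z \<in> regular_set T" if "z \<in> ball p d" "z \<noteq> p" for z
      using that d(2,3) Z[of z] by blast
    have c: "path_image (circlepath p (d/2)) \<subseteq> regular_set T"
      using d(1) dreg by (auto simp: dist_norm)
    obtain g' where g': "valid_path g'" "pathfinish g' = pathstart g'" "path_image g' \<subseteq> regular_set T"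
      and wn': "\<And>z. z \<notin> regular_set T \<Longrightarrow>
        winding_number g' z = winding_number g z + winding_number (circlepath p (d/2)) z"
      by (rule join_closed_paths[OF open_regular_set[OF T(1)] connected_regular_set[OF T(1)] g
          valid_path_circlepath _ c]) (simp, rule that)
    have cw: "winding_number (circlepath p (d/2)) z = (if z = p then 1 else 0)"
      if "z \<notin> regular_set T" for z
    proof (cases "z = p")
      case False
      hence "dist p z \<ge> d" using dreg[of z] that by (meson mem_ball not_le)
      thus ?thesis using d False by (subst circ_wn) auto
    qed (use d in \<open>simp add: winding_number_circlepath_centre\<close>)
    show ?case
    proof (intro exI[of _ g'] conjI allI impI g')
      fix z assume z: "z \<notin> regular_set T"
      show "winding_number g' z = (if norm z < r then 1 else 0) + (if z \<in> insert p F' then 1 else 0)"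
        unfolding wn'[OF z] wn[OF z] cw[OF z] using insert.hyps(2) by simp
    qed
  qed
  from this[OF order.refl] obtain g where g: "valid_path g" "pathfinish g = pathstart g"
    "path_image g \<subseteq> regular_set T"
    and wn: "\<And>z. z \<notin> regular_set T \<Longrightarrow> winding_number g z =
         (if norm z < r then 1 else 0) + (if z \<in> F then 1 else 0)" by auto
  have "separates T g" unfolding separates_def
  proof (intro conjI ballI allI impI g)
    show "winding_number g 0 = 1" using wn[of 0] r by (auto simp: regular_set_def F_def I_def)
  next
    fix t z assume t: "t \<in> T" "z \<noteq> 0" "qp (t / z) = 0"
    hence "z \<in> I" by (auto simp: I_def)
    hence "norm z \<noteq> r" using r by auto
    moreover have "z \<notin> regular_set T" using t by (auto simp: regular_set_def)
    ultimately show "winding_number g z = 1" using wn[of z] \<open>z \<in> I\<close> by (auto simp: F_def)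
  next
    fix t z assume t: "t \<in> T" "z \<noteq> 0" "qp (t * z) = 0"
    have "z \<notin> I"
    proof
      assume "z \<in> I"
      then obtain t' n where "t' \<in> T" "z = t' * q ^ n" by (auto simp: I_iff)
      moreover obtain m where "t * z * q ^ m = 1" using t by (auto simp: qp_eq_0_iff)
      ultimately show False using sep[of t t' "n + m"] t by (simp add: power_add mult_ac)
    qed
    moreover have "z \<notin> regular_set T" using t by (auto simp: regular_set_def)
    ultimately show "winding_number g z = 0" using wn[of z] out[OF t(1,3)] by (auto simp: F_def)
  qed
  thus ?thesis by (rule that)
qed

lemma separates_nonzero:
  assumes "separates T g" "z \<in> path_image g"
  shows "z \<noteq> 0"
  using assms by (auto simp: separates_def regular_set_def)

lemma separates_subset:
  assumes "separates T g" "T' \<subseteq> insert 0 T"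
  shows "separates T' g"
proof (rule separates_mono[OF assms(1)])
  fix t' assume "t' \<in> T'"
  moreover have "t' = q ^ 0 * t'" by simp
  ultimately show "t' = 0 \<or> (\<exists>t\<in>T. \<exists>n. t' = q ^ n * t)" using assms(2) by blast
qed

text \<open>The function \<open>f\<close> has poles only where \<open>qp (q * t * u)\<close> or
  \<open>qp (t / u)\<close> vanishes: each outer sequence has lost its first point
  \<open>1 / t\<close>. The curve divided by \<open>q\<close> still has the inner points inside and
  the shortened outer sequences outside, hence may replace \<open>g\<close>. Consequently
  differences \<open>f (u / q) - f u\<close> integrate to 0 against \<open>1 / u\<close>.\<close>

lemma separates_q_shift:
  assumes T: "finite T" and g: "separates T g"
    and f: "f holomorphic_on {u. u \<noteq> 0 \<and> (\<forall>t\<in>T. qp (q * t * u) \<noteq> 0 \<and> qp (t / u) \<noteq> 0)}"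
  shows "contour_integral g (\<lambda>u. f (u / q) / u) = contour_integral g (\<lambda>u. f u / u)"
proof -
  define S where "S = {u. u \<noteq> 0 \<and> (\<forall>t\<in>T. qp (q * t * u) \<noteq> 0 \<and> qp (t / u) \<noteq> 0)}"
  have g': "valid_path g" "pathfinish g = pathstart g" "path_image g \<subseteq> regular_set T"
    using g by (auto simp: separates_def)
  have rec: "qp x = 0" if "qp (q * x) = 0" for x using that qp_rec[of x] by simp
  have reg: "regular_set T \<subseteq> S"
    using rec by (fastforce simp: S_def regular_set_def mult.assoc)
  have Seq: "S = -{0} \<inter> (\<lambda>u. \<Prod>t\<in>T. qp (q * t * u) * qp (t / u)) -` (-{0})"
    using T by (auto simp: S_def)
  have S: "open S"
    unfolding Seq by (rule continuous_open_preimage) (auto intro!: continuous_intros)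
  have "connected S"
  proof -
    have "countable (- S)"
      by (rule countable_subset[OF _ countable_Compl_regular_set[OF T]]) (use reg in auto)
    thus ?thesis using path_connected_complement_countable[of "- S"]
      by (simp add: path_connected_imp_connected)
  qed
  define h where "h = (\<lambda>t. inverse q * g t)"
  have h: "valid_path h" "pathfinish h = pathstart h"
    unfolding h_def using g' by (auto intro!: valid_path_scale simp: pathfinish_def pathstart_def)
  have h_im: "path_image h \<subseteq> S"
  proof
    fix u assume "u \<in> path_image h"
    then obtain v where v: "v \<in> path_image g" "u = inverse q * v"
      unfolding h_def path_image_scale by auto
    hence "v \<in> regular_set T" using g' by auto
    hence "qp (q * t * u) \<noteq> 0 \<and> qp (t / u) \<noteq> 0" if "t \<in> T" for t
      using that rec[of "t / v"] v by (auto simp: regular_set_def field_simps)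
    thus "u \<in> S" using v \<open>v \<in> regular_set T\<close> by (auto simp: S_def regular_set_def)
  qed
  have wn: "winding_number h z = winding_number g z" if "z \<notin> S" for z
  proof -
    have sc: "winding_number h z = winding_number g (q * z)" if "q * z \<notin> regular_set T"
      using winding_number_scale[OF g'(1), of "inverse q" "q * z"] g' that
      by (auto simp: h_def mult.assoc[symmetric])
    consider "z = 0" | t where "z \<noteq> 0" "t \<in> T" "qp (q * t * z) = 0"
      | t where "z \<noteq> 0" "t \<in> T" "qp (t / z) = 0"
      using \<open>z \<notin> S\<close> by (auto simp: S_def)
    thus ?thesis
    proof cases
      case 1
      thus ?thesis using sc by (auto simp: regular_set_def)
    next
      case 2
      hence *: "qp (t * (q * z)) = 0" "qp (t * z) = 0" using rec[of "t * z"] by (auto simp: mult_ac)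
      hence "q * z \<notin> regular_set T" using 2 by (auto simp: regular_set_def)
      thus ?thesis using sc * 2 g by (auto simp: separates_def)
    next
      case 3
      then obtain n where "t / z * q ^ n = 1" by (auto simp: qp_eq_0_iff)
      hence "t / (q * z) * q ^ Suc n = 1" by (simp add: field_simps)
      hence *: "qp (t / (q * z)) = 0" unfolding qp_eq_0_iff by blast
      hence "q * z \<notin> regular_set T" using 3 by (auto simp: regular_set_def)
      thus ?thesis using sc * 3 g by (auto simp: separates_def)
    qed
  qed
  have "(\<lambda>u. f u / u) holomorphic_on S"
    using f unfolding S_def by (intro holomorphic_intros) auto
  from contour_integral_homologous[OF S \<open>connected S\<close> this h h_im g'(1,2) _ wn] reg g'(3)
  have "contour_integral h (\<lambda>u. f u / u) = contour_integral g (\<lambda>u. f u / u)" by auto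
  moreover have "contour_integral h (\<lambda>u. f u / u) = contour_integral g (\<lambda>u. f (u / q) / u)"
    unfolding h_def using g' by (subst contour_integral_scale) (auto simp: field_simps)
  ultimately show ?thesis by simp
qed

subsection \<open>The Nassrallah-Rahman integral\<close>

text \<open>The numerator parameter is the product of the five denominator parameters; if one of
  these is 0, the integrand is that of the Askey-Wilson integral.\<close>

definition nr_integrand ::
    "complex \<Rightarrow> complex \<Rightarrow> complex \<Rightarrow> complex \<Rightarrow> complex \<Rightarrow> complex \<Rightarrow> complex" where
  "nr_integrand t1 t2 t3 t4 t5 u =
     qp (u\<^sup>2) * qp (1 / u\<^sup>2) * qp (t1 * t2 * t3 * t4 * t5 * u) * qp (t1 * t2 * t3 * t4 * t5 / u) /
     (qp (t1 * u) * qp (t1 / u) * qp (t2 * u) * qp (t2 / u) * qp (t3 * u) * qp (t3 / u) *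
      qp (t4 * u) * qp (t4 / u) * qp (t5 * u) * qp (t5 / u))"

lemma nr_integrand_holomorphic:
  "nr_integrand t1 t2 t3 t4 t5 holomorphic_on regular_set {t1, t2, t3, t4, t5}"
  unfolding nr_integrand_def regular_set_def by (intro holomorphic_intros) auto

text \<open>Here \<open>t\<close> is the parameter to be shifted, and \<open>e1\<close> to
  \<open>e4\<close> are the elementary symmetric functions of the other four. \<open>P\<close> and
  \<open>P'\<close> are the products of the factors \<open>1 - t_j * u\<close> and
  \<open>1 - t_j / u\<close>, \<open>c1\<close> is that of \<open>1 - t * t_j\<close>, and
  \<open>c2\<close> that of \<open>1 - t * e4 / t_j\<close>. Symmetric functions keep the polynomial
  identity small enough for direct verification.\<close>

lemma nr_polynomial_identity:
  fixes t u e1 e2 e3 e4 :: complex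
  assumes "A = t * e4" "u \<noteq> 0"
    "P = 1 - e1 * u + e2 * u^2 - e3 * u^3 + e4 * u^4"
    "P' = 1 - e1 / u + e2 / u^2 - e3 / u^3 + e4 / u^4"
    "c1 = 1 - e1 * t + e2 * t^2 - e3 * t^3 + e4 * t^4"
    "c2 = 1 - t * e3 + t^2 * e2 * e4 - t^3 * e1 * e4^2 + t^4 * e4^3"
  shows "(1 - u^2) * (1 - 1/u^2) * (c2 * ((1 - t*u) * (1 - t/u)) - c1 * ((1 - A*u) * (1 - A/u))) =
    t * (1 - A*t) * (- u * (1 - u^2) * (1 - A*u) * (1 - t/u) * P'
                     - (1 - 1/u^2) * (1 - A/u) * (1 - t*u) * P / u)"
  unfolding assms(1,3-6) using assms(2) by (simp add: divide_simps) algebra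

text \<open>\<open>G u\<close> is the integrand times a rational function, namely
  \<open>t1 * (1 - A * t1) / (u * (1 - u^2) * (1 - A * u))\<close> times the five factors
  \<open>1 - t * u\<close>: a certificate as in creative telescoping. After division by the common
  infinite products the polynomial identity above remains.\<close>

lemma nr_certificate:
  fixes t1 t2 t3 t4 t5 :: complex
  defines "A \<equiv> t1 * t2 * t3 * t4 * t5"
  defines "G \<equiv> (\<lambda>u. t1 * (1 - A * t1) * (qp (q * u\<^sup>2) * qp (1 / u\<^sup>2) * qp (q * A * u) * qp (A / u)) /
     (u * (qp (q * t1 * u) * qp (t1 / u) * qp (q * t2 * u) * qp (t2 / u) * qp (q * t3 * u) * qp (t3 / u) *
      qp (q * t4 * u) * qp (t4 / u) * qp (q * t5 * u) * qp (t5 / u))))"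
  assumes u: "u \<in> regular_set {t1, t2, t3, t4, t5}"
  shows "(1 - t1*t3*t4*t5) * (1 - t1*t2*t4*t5) * (1 - t1*t2*t3*t5) * (1 - t1*t2*t3*t4) *
           nr_integrand (q * t1) t2 t3 t4 t5 u -
         (1 - t1*t2) * (1 - t1*t3) * (1 - t1*t4) * (1 - t1*t5) * nr_integrand t1 t2 t3 t4 t5 u
       = G (u / q) - G u"
proof -
  have u0: "u \<noteq> 0" using u by (simp add: regular_set_def)
  define X where "X = (\<lambda>t. qp (q * (t * u)))"
  define Y where "Y = (\<lambda>t. qp (q * (t / u)))"
  have X: "qp (t * u) = (1 - t * u) * X t" for t unfolding X_def by (rule qp_rec)
  have Y: "qp (t / u) = (1 - t / u) * Y t" for t unfolding Y_def by (rule qp_rec)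
  have X': "qp (q * t * u) = X t" for t by (simp add: X_def mult_ac)
  have Y': "qp (q * t / u) = Y t" for t by (simp add: Y_def)
  define \<omega> where "\<omega> = qp (q * u\<^sup>2) * qp (q * (1 / u\<^sup>2))"
  \<comment> \<open>Both integrands and both values of \<open>G\<close> are rational multiples of
    \<open>M / D\<close>: \<open>M\<close> collects the infinite products with all arguments
    multiplied by \<open>q\<close>, and \<open>D\<close> the ten leading factors of the
    denominators.\<close>
  define M where "M = \<omega> * X A * Y A / (X t1 * Y t1 * X t2 * Y t2 * X t3 * Y t3 * X t4 * Y t4 * X t5 * Y t5)"
  define P where "P = (1 - t2 * u) * (1 - t3 * u) * (1 - t4 * u) * (1 - t5 * u)"
  define P' where "P' = (1 - t2 / u) * (1 - t3 / u) * (1 - t4 / u) * (1 - t5 / u)"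
  define D where "D = (1 - t1 * u) * P * (1 - t1 / u) * P'"
  have nz: "1 - t * u \<noteq> 0" "1 - t / u \<noteq> 0" if "t \<in> {t1, t2, t3, t4, t5}" for t
    using u that X[of t] Y[of t] unfolding regular_set_def by auto
  have nz': "(1 - t1 * u) * P \<noteq> 0" "(1 - t1 / u) * P' \<noteq> 0"
    unfolding P_def P'_def using nz by auto
  have cancel: "M / x = y * (M / D)" if "D = x * y" "y \<noteq> 0" for x y
    using that by simp
  have sq: "qp (u\<^sup>2) * qp (1 / u\<^sup>2) = (1 - u\<^sup>2) * (1 - 1 / u\<^sup>2) * \<omega>"
    unfolding \<omega>_def using qp_rec[of "u\<^sup>2"] qp_rec[of "1 / u\<^sup>2"] by simp
  have 1: "nr_integrand t1 t2 t3 t4 t5 u =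
      (1 - u\<^sup>2) * (1 - 1 / u\<^sup>2) * ((1 - A * u) * (1 - A / u)) * (M / D)"
    unfolding nr_integrand_def A_def[symmetric] sq X Y M_def D_def P_def P'_def
    by (simp add: mult_ac)
  have 2: "nr_integrand (q * t1) t2 t3 t4 t5 u =
      (1 - u\<^sup>2) * (1 - 1 / u\<^sup>2) * ((1 - t1 * u) * (1 - t1 / u)) * (M / D)"
  proof -
    have "q * t1 * t2 * t3 * t4 * t5 = q * A" by (simp add: A_def)
    hence "nr_integrand (q * t1) t2 t3 t4 t5 u = (1 - u\<^sup>2) * (1 - 1 / u\<^sup>2) * (M / (P * P'))"
      unfolding nr_integrand_def sq
      by (simp only: X' Y') (simp add: X Y M_def P_def P'_def mult_ac)
    also have "M / (P * P') = ((1 - t1 * u) * (1 - t1 / u)) * (M / D)"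
      using nz[of t1] by (intro cancel) (auto simp: D_def mult_ac)
    finally show ?thesis by (simp add: mult_ac)
  qed
  have 3: "G u = t1 * (1 - A * t1) * ((1 - 1 / u\<^sup>2) * (1 - A / u) * (1 - t1 * u) * P / u) * (M / D)"
  proof -
    have "G u = t1 * (1 - A * t1) * ((1 - 1 / u\<^sup>2) * (1 - A / u) / u) * (M / ((1 - t1 / u) * P'))"
      unfolding G_def X' Y qp_rec[of "1 / u\<^sup>2"] M_def P'_def \<omega>_def by (simp add: mult_ac)
    also have "M / ((1 - t1 / u) * P') = (1 - t1 * u) * P * (M / D)"
      by (intro cancel) (use nz' in \<open>simp_all add: D_def mult_ac\<close>)
    finally show ?thesis by (simp add: mult_ac)
  qed
  have 4: "G (u / q) = t1 * (1 - A * t1) * (- u * (1 - u\<^sup>2) * (1 - A * u) * (1 - t1 / u) * P') * (M / D)"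
  proof -
    have X1: "qp (q * t * (u / q)) = (1 - t * u) * X t" for t using X[of t] by simp
    have Y1: "qp (t / (u / q)) = Y t" for t by (simp add: Y_def mult_ac)
    have "qp (u\<^sup>2 / q) = (1 - u\<^sup>2 / q) * ((1 - u\<^sup>2) * qp (q * u\<^sup>2))"
      using qp_rec[of "u\<^sup>2 / q"] qp_rec[of "u\<^sup>2"] by simp
    moreover have "qp (q * (1 / u\<^sup>2)) = (1 - q / u\<^sup>2) * qp (q\<^sup>2 / u\<^sup>2)"
      using qp_rec[of "q / u\<^sup>2"] by (simp add: power2_eq_square)
    moreover have "1 - u\<^sup>2 / q = - (u\<^sup>2 / q) * (1 - q / u\<^sup>2)"
      using u0 by (simp add: field_simps)
    ultimately have sq': "qp (q * (u / q)\<^sup>2) * qp (1 / (u / q)\<^sup>2) = - (u\<^sup>2 / q) * ((1 - u\<^sup>2) * \<omega>)"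
      by (simp add: \<omega>_def power_divide power2_eq_square)
    have "G (u / q) = t1 * (1 - A * t1) * (- u * (1 - u\<^sup>2) * (1 - A * u)) * (M / ((1 - t1 * u) * P))"
      unfolding G_def X1 Y1 sq' M_def P_def using u0 by (simp add: mult_ac power2_eq_square)
    also have "M / ((1 - t1 * u) * P) = (1 - t1 / u) * P' * (M / D)"
      by (intro cancel) (use nz' in \<open>simp_all add: D_def mult_ac\<close>)
    finally show ?thesis by (simp add: mult_ac)
  qed
  define e1 where "e1 = t2 + t3 + t4 + t5"
  define e2 where "e2 = t2*t3 + t2*t4 + t2*t5 + t3*t4 + t3*t5 + t4*t5"
  define e3 where "e3 = t2*t3*t4 + t2*t3*t5 + t2*t4*t5 + t3*t4*t5"
  define e4 where "e4 = t2*t3*t4*t5"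
  note e = e1_def e2_def e3_def e4_def
  have "(1 - u\<^sup>2) * (1 - 1 / u\<^sup>2) *
      ((1 - t1*t3*t4*t5) * (1 - t1*t2*t4*t5) * (1 - t1*t2*t3*t5) * (1 - t1*t2*t3*t4) *
         ((1 - t1 * u) * (1 - t1 / u)) -
       (1 - t1*t2) * (1 - t1*t3) * (1 - t1*t4) * (1 - t1*t5) * ((1 - A * u) * (1 - A / u))) =
    t1 * (1 - A * t1) * (- u * (1 - u\<^sup>2) * (1 - A * u) * (1 - t1 / u) * P'
                     - (1 - 1 / u\<^sup>2) * (1 - A / u) * (1 - t1 * u) * P / u)"
  proof (rule nr_polynomial_identity[where ?e1.0 = e1 and ?e2.0 = e2 and ?e3.0 = e3 and ?e4.0 = e4])
    show "A = t1 * e4" by (simp add: A_def e)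
    show "P = 1 - e1 * u + e2 * u^2 - e3 * u^3 + e4 * u^4"
      unfolding P_def e by algebra
    have "P' = 1 - e1 * (1/u) + e2 * (1/u)^2 - e3 * (1/u)^3 + e4 * (1/u)^4"
      unfolding P'_def e divide_inverse[of _ u] by algebra
    thus "P' = 1 - e1 / u + e2 / u^2 - e3 / u^3 + e4 / u^4" by (simp add: power_divide)
    show "(1 - t1*t2) * (1 - t1*t3) * (1 - t1*t4) * (1 - t1*t5) =
      1 - e1 * t1 + e2 * t1^2 - e3 * t1^3 + e4 * t1^4" unfolding e by algebra
    show "(1 - t1*t3*t4*t5) * (1 - t1*t2*t4*t5) * (1 - t1*t2*t3*t5) * (1 - t1*t2*t3*t4) =
      1 - t1 * e3 + t1^2 * e2 * e4 - t1^3 * e1 * e4^2 + t1^4 * e4^3" unfolding e by algebra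
  qed fact
  moreover have "c2 * (w * f1 * m) - c1 * (w * f2 * m) = k * a * m - k * b * m"
    if "w * (c2 * f1 - c1 * f2) = k * (a - b)" for c1 c2 w f1 f2 m k a b :: complex
    using that by algebra
  ultimately show ?thesis unfolding 1 2 3 4 by blast
qed

definition nr_integral ::
    "(real \<Rightarrow> complex) \<Rightarrow> complex \<Rightarrow> complex \<Rightarrow> complex \<Rightarrow> complex \<Rightarrow> complex \<Rightarrow> complex" where
  "nr_integral g t1 t2 t3 t4 t5 = contour_integral g (\<lambda>u. nr_integrand t1 t2 t3 t4 t5 u / u)"

lemma nr_integrable:
  assumes "separates {t1, t2, t3, t4, t5} g"
  shows "(\<lambda>u. nr_integrand t1 t2 t3 t4 t5 u / u) contour_integrable_on g"
proof (rule contour_integrable_holomorphic_simple)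
  show "(\<lambda>u. nr_integrand t1 t2 t3 t4 t5 u / u) holomorphic_on regular_set {t1, t2, t3, t4, t5}"
    by (intro holomorphic_intros nr_integrand_holomorphic) (auto simp: regular_set_def)
qed (use assms in \<open>auto simp: separates_def open_regular_set\<close>)

lemma contour_integral_lincomb:
  assumes "f contour_integrable_on g" "h contour_integrable_on g"
  shows "contour_integral g (\<lambda>u. c * f u - d * h u) =
    c * contour_integral g f - d * contour_integral g h"
  using assms by (simp add: contour_integral_diff contour_integral_lmul contour_integrable_lmul)

text \<open>The certificate is integrated along the contour. Its right hand side gives 0 by
  \<open>separates_q_shift\<close>, since the outer poles of \<open>G\<close> begin one step later
  than those of the integrand.\<close>

lemma nr_shift:
  assumes g: "separates {t1, t2, t3, t4, t5} g"
  shows "(1 - t1*t3*t4*t5) * (1 - t1*t2*t4*t5) * (1 - t1*t2*t3*t5) * (1 - t1*t2*t3*t4) *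
           nr_integral g (q * t1) t2 t3 t4 t5 =
         (1 - t1*t2) * (1 - t1*t3) * (1 - t1*t4) * (1 - t1*t5) * nr_integral g t1 t2 t3 t4 t5"
    (is "?c2 * _ = ?c1 * _")
proof -
  define A where "A = t1 * t2 * t3 * t4 * t5"
  define G where "G = (\<lambda>u. t1 * (1 - A * t1) * (qp (q * u\<^sup>2) * qp (1 / u\<^sup>2) * qp (q * A * u) * qp (A / u)) /
     (u * (qp (q * t1 * u) * qp (t1 / u) * qp (q * t2 * u) * qp (t2 / u) * qp (q * t3 * u) * qp (t3 / u) *
      qp (q * t4 * u) * qp (t4 / u) * qp (q * t5 * u) * qp (t5 / u))))"
  let ?T = "{t1, t2, t3, t4, t5}"
  have G: "G holomorphic_on {u. u \<noteq> 0 \<and> (\<forall>t\<in>?T. qp (q * t * u) \<noteq> 0 \<and> qp (t / u) \<noteq> 0)}"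
    unfolding G_def by (intro holomorphic_intros) auto
  have g': "separates {q * t1, t2, t3, t4, t5} g"
    by (rule separates_mono[OF g]) (auto intro: exI[of _ 0] exI[of _ 1])
  have [simp]: "(\<lambda>u. nr_integrand t1 t2 t3 t4 t5 u / u) contour_integrable_on g"
    "(\<lambda>u. nr_integrand (q * t1) t2 t3 t4 t5 u / u) contour_integrable_on g"
    using nr_integrable g g' by blast+
  have cert: "?c2 * (nr_integrand (q * t1) t2 t3 t4 t5 u / u) - ?c1 * (nr_integrand t1 t2 t3 t4 t5 u / u)
     = G (u / q) / u - G u / u" if "u \<in> path_image g" for u
  proof -
    have "u \<in> regular_set ?T" using g that by (auto simp: separates_def)
    from nr_certificate[OF this] show ?thesis
      unfolding G_def A_def by (simp only: times_divide_eq_right flip: diff_divide_distrib)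
  qed
  have rec: "qp x = 0" if "qp (q * x) = 0" for x using that qp_rec[of x] by simp
  have i1: "(\<lambda>u. G u / u) contour_integrable_on g"
  proof (rule contour_integrable_holomorphic_simple[of _ "regular_set ?T"])
    have "regular_set ?T \<subseteq> {u. u \<noteq> 0 \<and> (\<forall>t\<in>?T. qp (q * t * u) \<noteq> 0 \<and> qp (t / u) \<noteq> 0)}"
      using rec by (fastforce simp: regular_set_def mult.assoc)
    thus "(\<lambda>u. G u / u) holomorphic_on regular_set ?T"
      by (intro holomorphic_intros holomorphic_on_subset[OF G]) (auto simp: regular_set_def)
  qed (use g in \<open>auto simp: separates_def open_regular_set\<close>)
  have i2: "(\<lambda>u. G (u / q) / u) contour_integrable_on g"
  proof (rule contour_integrable_holomorphic_simple[of _ "regular_set ?T"])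
    have "(\<lambda>u. G (u / q)) holomorphic_on regular_set ?T"
    proof (rule holomorphic_on_compose_gen[unfolded o_def, OF _ G])
      show "(\<lambda>u. u / q) ` regular_set ?T \<subseteq> {u. u \<noteq> 0 \<and> (\<forall>t\<in>?T. qp (q * t * u) \<noteq> 0 \<and> qp (t / u) \<noteq> 0)}"
      proof (rule image_subsetI)
        fix u assume u: "u \<in> regular_set ?T"
        have "qp (q * t * (u / q)) \<noteq> 0 \<and> qp (t / (u / q)) \<noteq> 0" if "t \<in> ?T" for t
        proof -
          have *: "qp (t * u) \<noteq> 0" "qp (t / u) \<noteq> 0"
            using u that unfolding regular_set_def by blast+
          have "q * t * (u / q) = t * u" "t / (u / q) = q * (t / u)" by auto
          thus ?thesis using * rec[of "t / u"] by metis
        qed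
        thus "u / q \<in> {u. u \<noteq> 0 \<and> (\<forall>t\<in>?T. qp (q * t * u) \<noteq> 0 \<and> qp (t / u) \<noteq> 0)}"
          using u unfolding regular_set_def by simp
      qed
    qed (auto intro!: holomorphic_intros)
    thus "(\<lambda>u. G (u / q) / u) holomorphic_on regular_set ?T"
      by (intro holomorphic_intros) (auto simp: regular_set_def)
  qed (use g in \<open>auto simp: separates_def open_regular_set\<close>)
  have "?c2 * nr_integral g (q * t1) t2 t3 t4 t5 - ?c1 * nr_integral g t1 t2 t3 t4 t5 =
    contour_integral g (\<lambda>u. ?c2 * (nr_integrand (q * t1) t2 t3 t4 t5 u / u)
        - ?c1 * (nr_integrand t1 t2 t3 t4 t5 u / u))"
    unfolding nr_integral_def
    by (rule contour_integral_lincomb[symmetric]) simp_all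
  also have "\<dots> = contour_integral g (\<lambda>u. G (u / q) / u - G u / u)"
    by (rule contour_integral_cong) (use cert in auto)
  also have "\<dots> = 0"
    using separates_q_shift[OF _ g G] i1 i2 by (subst contour_integral_diff) auto
  finally show ?thesis by simp
qed

lemma nr_limit:
  assumes g: "separates {t1, t2, t3, t4, t5} g"
  shows "(\<lambda>n. nr_integral g (q ^ n * t1) t2 t3 t4 t5) \<longlonglongrightarrow> nr_integral g 0 t2 t3 t4 t5"
proof -
  define den where "den = (\<lambda>(t, u). qp (t * u) * qp (t / u) * qp (t2 * u) * qp (t2 / u) * qp (t3 * u) *
    qp (t3 / u) * qp (t4 * u) * qp (t4 / u) * qp (t5 * u) * qp (t5 / u))"
  define W where "W = {p :: complex \<times> complex. snd p \<noteq> 0} \<inter> den -` (-{0})"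
  have o: "open {p :: complex \<times> complex. snd p \<noteq> 0}"
    by (intro open_Collect_neq continuous_intros)
  have "open W" unfolding W_def
    by (rule continuous_open_preimage[OF _ o])
       (auto simp: den_def case_prod_unfold intro!: continuous_intros)
  moreover have "(0, z) \<in> W" if "z \<in> path_image g" for z
    using g that by (auto simp: W_def den_def separates_def regular_set_def)
  moreover have "continuous_on W (\<lambda>(t, u). nr_integrand t t2 t3 t4 t5 u / u)"
    unfolding nr_integrand_def case_prod_unfold
    by (intro continuous_intros) (auto simp: W_def den_def)
  moreover have "(\<lambda>u. nr_integrand t t2 t3 t4 t5 u / u) holomorphic_on {u. (t, u) \<in> W}" for t
    unfolding nr_integrand_def
    by (intro holomorphic_intros) (auto simp: W_def den_def)
  ultimately have "((\<lambda>t. nr_integral g t t2 t3 t4 t5) \<longlongrightarrow> nr_integral g 0 t2 t3 t4 t5) (nhds 0)"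
    unfolding nr_integral_def
    by (intro contour_integral_param_tendsto) (use g in \<open>auto simp: separates_def\<close>)
  moreover have "(\<lambda>n. q ^ n * t1) \<longlonglongrightarrow> 0"
    using q_lt by (intro tendsto_mult_left_zero LIMSEQ_power_zero)
  ultimately show ?thesis
    by (rule filterlim_compose)
qed

text \<open>The parameter runs through \<open>q ^ n * t1\<close> to 0. After multiplication by the
  factors \<open>qp (x * t_j)\<close> the recurrence involves only factors of the form
  \<open>1 - C * q ^ n\<close>, whose products converge to the infinite products on the
  right.\<close>

lemma nr_reduce:
  assumes g: "separates {t1, t2, t3, t4, t5} g"
  shows "nr_integral g t1 t2 t3 t4 t5 * (qp (t1*t2) * qp (t1*t3) * qp (t1*t4) * qp (t1*t5)) =
    qp (t1*t3*t4*t5) * qp (t1*t2*t4*t5) * qp (t1*t2*t3*t5) * qp (t1*t2*t3*t4) *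
    nr_integral g 0 t2 t3 t4 t5"
proof -
  define J where "J = (\<lambda>x. nr_integral g x t2 t3 t4 t5 * (qp (x*t2) * qp (x*t3) * qp (x*t4) * qp (x*t5)))"
  define c where "c = (\<lambda>n::nat. (1 - t1*t3*t4*t5 * q^n) * (1 - t1*t2*t4*t5 * q^n) *
      (1 - t1*t2*t3*t5 * q^n) * (1 - t1*t2*t3*t4 * q^n))"
  have step: "J (q ^ n * t1) = c n * J (q ^ Suc n * t1)" for n
  proof -
    let ?x = "q ^ n * t1"
    have "separates {?x, t2, t3, t4, t5} g"
      by (rule separates_mono[OF g]) (auto intro: exI[of _ 0] exI[of _ n])
    note sh = nr_shift[OF this]
    have "J ?x = ((1 - ?x*t2) * (1 - ?x*t3) * (1 - ?x*t4) * (1 - ?x*t5) * nr_integral g ?x t2 t3 t4 t5) *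
        (qp (q*(?x*t2)) * qp (q*(?x*t3)) * qp (q*(?x*t4)) * qp (q*(?x*t5)))"
      unfolding J_def qp_rec[of "?x * _"] by (simp only: mult_ac)
    also have "\<dots> = c n * J (q ^ Suc n * t1)"
      unfolding sh[symmetric] unfolding c_def J_def by (simp only: power_Suc mult_ac)
    finally show ?thesis .
  qed
  have "J t1 = (\<Prod>k<n. c k) * J (q ^ n * t1)" for n
  proof (induction n)
    case (Suc n)
    thus ?case using step[of n] by simp
  qed simp
  moreover have "(\<lambda>n. (\<Prod>k<n. c k) * J (q ^ n * t1)) \<longlonglongrightarrow>
      (qp (t1*t3*t4*t5) * qp (t1*t2*t4*t5) * qp (t1*t2*t3*t5) * qp (t1*t2*t3*t4)) *
      (nr_integral g 0 t2 t3 t4 t5 * (qp (0*t2) * qp (0*t3) * qp (0*t4) * qp (0*t5)))"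
    unfolding c_def J_def prod.distrib using q_lt
    by (intro tendsto_intros qp_LIMSEQ nr_limit[OF g] tendsto_mult_left_zero LIMSEQ_power_zero)
  ultimately have "(\<lambda>n. J t1) \<longlonglongrightarrow> (qp (t1*t3*t4*t5) * qp (t1*t2*t4*t5) * qp (t1*t2*t3*t5) *
      qp (t1*t2*t3*t4)) * nr_integral g 0 t2 t3 t4 t5"
    by simp
  thus ?thesis unfolding J_def by (simp add: LIMSEQ_const_iff)
qed

text \<open>The integral is symmetric, so each parameter can be sent to 0 in turn. As soon as one
  parameter is 0, the products of four parameters containing it contribute \<open>qp 0 = 1\<close>;
  the second reduction therefore yields only the factor of \<open>t2*t3*t4*t5\<close>, and the later
  ones none.\<close>

lemma nr_product:
  assumes g: "separates {t1, t2, t3, t4, t5} g"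
  shows "nr_integral g t1 t2 t3 t4 t5 *
      (qp (t1*t2) * qp (t1*t3) * qp (t1*t4) * qp (t1*t5) * qp (t2*t3) * qp (t2*t4) * qp (t2*t5) *
       qp (t3*t4) * qp (t3*t5) * qp (t4*t5)) =
    qp (t1*t3*t4*t5) * qp (t1*t2*t4*t5) * qp (t1*t2*t3*t5) * qp (t1*t2*t3*t4) * qp (t2*t3*t4*t5) *
    nr_integral g 0 0 0 0 0"
proof -
  have sym: "nr_integral g x1 x2 x3 x4 x5 = nr_integral g x2 x1 x3 x4 x5"
    "nr_integral g x1 x2 x3 x4 x5 = nr_integral g x3 x2 x1 x4 x5"
    "nr_integral g x1 x2 x3 x4 x5 = nr_integral g x4 x2 x3 x1 x5"
    "nr_integral g x1 x2 x3 x4 x5 = nr_integral g x5 x2 x3 x4 x1" for x1 x2 x3 x4 x5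
    unfolding nr_integral_def nr_integrand_def by (simp_all only: mult_ac)
  have s: "separates T' g" if "T' \<subseteq> {0, t1, t2, t3, t4, t5}" for T'
    by (rule separates_subset[OF g]) (use that in auto)
  note r1 = nr_reduce[OF g]
  have r2: "nr_integral g 0 t2 t3 t4 t5 * (qp (t2*t3) * qp (t2*t4) * qp (t2*t5)) =
      qp (t2*t3*t4*t5) * nr_integral g 0 0 t3 t4 t5"
    using nr_reduce[of t2 0 t3 t4 t5 g] s sym(1)[of t2 0] by simp
  have r3: "nr_integral g 0 0 t3 t4 t5 * (qp (t3*t4) * qp (t3*t5)) = nr_integral g 0 0 0 t4 t5"
    using nr_reduce[of t3 0 0 t4 t5 g] s sym(2)[of t3 0 0] by simp
  have r4: "nr_integral g 0 0 0 t4 t5 * qp (t4*t5) = nr_integral g 0 0 0 0 t5"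
    using nr_reduce[of t4 0 0 0 t5 g] s sym(3)[of t4 0 0 0] by simp
  have r5: "nr_integral g 0 0 0 0 t5 = nr_integral g 0 0 0 0 0"
    using nr_reduce[of t5 0 0 0 0 g] s sym(4)[of t5 0 0 0 0] by simp
  show ?thesis using r1 r2 r3 r4 r5 by algebra
qed

section \<open>The constant of the Nassrallah-Rahman integral\<close>

lemma qp_square:
  assumes s: "s\<^sup>2 = q"
  shows "qp (u\<^sup>2) = qp u * qp (- u) * qp (s * u) * qp (- (s * u))"
proof -
  define f where "f = (\<lambda>u. qp u * qp (- u) * qp (s * u) * qp (- (s * u)))"
  have ns: "norm s < 1"
  proof -
    have "norm s ^ 2 < 1\<^sup>2" using s q_lt by (simp flip: norm_power)
    thus ?thesis by (rule power_less_imp_less_base) simp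
  qed
  have ss: "s * (s * x) = q * x" for x
    using s by (simp add: power2_eq_square mult.assoc[symmetric])
  have step: "f u = (1 - u\<^sup>2) * f (s * u)" for u
  proof -
    have "f u = ((1 - u) * (1 + u)) * (qp (s * (s * u)) * qp (- (s * (s * u))) * qp (s * u) * qp (- (s * u)))"
      unfolding f_def qp_rec[of u] qp_rec[of "-u"] ss by (simp add: mult_ac)
    thus ?thesis by (simp add: f_def power2_eq_square algebra_simps)
  qed
  have "f u = (\<Prod>i<n. 1 - u\<^sup>2 * q ^ i) * f (s ^ n * u)" for n
  proof (induction n)
    case (Suc n)
    have "(s ^ n)\<^sup>2 = (s\<^sup>2) ^ n"
      unfolding power_mult[symmetric] by (simp add: mult.commute)
    hence "(s ^ n * u)\<^sup>2 = u\<^sup>2 * q ^ n"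
      using s by (simp add: power_mult_distrib)
    thus ?case using Suc step[of "s ^ n * u"] by (simp add: mult_ac)
  qed simp
  moreover have "(\<lambda>n. (\<Prod>i<n. 1 - u\<^sup>2 * q ^ i) * f (s ^ n * u)) \<longlonglongrightarrow>
      qp (u\<^sup>2) * (qp 0 * qp (- 0) * qp (s * 0) * qp (- (s * 0)))"
    unfolding f_def using ns
    by (intro tendsto_intros qp_LIMSEQ tendsto_mult_left_zero LIMSEQ_power_zero)
  ultimately have "(\<lambda>n. f u) \<longlonglongrightarrow> qp (u\<^sup>2)" by simp
  thus ?thesis by (simp add: f_def LIMSEQ_const_iff)
qed

lemma separates_unit_circle:
  assumes "\<And>t. t \<in> T \<Longrightarrow> norm t < 1"
  shows "separates T (circlepath 0 1)"
  unfolding separates_def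
proof (intro conjI ballI allI impI)
  show "path_image (circlepath 0 1) \<subseteq> regular_set T"
    using assms qp_neq_0 by (auto simp: regular_set_def norm_mult norm_divide)
next
  fix t z assume t: "t \<in> T" and z: "z \<noteq> 0" "qp (t / z) = 0"
  have "norm (t / z) \<ge> 1" using qp_neq_0[of "t / z"] z by force
  hence "norm z < 1" using assms[OF t] z by (simp add: norm_divide field_simps)
  thus "winding_number (circlepath 0 1) z = 1" by (simp add: winding_number_circlepath)
next
  fix t z assume t: "t \<in> T" and z: "z \<noteq> 0" "qp (t * z) = 0"
  have "norm (t * z) \<ge> 1" using qp_neq_0[of "t * z"] z by force
  moreover have "norm t * norm z < 1 * norm z"
    using assms[OF t] z by (intro mult_strict_right_mono) auto
  ultimately have "z \<notin> cball 0 1" by (simp add: norm_mult)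
  thus "winding_number (circlepath 0 1) z = 0"
    by (intro winding_number_zero_outside[of _ "cball 0 1"]) auto
qed (auto simp: winding_number_circlepath)

text \<open>Only the constant term 2 of the Laurent polynomial
  \<open>(1 - u^2) * (1 - 1 / u^2)\<close> contributes.\<close>

lemma contour_integral_unit_circle:
  "contour_integral (circlepath 0 1) (\<lambda>u. (1 - u\<^sup>2) * (1 - 1 / u\<^sup>2) / u) = 4 * of_real pi * \<i>"
proof -
  have 1: "((\<lambda>u. 2 * (1 / (u - 0))) has_contour_integral 2 * (2 * of_real pi * \<i> * 1)) (circlepath 0 1)"
    using has_contour_integral_winding_number[of "circlepath 0 1" 0]
    by (intro has_contour_integral_lmul) (simp add: winding_number_circlepath)
  have 2: "((\<lambda>u. - u - 1 / u ^ 3) has_contour_integral 0) (circlepath 0 1)"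
  proof (rule Cauchy_theorem_primitive)
    show "((\<lambda>u. - u\<^sup>2 / 2 + 1 / (2 * u\<^sup>2)) has_field_derivative (- u - 1 / u ^ 3)) (at u within -{0})"
      if "u \<in> -{0}" for u :: complex
      using that by (auto intro!: derivative_eq_intros simp: field_simps power2_eq_square power3_eq_cube)
  qed auto
  have "((\<lambda>u. (1 - u\<^sup>2) * (1 - 1 / u\<^sup>2) / u) has_contour_integral 4 * of_real pi * \<i>) (circlepath 0 1)"
  proof (rule has_contour_integral_eq)
    show "((\<lambda>u. 2 * (1 / (u - 0)) + (- u - 1 / u ^ 3)) has_contour_integral 4 * of_real pi * \<i>) (circlepath 0 1)"
      using has_contour_integral_add[OF 1 2] by (simp add: mult.assoc)
    show "2 * (1 / (u - 0)) + (- u - 1 / u ^ 3) = (1 - u\<^sup>2) * (1 - 1 / u\<^sup>2) / u"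
      if "u \<in> path_image (circlepath 0 1)" for u
    proof -
      have "u \<noteq> 0" using that by auto
      thus ?thesis by (simp add: field_simps power2_eq_square power3_eq_cube)
    qed
  qed
  thus ?thesis by (rule contour_integral_unique)
qed

text \<open>The parameters 0, \<open>s\<close>, \<open>- s\<close>, \<open>q\<close>,
  \<open>- q\<close> with \<open>s\<^sup>2 = q\<close> cancel the infinite products of the integrand
  by \<open>qp_square\<close>, leaving a Laurent polynomial on the unit circle. The product formula,
  read backwards at these parameters, then gives the value with all parameters 0.\<close>

lemma nr_constant:
  assumes g: "separates {0} g"
  shows "nr_integral g 0 0 0 0 0 * qp q = 4 * of_real pi * \<i>"
proof -
  define s where "s = csqrt q"
  have s: "s\<^sup>2 = q" by (simp add: s_def)
  have ns: "norm s < 1"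
  proof -
    have "norm s ^ 2 < 1\<^sup>2" using s q_lt by (simp flip: norm_power)
    thus ?thesis by (rule power_less_imp_less_base) simp
  qed
  let ?c = "circlepath 0 1"
  have "nr_integral g 0 0 0 0 0 = nr_integral ?c 0 0 0 0 0"
    unfolding nr_integral_def
  proof (rule separates_integral_eq[OF _ g])
    show "(\<lambda>u. nr_integrand 0 0 0 0 0 u / u) holomorphic_on regular_set {0}"
      using nr_integrand_holomorphic[of 0 0 0 0 0]
      by (intro holomorphic_intros) (auto simp: regular_set_def)
  qed (auto intro: separates_unit_circle)
  moreover have c: "separates {0, s, -s, q, -q} ?c"
    using ns q_lt by (intro separates_unit_circle) auto
  moreover have "nr_integral ?c 0 s (-s) q (-q) = 4 * of_real pi * \<i>"
    unfolding nr_integral_def contour_integral_unit_circle[symmetric]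
  proof (rule contour_integral_cong[OF refl])
    fix u :: complex assume "u \<in> path_image ?c"
    hence "u \<in> regular_set {0, s, -s, q, -q}" using c by (auto simp: separates_def)
    hence nz: "u \<noteq> 0" "qp (s * u) \<noteq> 0" "qp (s / u) \<noteq> 0" "qp (-(s * u)) \<noteq> 0" "qp (-(s / u)) \<noteq> 0"
       "qp (q * u) \<noteq> 0" "qp (q / u) \<noteq> 0" "qp (-(q * u)) \<noteq> 0" "qp (-(q / u)) \<noteq> 0"
      by (auto simp: regular_set_def)
    have "qp (u\<^sup>2) = (1 - u\<^sup>2) * (qp (q * u) * qp (-(q * u)) * qp (s * u) * qp (-(s * u)))"
      unfolding qp_square[OF s] qp_rec[of u] qp_rec[of "-u"] by (simp add: power2_eq_square algebra_simps)
    moreover have "qp (1 / u\<^sup>2) = (1 - 1 / u\<^sup>2) * (qp (q / u) * qp (-(q / u)) * qp (s / u) * qp (-(s / u)))"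
      using qp_square[OF s, of "1 / u"] qp_rec[of "1 / u"] qp_rec[of "-(1 / u)"]
      by (simp add: power2_eq_square algebra_simps)
    ultimately have "nr_integrand 0 s (-s) q (-q) u = (1 - u\<^sup>2) * (1 - 1 / u\<^sup>2)"
      unfolding nr_integrand_def using nz by simp
    thus "nr_integrand 0 s (-s) q (-q) u / u = (1 - u\<^sup>2) * (1 - 1 / u\<^sup>2) / u" by simp
  qed
  ultimately have *: "4 * of_real pi * \<i> * (qp (-q) * qp (s * q) * qp (- (s * q)) * qp (- (s * q)) *
      qp (s * q) * qp (- (q\<^sup>2))) = qp (q ^ 3) * nr_integral g 0 0 0 0 0"
    using nr_product[OF c] s by (simp add: power2_eq_square power3_eq_cube mult_ac)
  have e1: "qp q = (1 - q) * ((1 - q\<^sup>2) * qp (q ^ 3))"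
    using qp_rec[of q] qp_rec[of "q\<^sup>2"] by (simp add: power2_eq_square power3_eq_cube mult.assoc)
  have e2: "qp (- q) = (1 + q) * qp (- (q\<^sup>2))"
    using qp_rec[of "- q"] by (simp add: power2_eq_square)
  \<comment> \<open>Euler's identity in disguise: \<open>qp s * qp (- s)\<close> is the product over
    odd powers of \<open>q\<close>, and it is inverse to the product of all \<open>1 + q ^ n\<close>
    with \<open>n \<ge> 1\<close>.\<close>
  have "qp q = qp s * qp (- s) * qp q * qp (- q)"
    using qp_square[OF s, of s] s by (simp add: power2_eq_square)
  hence e3: "qp s * qp (- s) * qp (- q) = 1"
    using qp_q_neq_0 by (simp add: field_simps)
  have e4: "qp s = (1 - s) * qp (s * q)" "qp (- s) = (1 + s) * qp (- (s * q))"
    using qp_rec[of s] qp_rec[of "- s"] by (simp_all add: mult_ac)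
  have e5: "(1 - q) * (qp (s * q) * qp (- (s * q)) * qp (- q)) = 1"
  proof -
    have d: "1 - q = (1 - s) * (1 + s)" using s by (simp add: algebra_simps power2_eq_square)
    show ?thesis using e3 unfolding e4 d by (simp only: mult_ac)
  qed
  have "qp (q ^ 3) \<noteq> 0" using e1 qp_q_neq_0 by auto
  moreover have "qp (q ^ 3) * (nr_integral g 0 0 0 0 0 * qp q) = qp (q ^ 3) * (4 * of_real pi * \<i>)"
  proof -
    define X where "X = qp (s * q) * qp (- (s * q))"
    define E where "E = qp (- (q\<^sup>2))"
    define F where "F = qp (q ^ 3)"
    have x: "(1 - q) * (X * ((1 + q) * E)) = 1" using e5 unfolding e2 X_def E_def .
    have "qp (q ^ 3) * (nr_integral g 0 0 0 0 0 * qp q) =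
       4 * of_real pi * \<i> * (((1 + q) * E) * X * X * E) * ((1 - q) * ((1 - q\<^sup>2) * F))"
      using * unfolding e1 e2 X_def E_def F_def by (simp only: mult_ac)
    also have "\<dots> = 4 * of_real pi * \<i> * F * ((1 - q) * (X * ((1 + q) * E)))\<^sup>2"
      by (simp add: power2_eq_square algebra_simps)
    finally show ?thesis unfolding x F_def by (simp add: mult_ac)
  qed
  ultimately show ?thesis by (simp add: mult.assoc)
qed

subsection \<open>Partial fractions of theta functions\<close>

definition theta_pm :: "complex \<Rightarrow> complex \<Rightarrow> complex" where
  "theta_pm x u = theta (x * u) * theta (x / u)"

lemma theta_pm_q: "x \<noteq> 0 \<Longrightarrow> u \<noteq> 0 \<Longrightarrow> theta_pm x (q * u) = theta_pm x u / (q * u\<^sup>2)"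
proof -
  assume nz: "x \<noteq> 0" "u \<noteq> 0"
  have "theta (x * (q * u)) = - theta (x * u) / (x * u)"
    using theta_q[of "x * u"] nz by (simp add: mult_ac)
  moreover have "theta (x / (q * u)) = - theta (x / u) * (x / (q * u))"
    using theta_q[of "x / (q * u)"] nz by (simp add: field_simps)
  ultimately show ?thesis using nz by (simp add: theta_pm_def power2_eq_square)
qed

lemma theta_pm_inverse: "theta_pm x (1 / u) = theta_pm x u"
  by (simp add: theta_pm_def mult_ac)

lemma theta_pm_swap: "x \<noteq> 0 \<Longrightarrow> u \<noteq> 0 \<Longrightarrow> theta_pm u x = - (u / x) * theta_pm x u"
  using theta_inverse[of "x / u"] by (simp add: theta_pm_def mult_ac)

lemma theta_sq_q: "u \<noteq> 0 \<Longrightarrow> theta ((q * u)\<^sup>2) = theta (u\<^sup>2) / (q * u ^ 4)"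
proof -
  assume nz: "u \<noteq> 0"
  have "theta ((q * u)\<^sup>2) = theta (q * (q * u\<^sup>2))" by (simp add: power2_eq_square mult_ac)
  also have "\<dots> = theta (u\<^sup>2) / (q * u ^ 4)"
    using nz by (subst theta_q, simp, subst theta_q) (auto simp: power2_eq_square power4_eq_xxxx)
  finally show ?thesis .
qed

lemma theta_sq_inverse: "u \<noteq> 0 \<Longrightarrow> theta ((1 / u)\<^sup>2) = - theta (u\<^sup>2) / u\<^sup>2"
  using theta_inverse[of "u\<^sup>2"] by (simp add: power_divide)

lemma theta_pm_holomorphic [holomorphic_intros]:
  "x \<noteq> 0 \<Longrightarrow> f holomorphic_on A \<Longrightarrow> (\<And>z. z \<in> A \<Longrightarrow> f z \<noteq> 0) \<Longrightarrow> (\<lambda>z. theta_pm x (f z)) holomorphic_on A"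
  unfolding theta_pm_def by (intro holomorphic_intros) auto

text \<open>The two factors can vanish together only if the product \<open>x\<^sup>2\<close> of
  their arguments is a power of \<open>q\<close>; otherwise each zero is a simple zero of a single
  factor.\<close>

lemma theta_pm_simple_zeros:
  assumes nz: "x \<noteq> 0" "u \<noteq> 0" and x2: "theta (x\<^sup>2) \<noteq> 0" and 0: "theta_pm x u = 0"
  shows "deriv (theta_pm x) u \<noteq> 0"
proof -
  have fd: "(\<lambda>u. theta (x * u)) field_differentiable at u" "(\<lambda>u. theta (x / u)) field_differentiable at u"
    using nz by (auto intro!: holomorphic_on_imp_differentiable_at[of _ "-{0}"] holomorphic_intros)
  have "theta (x * u) \<noteq> 0 \<or> theta (x / u) \<noteq> 0"
  proof (rule ccontr)
    assume "\<not> ?thesis"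
    then obtain k l :: int where "x * u = q powi k" "x / u = q powi l"
      using nz theta_eq_0_iff[of "x * u"] theta_eq_0_iff[of "x / u"] by auto
    hence "x\<^sup>2 = q powi (k + l)"
      using nz by (simp add: power_int_add power2_eq_square field_simps)
    thus False using x2 nz theta_eq_0_iff[of "x\<^sup>2"] by auto
  qed
  moreover have "theta (x * u) = 0 \<Longrightarrow> deriv (\<lambda>u. theta (x * u)) u \<noteq> 0"
    by (rule theta_compose_simple_zeros[where h' = x]) (use nz in \<open>auto intro!: derivative_eq_intros\<close>)
  moreover have "theta (x / u) = 0 \<Longrightarrow> deriv (\<lambda>u. theta (x / u)) u \<noteq> 0"
    by (rule theta_compose_simple_zeros[where h' = "- x / u\<^sup>2"])
       (use nz in \<open>auto intro!: derivative_eq_intros simp: power2_eq_square\<close>)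
  ultimately have "deriv (\<lambda>u. theta (x * u) * theta (x / u)) u \<noteq> 0"
    using fd 0 by (intro deriv_mult_at_simple_zero) (auto simp: theta_pm_def)
  thus ?thesis by (simp add: theta_pm_def[abs_def])
qed

lemma theta_pm_eq_0D:
  assumes "x \<noteq> 0" "u \<noteq> 0" "theta_pm x u = 0"
  obtains k :: int where "u = q powi k * x" | k :: int where "u = q powi k / x"
proof -
  consider "theta (x * u) = 0" | "theta (x / u) = 0" using assms by (auto simp: theta_pm_def)
  thus ?thesis
  proof cases
    case 1
    then obtain k :: int where "x * u = q powi k" using assms theta_eq_0_iff[of "x * u"] by auto
    thus ?thesis using that(2)[of k] assms by (simp add: field_simps)
  next
    case 2
    then obtain k :: int where "x / u = q powi k" using assms theta_eq_0_iff[of "x / u"] by auto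
    thus ?thesis using that(1)[of "- k"] assms by (simp add: field_simps power_int_minus)
  qed
qed

lemma theta_pm_self [simp]: "x \<noteq> 0 \<Longrightarrow> theta_pm x x = 0"
  by (simp add: theta_pm_def theta_def qp_eq_0_iff[of 1] exI[of _ 0])

lemma multiplier_zeros:
  assumes m: "\<And>z. z \<noteq> 0 \<Longrightarrow> f (q * z) = m z * f z" "\<And>z. z \<noteq> 0 \<Longrightarrow> m z \<noteq> 0"
    and x: "x \<noteq> 0" "f x = (0 :: complex)"
  shows "f (q powi k * x) = 0"
proof (induction k rule: int_induct[where k = 0])
  case (step1 i)
  thus ?case using m(1)[of "q powi i * x"] x by (simp add: power_int_add mult_ac)
next
  case (step2 i)
  have "q powi i * x = q * (q powi (i - 1) * x)" by (simp add: power_int_diff)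
  thus ?case using step2 m[of "q powi (i - 1) * x"] x by (simp add: mult.assoc)
qed (use x in simp)

text \<open>A common zero makes \<open>y\<close> a power of \<open>q\<close> times \<open>x\<close>
  or \<open>1 / x\<close>.\<close>

lemma theta_pm_common_zero:
  assumes nz: "x \<noteq> 0" "y \<noteq> 0" "z \<noteq> 0" and 0: "theta_pm x z = 0" "theta_pm y z = 0"
  shows "theta_pm x y = 0"
proof -
  have m: "theta_pm y (q powi k * w) = 0" if "w \<noteq> 0" "theta_pm y w = 0" for k w
    by (rule multiplier_zeros[where m = "\<lambda>u. 1 / (q * u\<^sup>2)"]) (use nz that in \<open>auto simp: theta_pm_q\<close>)
  have "theta_pm y x = 0"
  proof (rule theta_pm_eq_0D[OF nz(1,3) 0(1)])
    fix k :: int assume "z = q powi k * x"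
    thus ?thesis using m[OF nz(3) 0(2), of "- k"] by (simp add: power_int_minus field_simps)
  next
    fix k :: int assume "z = q powi k / x"
    hence "theta_pm y (1 / x) = 0" using m[OF nz(3) 0(2), of "- k"] by (simp add: power_int_minus field_simps)
    thus ?thesis by (simp only: theta_pm_inverse)
  qed
  thus ?thesis using theta_pm_swap[of y x] nz by simp
qed

text \<open>A nonzero function with this multiplier has only four zeros per period. The product
  \<open>D\<close>, with the factor \<open>u\<^sup>2\<close> to adjust its multiplier, vanishes
  simply on the orbits of \<open>x1\<close>, \<open>1 / x1\<close>, \<open>x2\<close>,
  \<open>1 / x2\<close>, so \<phi> is a multiple of it; the additional zero \<open>x3\<close> makes
  the multiple 0.\<close>

lemma theta_six_zeros:
  assumes nz: "x1 \<noteq> 0" "x2 \<noteq> 0" "x3 \<noteq> 0"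
    and sq: "theta (x1\<^sup>2) \<noteq> 0" "theta (x2\<^sup>2) \<noteq> 0"
    and pm: "theta_pm x1 x2 \<noteq> 0" "theta_pm x1 x3 \<noteq> 0" "theta_pm x2 x3 \<noteq> 0"
    and hol: "\<phi> holomorphic_on -{0}" and q: "\<And>u. u \<noteq> 0 \<Longrightarrow> \<phi> (q * u) = 1 / u ^ 4 * \<phi> u"
    and 0: "\<phi> x1 = 0" "\<phi> (1 / x1) = 0" "\<phi> x2 = 0" "\<phi> (1 / x2) = 0" "\<phi> x3 = 0"
    and u: "u \<noteq> 0"
  shows "\<phi> u = 0"
proof -
  define D where "D = (\<lambda>u. u\<^sup>2 * (theta_pm x1 u * theta_pm x2 u))"
  have phi0: "\<phi> (q powi k * x) = 0" if "\<phi> x = 0" "x \<noteq> 0" for k x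
    by (rule multiplier_zeros[where f = \<phi> and m = "\<lambda>u. 1 / u ^ 4"]) (use that q in auto)
  obtain c where c: "\<And>z. z \<noteq> 0 \<Longrightarrow> \<phi> z = c * D z"
  proof (rule quasiperiodic_eq_cmult[OF q_nz q_lt hol, of D])
    show "D holomorphic_on -{0}" unfolding D_def using nz by (intro holomorphic_intros) auto
    show "D (q * z) = 1 / z ^ 4 * D z" if "z \<noteq> 0" for z
      using that nz by (simp add: D_def theta_pm_q power2_eq_square power4_eq_xxxx)
    show "\<phi> z = 0 \<and> deriv D z \<noteq> 0" if z: "z \<noteq> 0" and "D z = 0" for z
    proof
      have or: "theta_pm x1 z = 0 \<or> theta_pm x2 z = 0" using that by (auto simp: D_def)
      have not_both: "theta_pm x1 z \<noteq> 0 \<or> theta_pm x2 z \<noteq> 0"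
        using theta_pm_common_zero[of x1 x2 z] nz z pm by auto
      show "\<phi> z = 0"
        using or phi0[of x1] phi0[of "1/x1"] phi0[of x2] phi0[of "1/x2"] 0 nz z
        by (elim disjE theta_pm_eq_0D[rotated 2]) auto
      have fd: "theta_pm x field_differentiable at z" if "x \<noteq> 0" for x
        by (rule holomorphic_on_imp_differentiable_at[of _ "-{0}"])
           (use that z in \<open>auto intro!: holomorphic_intros\<close>)
      define H where "H = (\<lambda>z. theta_pm x1 z * theta_pm x2 z)"
      have H: "H z = 0" "H field_differentiable at z" unfolding H_def
        using or nz by (auto intro!: field_differentiable_mult fd)
      have "deriv H z \<noteq> 0" unfolding H_def
        using theta_pm_simple_zeros[of x1 z] theta_pm_simple_zeros[of x2 z] nz z sq or not_both
        by (intro deriv_mult_at_simple_zero fd) auto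
      hence "deriv (\<lambda>z. z\<^sup>2 * H z) z \<noteq> 0"
        using H z by (intro deriv_mult_at_simple_zero field_differentiable_power field_differentiable_ident) auto
      thus "deriv D z \<noteq> 0" unfolding D_def H_def .
    qed
  qed (use q in auto)
  have "c * D x3 = 0" using c[of x3] 0 nz by simp
  moreover have "D x3 \<noteq> 0" using pm nz by (simp add: D_def)
  ultimately show ?thesis using c[OF u] by simp
qed

text \<open>After clearing the factors that contain \<open>x4\<close>, the identity is one between
  functions of \<open>u = x4\<close> with the common multiplier \<open>1 / u ^ 4\<close>. It then
  suffices to check zeros at \<open>x1\<close>, \<open>x2\<close>, \<open>x3\<close> and at inverses
  of these points.\<close>

lemma theta_partial_fractions:
  assumes nz: "x1 \<noteq> 0" "x2 \<noteq> 0" "x3 \<noteq> 0" "x4 \<noteq> 0"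
    and sq: "theta (x1\<^sup>2) \<noteq> 0" "theta (x2\<^sup>2) \<noteq> 0"
    and pm: "theta_pm x1 x2 \<noteq> 0" "theta_pm x1 x3 \<noteq> 0" "theta_pm x2 x3 \<noteq> 0"
      "theta_pm x1 x4 \<noteq> 0" "theta_pm x2 x4 \<noteq> 0" "theta_pm x3 x4 \<noteq> 0"
  shows "theta (x1\<^sup>2) / (x1\<^sup>2 * (theta_pm x2 x1 * theta_pm x3 x1 * theta_pm x4 x1)) +
         theta (x2\<^sup>2) / (x2\<^sup>2 * (theta_pm x1 x2 * theta_pm x3 x2 * theta_pm x4 x2)) +
         theta (x3\<^sup>2) / (x3\<^sup>2 * (theta_pm x1 x3 * theta_pm x2 x3 * theta_pm x4 x3)) +
         theta (x4\<^sup>2) / (x4\<^sup>2 * (theta_pm x1 x4 * theta_pm x2 x4 * theta_pm x3 x4)) =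
    - 2 * theta (x1 * x2 * x3 * x4) /
      (theta (x1*x2) * theta (x1*x3) * theta (x1*x4) * theta (x2*x3) * theta (x2*x4) * theta (x3*x4))"
proof -
  define c where "c = (\<lambda>x y z. theta (x\<^sup>2) / (x\<^sup>2 * (theta_pm y x * theta_pm z x)))"
  \<comment> \<open>At \<open>u = x\<close> the first term cancels the fourth and the last one
    vanishes. At \<open>u = 1 / x\<close> the first and the fourth terms are equal and add up, and
    the last one has to cancel their sum: this is the origin of the coefficient 2.\<close>
  define \<phi> where "\<phi> = (\<lambda>x y z u. c x y z * (theta_pm u y * theta_pm u z) +
      c y x z * (theta_pm u x * theta_pm u z) + c z x y * (theta_pm u x * theta_pm u y)
      - u * theta (u\<^sup>2) / (x * y * z) +
      2 * theta (x * y * z * u) * theta (u / x) * theta (u / y) * theta (u / z) /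
      (theta (x * y) * theta (x * z) * theta (y * z)))"
  have sw: "theta_pm v w = - (v / w) * theta_pm w v" if "v \<noteq> 0" "w \<noteq> 0" for v w
    using theta_pm_swap[of w v] that by simp
  have vanish: "\<phi> x y z x = 0 \<and> \<phi> x y z (1 / x) = 0"
    if xyz: "x \<noteq> 0" "y \<noteq> 0" "z \<noteq> 0" and pm: "theta_pm y x \<noteq> 0" "theta_pm z x \<noteq> 0"
    and nn: "theta (x * y) \<noteq> 0" "theta (x * z) \<noteq> 0" "theta (y * z) \<noteq> 0" for x y z
  proof
    have inv: "theta_pm (1 / x) w = theta_pm x w / x\<^sup>2" if "w \<noteq> 0" for w
      using sw[of "1/x" w] sw[of x w] that xyz theta_pm_inverse[of w x]
      by (simp add: power2_eq_square)
    have k: "c x y z * (theta_pm x y * theta_pm x z) = x * theta (x\<^sup>2) / (x * y * z)"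
      unfolding c_def sw[OF xyz(1,2)] sw[OF xyz(1,3)] using xyz pm
      by (simp add: power2_eq_square)
    have t1: "theta 1 = 0" by (simp add: theta_def qp_eq_0_iff[of 1] exI[of _ 0])
    show "\<phi> x y z x = 0"
      unfolding \<phi>_def k using xyz by (simp add: t1)
    have e: "c x y z * (theta_pm (1/x) y * theta_pm (1/x) z) = (x * theta (x\<^sup>2) / (x * y * z)) / x ^ 4"
      unfolding k[symmetric] using xyz by (simp add: inv power2_eq_square power4_eq_xxxx)
    have e1: "theta_pm (1 / x) x = 0" using inv[of x] xyz by simp
    have e2: "theta ((1 / x)\<^sup>2) = - theta (x\<^sup>2) / x\<^sup>2" using xyz(1) by (rule theta_sq_inverse)
    have e3: "theta (1 / x / x) = - theta (x\<^sup>2) / x\<^sup>2"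
      using theta_sq_inverse[of x] xyz by (simp add: power2_eq_square)
    have e4: "theta (1 / x / y) = - theta (x * y) / (x * y)"
      "theta (1 / x / z) = - theta (x * z) / (x * z)"
      using theta_inverse[of "x * y"] theta_inverse[of "x * z"] xyz by simp_all
    have e5: "x * y * z * (1 / x) = y * z" using xyz by simp
    show "\<phi> x y z (1 / x) = 0"
      unfolding \<phi>_def e e1 e2 e3 e4 e5 using xyz nn
      by (simp add: field_simps power2_eq_square power4_eq_xxxx)
  qed
  have sym: "\<phi> x y z = \<phi> y x z" "\<phi> x y z = \<phi> z y x" for x y z
    unfolding \<phi>_def c_def by (simp_all add: fun_eq_iff mult_ac add_ac)
  have pm': "theta_pm x2 x1 \<noteq> 0" "theta_pm x3 x1 \<noteq> 0" "theta_pm x3 x2 \<noteq> 0"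
    using sw[of x2 x1] sw[of x3 x1] sw[of x3 x2] nz pm by auto
  have nn: "theta (x1*x2) \<noteq> 0" "theta (x1*x3) \<noteq> 0" "theta (x1*x4) \<noteq> 0" "theta (x2*x3) \<noteq> 0"
    "theta (x2*x4) \<noteq> 0" "theta (x3*x4) \<noteq> 0" using pm by (auto simp: theta_pm_def)
  have "\<phi> x1 x2 x3 x4 = 0"
  proof (rule theta_six_zeros[where \<phi> = "\<phi> x1 x2 x3", OF nz(1-3) sq pm(1-3)])
    show "\<phi> x1 x2 x3 holomorphic_on -{0}"
      unfolding \<phi>_def theta_pm_def using nz by (intro holomorphic_intros) (auto simp: nn)
    show "\<phi> x1 x2 x3 (q * u) = 1 / u ^ 4 * \<phi> x1 x2 x3 u" if u: "u \<noteq> 0" for u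
    proof -
      have p: "theta_pm (q * u) w = theta_pm u w / u\<^sup>2" if "w \<noteq> 0" for w
        using sw[of "q * u" w] sw[of u w] theta_pm_q[of w u] u that
        by (simp add: power2_eq_square)
      have t: "theta (x1 * x2 * x3 * (q * u)) = - theta (x1 * x2 * x3 * u) / (x1 * x2 * x3 * u)"
        using theta_q[of "x1 * x2 * x3 * u"] nz u by (simp add: mult_ac)
      have t': "theta (q * u / w) = - theta (u / w) * w / u" if "w \<noteq> 0" for w
        using theta_q[of "u / w"] that u by simp
      have e: "c x1 x2 x3 * (theta_pm (q * u) x2 * theta_pm (q * u) x3) = c x1 x2 x3 * (theta_pm u x2 * theta_pm u x3) / u^4"
        "c x2 x1 x3 * (theta_pm (q * u) x1 * theta_pm (q * u) x3) = c x2 x1 x3 * (theta_pm u x1 * theta_pm u x3) / u^4"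
        "c x3 x1 x2 * (theta_pm (q * u) x1 * theta_pm (q * u) x2) = c x3 x1 x2 * (theta_pm u x1 * theta_pm u x2) / u^4"
        using nz by (simp_all add: p power2_eq_square power4_eq_xxxx)
      have e4: "q * u * theta ((q * u)\<^sup>2) / (x1 * x2 * x3) = u * theta (u\<^sup>2) / (x1 * x2 * x3) / u ^ 4"
        unfolding theta_sq_q[OF u] by simp
      have e5: "2 * theta (x1 * x2 * x3 * (q * u)) * theta (q * u / x1) * theta (q * u / x2) * theta (q * u / x3) /
         (theta (x1 * x2) * theta (x1 * x3) * theta (x2 * x3)) =
         2 * theta (x1 * x2 * x3 * u) * theta (u / x1) * theta (u / x2) * theta (u / x3) /
         (theta (x1 * x2) * theta (x1 * x3) * theta (x2 * x3)) / u ^ 4"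
        unfolding t t'[OF nz(1)] t'[OF nz(2)] t'[OF nz(3)] using nz u
        by (simp add: power4_eq_xxxx mult_ac)
      show ?thesis unfolding \<phi>_def e e4 e5 by (simp add: add_divide_distrib diff_divide_distrib)
    qed
    show "\<phi> x1 x2 x3 x1 = 0" "\<phi> x1 x2 x3 (1 / x1) = 0"
      using vanish[of x1 x2 x3] nz pm' nn by auto
    show "\<phi> x1 x2 x3 x2 = 0" "\<phi> x1 x2 x3 (1 / x2) = 0"
      using vanish[of x2 x1 x3] nz pm pm' nn sym(1)[of x1 x2 x3] by (auto simp: mult.commute)
    show "\<phi> x1 x2 x3 x3 = 0"
      using vanish[of x3 x2 x1] nz pm nn sym(2)[of x1 x2 x3] by (auto simp: mult.commute)
  qed fact
  hence *: "c x1 x2 x3 * (theta_pm x4 x2 * theta_pm x4 x3) +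
      c x2 x1 x3 * (theta_pm x4 x1 * theta_pm x4 x3) + c x3 x1 x2 * (theta_pm x4 x1 * theta_pm x4 x2)
      - x4 * theta (x4\<^sup>2) / (x1 * x2 * x3) =
      - 2 * theta (x1 * x2 * x3 * x4) * theta (x4 / x1) * theta (x4 / x2) * theta (x4 / x3) /
      (theta (x1 * x2) * theta (x1 * x3) * theta (x2 * x3))"
    unfolding \<phi>_def by (simp only: mult_minus_left minus_divide_left[symmetric] eq_neg_iff_add_eq_0)
  define Q where "Q = theta_pm x4 x1 * theta_pm x4 x2 * theta_pm x4 x3"
  have p4: "theta_pm x4 x1 \<noteq> 0" "theta_pm x4 x2 \<noteq> 0" "theta_pm x4 x3 \<noteq> 0"
    using sw[of x4 x1] sw[of x4 x2] sw[of x4 x3] nz pm by auto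
  have Q: "Q \<noteq> 0" using p4 by (simp add: Q_def)
  have f1: "theta (x1\<^sup>2) / (x1\<^sup>2 * (theta_pm x2 x1 * theta_pm x3 x1 * theta_pm x4 x1)) =
      c x1 x2 x3 * (theta_pm x4 x2 * theta_pm x4 x3) / Q"
    "theta (x2\<^sup>2) / (x2\<^sup>2 * (theta_pm x1 x2 * theta_pm x3 x2 * theta_pm x4 x2)) =
      c x2 x1 x3 * (theta_pm x4 x1 * theta_pm x4 x3) / Q"
    "theta (x3\<^sup>2) / (x3\<^sup>2 * (theta_pm x1 x3 * theta_pm x2 x3 * theta_pm x4 x3)) =
      c x3 x1 x2 * (theta_pm x4 x1 * theta_pm x4 x2) / Q"
    unfolding c_def Q_def using p4 by simp_all
  have f4: "theta (x4\<^sup>2) / (x4\<^sup>2 * (theta_pm x1 x4 * theta_pm x2 x4 * theta_pm x3 x4)) =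
      - (x4 * theta (x4\<^sup>2) / (x1 * x2 * x3)) / Q"
    unfolding sw[OF nz(1,4)] sw[OF nz(2,4)] sw[OF nz(3,4)] Q_def using nz p4
    by (simp add: power2_eq_square mult_ac)
  have f5: "- 2 * theta (x1 * x2 * x3 * x4) /
      (theta (x1*x2) * theta (x1*x3) * theta (x1*x4) * theta (x2*x3) * theta (x2*x4) * theta (x3*x4)) =
      (- 2 * theta (x1 * x2 * x3 * x4) * theta (x4 / x1) * theta (x4 / x2) * theta (x4 / x3) /
      (theta (x1 * x2) * theta (x1 * x3) * theta (x2 * x3))) / Q"
    unfolding Q_def theta_pm_def using p4 by (simp add: theta_pm_def mult_ac)
  show ?thesis
    unfolding f1 f4 f5 *[symmetric] by (simp add: add_divide_distrib diff_divide_distrib)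
qed

end

subsection \<open>The bilateral sum\<close>

lemma summable_on_int_geometric:
  fixes x :: real
  assumes "0 \<le> x" "x < 1"
  shows "(\<lambda>m::int. c * x ^ nat \<bar>m\<bar>) summable_on UNIV"
proof -
  have "summable (\<lambda>n. x ^ n)" using assms by (intro summable_geometric) auto
  hence nat: "(\<lambda>n::nat. x ^ n) summable_on UNIV"
    using assms by (intro summable_nonneg_imp_summable_on) auto
  have "(\<lambda>m::int. x ^ nat \<bar>m\<bar>) summable_on range int"
    using nat by (subst summable_on_reindex) (auto simp: o_def)
  moreover have "(\<lambda>m::int. x ^ nat \<bar>m\<bar>) summable_on range (\<lambda>n. - int n)"
    using nat by (subst summable_on_reindex) (auto simp: o_def inj_on_def)
  ultimately have "(\<lambda>m::int. x ^ nat \<bar>m\<bar>) summable_on (range int \<union> range (\<lambda>n. - int n))"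
    by (rule summable_on_union)
  also have "range int \<union> range (\<lambda>n. - int n) = UNIV"
    by (auto simp: image_iff) (metis int_cases)
  finally show ?thesis by (rule summable_on_cmult_right)
qed

context nome
begin

definition bilateral_factor :: "(nat \<Rightarrow> complex) \<Rightarrow> complex \<Rightarrow> complex" where
  "bilateral_factor a v = (\<Prod>j=1..6. qp (q / (a j * v)) * qp (q * v / a j))"

text \<open>The factor of the integrand that depends on \<open>m\<close> once
  \<open>u = s powi m * z\<close> is the variable; what is independent of \<open>m\<close> goes into
  \<open>weight\<close>. The exponent \<open>3 * m\<^sup>2 - m\<close> combines
  \<open>1 / q powi m\<close> with the power \<open>s powi (6 * m\<^sup>2)\<close> that
  \<open>z powi (- 6 * m)\<close> releases.\<close>

definition bilateral_term :: "(nat \<Rightarrow> complex) \<Rightarrow> int \<Rightarrow> complex \<Rightarrow> complex" where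
  "bilateral_term a m u = bilateral_factor a (u * q powi (- m)) * (1 - q powi (2 * m) / u\<^sup>2) *
     q powi (3 * m\<^sup>2 - m) * u powi (- 6 * m)"

definition bilateral_sum :: "(nat \<Rightarrow> complex) \<Rightarrow> complex \<Rightarrow> complex" where
  "bilateral_sum a u = (\<Sum>\<^sub>\<infinity>m. bilateral_term a m u)"

lemma bilateral_factor_inverse: "bilateral_factor a (1 / v) = bilateral_factor a v"
  unfolding bilateral_factor_def by (intro prod.cong) (auto simp: mult_ac)

text \<open>Raising \<open>m\<close> by 1 along with multiplying \<open>u\<close> by
  \<open>q\<close> fixes both \<open>u * q powi (- m)\<close> and
  \<open>q powi (2 * m) / u\<^sup>2\<close>, so that only the monomial factors change.\<close>

lemma bilateral_term_shift:
  assumes "u \<noteq> 0"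
  shows "bilateral_term a (m + 1) (q * u) = 1 / (q ^ 4 * u ^ 6) * bilateral_term a m u"
proof -
  have 1: "q * u * q powi (- (m + 1)) = u * q powi (- m)"
    by (simp add: power_int_diff)
  have 2: "q powi (2 * (m + 1)) / (q * u)\<^sup>2 = q powi (2 * m) / u\<^sup>2"
    by (simp add: power_int_add power_mult_distrib distrib_left)
  have e: "3 * (m + 1)\<^sup>2 - (m + 1) = (3 * m\<^sup>2 - m) + (6 * m + 2)"
    by (simp add: power2_eq_square algebra_simps)
  have 3: "q powi (3 * (m + 1)\<^sup>2 - (m + 1)) = q powi (3 * m\<^sup>2 - m) * q powi (6 * m + 2)"
    unfolding e by (rule power_int_add) simp
  have "(q * u) powi (- 6 * (m + 1)) = q powi (- (6 * m + 2) + - 4) * u powi (- 6 * m + - 6)"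
    by (simp add: power_int_mult_distrib algebra_simps)
  also have "\<dots> = q powi (- (6 * m + 2)) * q powi (- 4) * (u powi (- 6 * m) * u powi (- 6))"
    using assms by (subst (1 2) power_int_add) auto
  also have "\<dots> = u powi (- 6 * m) / (q powi (6 * m + 2) * (q ^ 4 * u ^ 6))"
    unfolding power_int_minus[of q "6 * m + 2"] power_int_minus[of u 6] power_int_minus[of q 4]
    by (simp add: divide_inverse)
  finally have 4: "(q * u) powi (- 6 * (m + 1)) = u powi (- 6 * m) / (q powi (6 * m + 2) * (q ^ 4 * u ^ 6))" .
  show ?thesis unfolding bilateral_term_def 1 2 3 4 by simp
qed

lemma bilateral_term_inverse:
  assumes "u \<noteq> 0"
  shows "bilateral_term a (- m) (1 / u) = - u\<^sup>2 * bilateral_term a m u"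
proof -
  have 1: "bilateral_factor a (1 / u * q powi (- (- m))) = bilateral_factor a (u * q powi (- m))"
    using bilateral_factor_inverse[of a "u * q powi (- m)"] by (simp add: power_int_minus field_simps)
  have 2: "1 - q powi (2 * - m) / (1 / u)\<^sup>2 = - u\<^sup>2 * q powi (- 2 * m) * (1 - q powi (2 * m) / u\<^sup>2)"
    using assms by (simp add: power_int_minus field_simps)
  have "3 * (- m)\<^sup>2 - - m = (3 * m\<^sup>2 - m) + 2 * m" by simp
  hence 3: "q powi (3 * (- m)\<^sup>2 - - m) = q powi (3 * m\<^sup>2 - m) * q powi (2 * m)"
    by (simp only: power_int_add q_nz simp_thms)
  have 4: "(1 / u) powi (- 6 * - m) = u powi (- 6 * m)"
    by (simp add: power_int_divide_distrib power_int_minus field_simps)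
  show ?thesis
    unfolding bilateral_term_def 1 2 3 4 by (simp add: power_int_minus)
qed

lemma bilateral_sum_shift:
  assumes "u \<noteq> 0"
  shows "bilateral_sum a (q * u) = 1 / (q ^ 4 * u ^ 6) * bilateral_sum a u"
proof -
  have "bilateral_sum a (q * u) = (\<Sum>\<^sub>\<infinity>m. bilateral_term a (m + 1) (q * u))"
    unfolding bilateral_sum_def
    by (rule infsum_reindex_bij_witness[where i = "\<lambda>m. m + 1" and j = "\<lambda>m. m - 1"]) auto
  thus ?thesis
    unfolding bilateral_term_shift[OF assms] bilateral_sum_def by (simp only: infsum_cmult_right')
qed

lemma bilateral_sum_inverse:
  assumes "u \<noteq> 0"
  shows "bilateral_sum a (1 / u) = - u\<^sup>2 * bilateral_sum a u"
proof -
  have "bilateral_sum a (1 / u) = (\<Sum>\<^sub>\<infinity>m. bilateral_term a (- m) (1 / u))"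
    unfolding bilateral_sum_def
    by (rule infsum_reindex_bij_witness[where i = "\<lambda>m. - m" and j = "\<lambda>m. - m"]) auto
  thus ?thesis
    unfolding bilateral_term_inverse[OF assms] bilateral_sum_def by (simp only: infsum_cmult_right')
qed

section \<open>Convergence of the bilateral sum\<close>

lemma qp_negative_shift: "qp (q * y / q ^ n) = qp (q * y) * (\<Prod>i<n. 1 - y / q ^ i)"
proof (induction n)
  case (Suc n)
  have "q * y / q ^ Suc n = y / q ^ n" by simp
  moreover have "qp (y / q ^ n) = (1 - y / q ^ n) * qp (q * y / q ^ n)"
    using qp_rec[of "y / q ^ n"] by simp
  ultimately show ?case using Suc by (simp add: mult_ac)
qed simp

text \<open>Each factor \<open>1 - y / q ^ i\<close> equals \<open>- y / q ^ i\<close> times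
  \<open>1 - q ^ i / y\<close>. The extracted monomials carry all the growth in \<open>n\<close>;
  the rest is bounded by \<open>norm_qp_finite_le\<close>.\<close>

lemma norm_qp_negative_shift_le:
  assumes y: "y \<noteq> 0" "norm y \<le> R" "1 / norm y \<le> R"
  shows "norm (qp (q * y / q ^ n)) \<le> (exp (R / (1 - norm q)))\<^sup>2 * (norm y ^ n / (\<Prod>i<n. norm q ^ i))"
proof -
  have q1: "1 - norm q > 0" using q_lt by simp
  have "(\<Prod>i<n. 1 - y / q ^ i) = (\<Prod>i<n. (- y / q ^ i) * (1 - 1 / y * q ^ i))"
    using y by (intro prod.cong) (auto simp: field_simps)
  hence eq: "norm (\<Prod>i<n. 1 - y / q ^ i) = (norm y ^ n / (\<Prod>i<n. norm q ^ i)) * norm (\<Prod>i<n. 1 - 1 / y * q ^ i)"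
    by (simp add: prod.distrib prod_dividef norm_mult norm_divide norm_power prod_norm[symmetric])
  have "norm (\<Prod>i<n. 1 - 1 / y * q ^ i) \<le> exp (norm (1 / y) / (1 - norm q))"
    by (rule norm_qp_finite_le)
  also have "\<dots> \<le> exp (R / (1 - norm q))"
    using y q1 unfolding norm_divide norm_one exp_le_cancel_iff by (intro divide_right_mono) auto
  finally have 1: "norm (\<Prod>i<n. 1 - y / q ^ i) \<le> norm y ^ n / (\<Prod>i<n. norm q ^ i) * exp (R / (1 - norm q))"
    unfolding eq by (intro mult_left_mono) (auto intro!: divide_nonneg_nonneg prod_nonneg)
  have "norm (q * y) \<le> 1 * R"
    unfolding norm_mult using y q_lt by (intro mult_mono) auto
  hence "exp (norm (q * y) / (1 - norm q)) \<le> exp (R / (1 - norm q))"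
    using q1 by (auto intro!: divide_right_mono)
  hence 2: "norm (qp (q * y)) \<le> exp (R / (1 - norm q))"
    using norm_qp_le[of "q * y"] by linarith
  have "norm (qp (q * y / q ^ n)) = norm (qp (q * y)) * norm (\<Prod>i<n. 1 - y / q ^ i)"
    by (simp add: qp_negative_shift norm_mult)
  also have "\<dots> \<le> exp (R / (1 - norm q)) * (norm y ^ n / (\<Prod>i<n. norm q ^ i) * exp (R / (1 - norm q)))"
    by (intro mult_mono 1 2) auto
  finally show ?thesis by (simp add: power2_eq_square mult_ac)
qed

lemma prod_power_index: "(\<Prod>i<n. x ^ i) ^ 6 = (x ^ (3 * n * (n - 1)) :: real)"
proof (induction n)
  case (Suc n)
  have "3 * Suc n * (Suc n - 1) = 3 * n * (n - 1) + n * 6"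
    by (cases n) (auto simp: algebra_simps)
  thus ?case using Suc by (simp add: power_mult_distrib power_add power_mult)
qed simp

text \<open>Every parameter contributes three bounded factors, whence \<open>E ^ 18\<close> for six
  of them, and one quotient that grows with \<open>n\<close>. In the product of these quotients the
  \<open>norm (a j * u)\<close> combine to \<open>norm q * norm u ^ 6\<close>.\<close>

lemma norm_bilateral_factor_le:
  assumes r: "1 / r \<le> norm u" "norm u \<le> r" "r > 0"
    and a: "\<And>j. j \<in> {1..6} \<Longrightarrow> 1 / r \<le> norm (a j) \<and> norm (a j) \<le> r"
    and pr: "(\<Prod>j=1..6. a j) = q"
  shows "norm (bilateral_factor a (u * q ^ n)) \<le>
    exp (r\<^sup>2 / (1 - norm q)) ^ 18 / ((norm q * norm u ^ 6) ^ n * norm q ^ (3 * n * (n - 1)))"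
proof -
  have q1: "1 - norm q > 0" using q_lt by simp
  define E where "E = exp (r\<^sup>2 / (1 - norm q))"
  define R where "R = (\<Prod>i<n. norm q ^ i)"
  have R: "R > 0" by (simp add: R_def prod_pos)
  have nz: "norm u > 0" "\<And>j. j \<in> {1..6} \<Longrightarrow> norm (a j) > 0"
    using r a by (meson less_le_trans zero_less_divide_1_iff)+
  have "norm (qp (q / (a j * (u * q ^ n))) * qp (q * (u * q ^ n) / a j)) \<le>
      E ^ 3 * ((1 / norm (a j * u)) ^ n / R)" if j: "j \<in> {1..6}" for j
  proof -
    have l: "norm (a j) * norm u \<le> r\<^sup>2" "1 / (norm (a j) * norm u) \<le> r\<^sup>2" "norm u / norm (a j) \<le> r\<^sup>2"
    proof -
      have i: "1 / norm (a j) \<le> r" "1 / norm u \<le> r"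
        using a[OF j] r nz(1) nz(2)[OF j] by (auto simp: field_simps)
      show "norm (a j) * norm u \<le> r\<^sup>2"
        unfolding power2_eq_square using a[OF j] r by (intro mult_mono) auto
      have "(1 / norm (a j)) * (1 / norm u) \<le> r * r"
        using i r by (intro mult_mono) auto
      thus "1 / (norm (a j) * norm u) \<le> r\<^sup>2" by (simp add: power2_eq_square)
      have "norm u * (1 / norm (a j)) \<le> r * r"
        using i r by (intro mult_mono) auto
      thus "norm u / norm (a j) \<le> r\<^sup>2" by (simp add: power2_eq_square)
    qed
    have y: "q / (a j * (u * q ^ n)) = q * (1 / (a j * u)) / q ^ n" by simp
    have "norm (qp (q / (a j * (u * q ^ n)))) \<le> E\<^sup>2 * ((1 / norm (a j * u)) ^ n / R)"
      unfolding y E_def R_def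
      using norm_qp_negative_shift_le[of "1 / (a j * u)" "r\<^sup>2" n] l nz(1) nz(2)[OF j]
      by (auto simp: norm_mult norm_divide)
    moreover have "norm (qp (q * (u * q ^ n) / a j)) \<le> E"
    proof -
      have "norm (q * (u * q ^ n) / a j) = norm q ^ Suc n * (norm u / norm (a j))"
        by (simp add: norm_mult norm_divide norm_power)
      also have "\<dots> \<le> 1 * r\<^sup>2"
        using l q_lt by (intro mult_mono power_le_one) auto
      finally have "exp (norm (q * (u * q ^ n) / a j) / (1 - norm q)) \<le> E"
        unfolding E_def exp_le_cancel_iff using q1 by (intro divide_right_mono) auto
      thus ?thesis using norm_qp_le[of "q * (u * q ^ n) / a j"] by linarith
    qed
    ultimately have "norm (qp (q / (a j * (u * q ^ n)))) * norm (qp (q * (u * q ^ n) / a j)) \<le>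
        E\<^sup>2 * ((1 / norm (a j * u)) ^ n / R) * E"
      using R by (intro mult_mono) (auto simp: E_def)
    thus ?thesis by (simp add: norm_mult power2_eq_square power3_eq_cube mult_ac)
  qed
  hence "norm (bilateral_factor a (u * q ^ n)) \<le> (\<Prod>j=1..6. E ^ 3 * ((1 / norm (a j * u)) ^ n / R))"
    unfolding bilateral_factor_def prod_norm[symmetric] by (intro prod_mono) auto
  also have "\<dots> = (\<Prod>j=(1::nat)..6. E ^ 3) * (\<Prod>j=(1::nat)..6. inverse (norm (a j * u) ^ n * R))"
    unfolding prod.distrib[symmetric] by (simp add: divide_inverse power_inverse)
  also have "(\<Prod>j=(1::nat)..6. inverse (norm (a j * u) ^ n * R)) =
      inverse ((\<Prod>j=1..6. norm (a j * u)) ^ n * R ^ 6)"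
    using prod_inversef[of "\<lambda>j. norm (a j * u) ^ n * R" "{1..6}"]
    by (simp add: o_def prod.distrib prod_power_distrib)
  also have "(\<Prod>j=(1::nat)..6. E ^ 3) * inverse ((\<Prod>j=1..6. norm (a j * u)) ^ n * R ^ 6) =
      E ^ 18 / ((\<Prod>j=1..6. norm (a j * u)) ^ n * R ^ 6)"
    by (simp add: power_mult[symmetric] divide_inverse)
  also have "(\<Prod>j=1..6. norm (a j * u)) = norm q * norm u ^ 6"
    unfolding pr[symmetric] by (simp add: norm_mult prod.distrib prod_norm)
  also have "R ^ 6 = norm q ^ (3 * n * (n - 1))"
    unfolding R_def by (rule prod_power_index)
  finally show ?thesis by (simp add: E_def)
qed

text \<open>The inner \<open>r\<^sup>2 + 1\<close> bounds the factor
  \<open>1 - q powi (2 * m) / u\<^sup>2\<close> up to a power of \<open>q\<close>; the outer one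
  pays for the inversion of \<open>u\<close> when \<open>m\<close> is positive.\<close>

definition bilateral_bound :: "real \<Rightarrow> real" where
  "bilateral_bound r = (r\<^sup>2 + 1) * (exp (r\<^sup>2 / (1 - norm q)) ^ 18 * (r\<^sup>2 + 1))"

text \<open>For \<open>m = - n\<close> the explicit power has exponent \<open>3 * n * n + n\<close>;
  the six factors take away \<open>n + 3 * n * (n - 1)\<close>, and the factor
  \<open>1 - q powi (2 * m) / u\<^sup>2\<close> takes away \<open>2 * n\<close>. Exactly
  \<open>n\<close> remains. Positive \<open>m\<close> reduce to this by
  \<open>bilateral_term_inverse\<close>, which is why \<open>norm u\<close> is bounded from both
  sides.\<close>

lemma norm_bilateral_term_le:
  assumes r: "1 / r \<le> norm u" "norm u \<le> r" "r > 0"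
    and a: "\<And>j. j \<in> {1..6} \<Longrightarrow> 1 / r \<le> norm (a j) \<and> norm (a j) \<le> r"
    and pr: "(\<Prod>j=1..6. a j) = q"
  shows "norm (bilateral_term a m u) \<le> bilateral_bound r * norm q ^ nat \<bar>m\<bar>"
proof -
  define C where "C = exp (r\<^sup>2 / (1 - norm q)) ^ 18 * (r\<^sup>2 + 1)"
  have C: "C \<ge> 0" by (simp add: C_def)
  have neg: "norm (bilateral_term a (- int n) u) \<le> C * norm q ^ n"
    if r: "1 / r \<le> norm u" "norm u \<le> r" for u n
  proof -
    have u0: "norm u > 0" using r \<open>r > 0\<close> by (meson less_le_trans zero_less_divide_1_iff)
    have iu: "1 / norm u \<le> r" using r u0 \<open>r > 0\<close> by (simp add: field_simps)
    have e: "3 * (- int n)\<^sup>2 - - int n = int (3 * n * n + n)" by (simp add: power2_eq_square)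
    have e': "- 6 * - int n = int (6 * n)" by simp
    have e'': "q powi (2 * - int n) = 1 / q ^ (2 * n)"
    proof -
      have "2 * - int n = - int (2 * n)" by simp
      thus ?thesis by (simp only: power_int_minus power_int_of_nat inverse_eq_divide)
    qed
    have "bilateral_term a (- int n) u =
        bilateral_factor a (u * q ^ n) * (1 - 1 / (q ^ (2 * n) * u\<^sup>2)) * q ^ (3 * n * n + n) * u ^ (6 * n)"
      unfolding bilateral_term_def e e' e'' power_int_of_nat by simp
    also have "norm \<dots> = norm (bilateral_factor a (u * q ^ n)) * norm (1 - 1 / (q ^ (2 * n) * u\<^sup>2)) *
        norm q ^ (3 * n * n + n) * norm u ^ (6 * n)"
      by (simp add: norm_mult norm_power)
    also have "\<dots> \<le> exp (r\<^sup>2 / (1 - norm q)) ^ 18 / ((norm q * norm u ^ 6) ^ n * norm q ^ (3 * n * (n - 1))) *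
        ((r\<^sup>2 + 1) / norm q ^ (2 * n)) * norm q ^ (3 * n * n + n) * norm u ^ (6 * n)"
    proof (intro mult_right_mono mult_mono norm_bilateral_factor_le r \<open>r > 0\<close> a pr)
      have "norm (1 - 1 / (q ^ (2 * n) * u\<^sup>2)) \<le> 1 + (1 / norm u)\<^sup>2 / norm q ^ (2 * n)"
        using norm_triangle_ineq4[of 1 "1 / (q ^ (2 * n) * u\<^sup>2)"]
        by (simp add: norm_divide norm_mult norm_power power_divide mult.commute)
      also have "\<dots> \<le> 1 / norm q ^ (2 * n) + r\<^sup>2 / norm q ^ (2 * n)"
        using iu u0 q_lt by (intro add_mono divide_right_mono power_mono) (auto simp: power_le_one)
      finally show "norm (1 - 1 / (q ^ (2 * n) * u\<^sup>2)) \<le> (r\<^sup>2 + 1) / norm q ^ (2 * n)"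
        by (simp add: add_divide_distrib)
    qed auto
    also have "\<dots> = C * norm q ^ n"
    proof (cases n)
      case (Suc k)
      have e: "3 * n * n + n = n + (n + 3 * n * (n - 1) + 2 * n)"
        unfolding Suc by (simp add: algebra_simps)
      have "norm q ^ (3 * n * n + n) = norm q ^ n * (norm q ^ n * norm q ^ (3 * n * (n - 1)) * norm q ^ (2 * n))"
        unfolding e by (simp only: power_add)
      thus ?thesis unfolding C_def using u0
        by (simp add: power_mult_distrib power_mult[symmetric])
    qed (simp add: C_def)
    finally show ?thesis .
  qed
  have u0: "norm u > 0" using r by (meson less_le_trans zero_less_divide_1_iff)
  have "1 \<le> r * norm u" using r(1) assms(3) by (simp add: field_simps)
  hence iu: "1 / norm u \<le> r" using u0 by (simp add: field_simps)
  have iu': "1 / r \<le> 1 / norm u" by (rule divide_left_mono[OF r(2) zero_le_one mult_pos_pos[OF assms(3) u0]])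
  have bb: "bilateral_bound r = (r\<^sup>2 + 1) * C" by (simp add: bilateral_bound_def C_def)
  show ?thesis
  proof (cases "m \<le> 0")
    case True
    have "norm (bilateral_term a (- int (nat \<bar>m\<bar>)) u) \<le> C * norm q ^ nat \<bar>m\<bar>"
      by (rule neg) (use r in auto)
    also have "\<dots> \<le> ((r\<^sup>2 + 1) * C) * norm q ^ nat \<bar>m\<bar>"
      using C by (intro mult_right_mono) (auto simp: algebra_simps)
    finally show ?thesis using True bb by simp
  next
    case False
    have "norm (bilateral_term a (- int (nat m)) (1 / u)) \<le> C * norm q ^ nat m"
      by (rule neg) (use iu iu' in \<open>auto simp: norm_divide\<close>)
    moreover have "bilateral_term a m u = - (1 / u)\<^sup>2 * bilateral_term a (- int (nat m)) (1 / u)"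
      using bilateral_term_inverse[of u a m] u0 False by (simp add: power_divide)
    ultimately have "norm (bilateral_term a m u) \<le> (1 / norm u)\<^sup>2 * (C * norm q ^ nat m)"
      by (simp add: norm_mult norm_power norm_divide divide_right_mono power_divide)
    also have "\<dots> \<le> (r\<^sup>2 + 1) * (C * norm q ^ nat m)"
    proof (rule mult_right_mono)
      have "(1 / norm u)\<^sup>2 \<le> r\<^sup>2" using iu u0 by (intro power_mono) auto
      thus "(1 / norm u)\<^sup>2 \<le> r\<^sup>2 + 1" by simp
    qed (use C in auto)
    finally show ?thesis using False by (simp add: bb mult.assoc)
  qed
qed

lemma annulus_bounds:
  assumes "compact K" "K \<subseteq> -{0 :: complex}"
  obtains r where "r > 0" "\<And>z. z \<in> K \<Longrightarrow> 1 / r \<le> norm z \<and> norm z \<le> r"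
proof -
  have "bounded K" "bounded (inverse ` K)"
    using assms by (auto intro!: compact_imp_bounded compact_continuous_image continuous_intros)
  then obtain B B' where B: "\<And>z. z \<in> K \<Longrightarrow> norm z \<le> B" "\<And>z. z \<in> K \<Longrightarrow> norm (inverse z) \<le> B'"
    unfolding bounded_iff by auto
  define r where "r = max 1 (max B B')"
  have "1 / r \<le> norm z \<and> norm z \<le> r" if z: "z \<in> K" for z
  proof
    have "norm z > 0" using z assms by auto
    moreover have "inverse (norm z) \<le> r" using B(2)[OF z] by (auto simp: r_def norm_inverse)
    ultimately show "1 / r \<le> norm z" using inverse_le_imp_le[of "inverse r" "norm z"]
      by (simp add: field_simps r_def)
    show "norm z \<le> r" using B(1)[OF z] by (auto simp: r_def)
  qed
  moreover have "r > 0" by (auto simp: r_def)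
  ultimately show ?thesis using that by blast
qed

lemma bilateral_sum_uniform_limit:
  assumes K: "\<And>p. p \<in> K \<Longrightarrow> 1 / r \<le> norm (w p) \<and> norm (w p) \<le> r" "r > 0"
    and a: "\<And>p j. p \<in> K \<Longrightarrow> j \<in> {1..6} \<Longrightarrow> 1 / r \<le> norm (a p j) \<and> norm (a p j) \<le> r"
    and pr: "\<And>p. p \<in> K \<Longrightarrow> (\<Prod>j=1..6. a p j) = q"
  shows "uniform_limit K (\<lambda>X p. \<Sum>m\<in>X. bilateral_term (a p) m (w p))
    (\<lambda>p. bilateral_sum (a p) (w p)) (finite_subsets_at_top UNIV)"
  unfolding bilateral_sum_def
  by (rule Weierstrass_m_test_general[OF norm_bilateral_term_le summable_on_int_geometric])
     (use K a pr q_lt in auto)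

lemma bilateral_term_continuous:
  assumes "continuous_on K w" "\<And>j. j \<in> {1..6} \<Longrightarrow> continuous_on K (\<lambda>p. a p j)"
    and "\<And>p. p \<in> K \<Longrightarrow> w p \<noteq> 0" "\<And>p j. p \<in> K \<Longrightarrow> j \<in> {1..6} \<Longrightarrow> a p j \<noteq> 0"
  shows "continuous_on K (\<lambda>p. bilateral_term (a p) m (w p))"
  unfolding bilateral_term_def bilateral_factor_def
  by (intro continuous_intros assms) (use assms in auto)

lemma bilateral_term_holomorphic:
  assumes "\<And>j. j \<in> {1..6} \<Longrightarrow> a j \<noteq> 0"
  shows "bilateral_term a m holomorphic_on -{0}"
  unfolding bilateral_term_def bilateral_factor_def
  by (intro holomorphic_intros) (use assms in auto)

lemma bilateral_sum_holomorphic: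
  assumes a: "\<And>j. j \<in> {1..6} \<Longrightarrow> a j \<noteq> 0" and pr: "(\<Prod>j=1..6. a j) = q"
  shows "bilateral_sum a holomorphic_on -{0}"
proof -
  have "bilateral_sum a field_differentiable at z" if z: "z \<noteq> 0" for z
  proof -
    define d where "d = norm z / 2"
    have d: "d > 0" "cball z d \<subseteq> -{0}" using z by (auto simp: d_def)
    have "compact (cball z d \<union> a ` {1..6})"
      by (intro compact_Un compact_cball finite_imp_compact) auto
    moreover have "cball z d \<union> a ` {1..6} \<subseteq> -{0}" using d a by auto
    ultimately obtain r where r: "r > 0" "\<And>w. w \<in> cball z d \<union> a ` {1..6} \<Longrightarrow> 1 / r \<le> norm w \<and> norm w \<le> r"
      using annulus_bounds by metis
    have ul: "uniform_limit (cball z d) (\<lambda>X u. \<Sum>m\<in>X. bilateral_term a m u)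
        (bilateral_sum a) (finite_subsets_at_top UNIV)"
      using bilateral_sum_uniform_limit[of "cball z d" r "\<lambda>u. u" "\<lambda>_. a"] r pr by auto
    have "bilateral_sum a holomorphic_on ball z d"
    proof (rule holomorphic_uniform_limit[OF always_eventually ul])
      have h: "bilateral_term a m holomorphic_on cball z d" for m
        by (rule holomorphic_on_subset[OF bilateral_term_holomorphic]) (use a d in auto)
      show "\<forall>X. continuous_on (cball z d) (\<lambda>u. \<Sum>m\<in>X. bilateral_term a m u) \<and>
          (\<lambda>u. \<Sum>m\<in>X. bilateral_term a m u) holomorphic_on ball z d"
        by (intro allI conjI continuous_on_sum holomorphic_on_sum holomorphic_on_imp_continuous_on h
            holomorphic_on_subset[OF h ball_subset_cball])
    qed auto
    thus ?thesis using d by (intro holomorphic_on_imp_differentiable_at[of _ "ball z d"]) auto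
  qed
  thus ?thesis by (auto simp: holomorphic_on_def intro: field_differentiable_at_within)
qed

section \<open>Zeros of the bilateral sum and its expansion in two theta functions\<close>

lemma bilateral_sum_powi_shift:
  assumes "u \<noteq> 0"
  shows "bilateral_sum a (q powi n * u) = q powi (- (3 * n\<^sup>2 + n)) * u powi (- 6 * n) * bilateral_sum a u"
    (is "?P n")
proof -
  have step: "?P (n + 1) \<longleftrightarrow> ?P n" for n
  proof -
    let ?c = "q powi (4 + 6 * n) * u ^ 6"
    have "bilateral_sum a (q powi (n + 1) * u) = bilateral_sum a (q * (q powi n * u))"
      by (simp add: power_int_add mult_ac)
    also have "\<dots> = 1 / (q ^ 4 * (q powi n * u) ^ 6) * bilateral_sum a (q powi n * u)"
      using assms by (intro bilateral_sum_shift) auto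
    also have "q ^ 4 * (q powi n * u) ^ 6 = ?c"
    proof -
      have "(q powi n) ^ 6 = q powi (6 * n)"
        using power_int_mult[of q n 6] by (simp add: mult.commute)
      thus ?thesis by (simp add: power_mult_distrib power_int_add)
    qed
    finally have 1: "bilateral_sum a (q powi (n + 1) * u) = 1 / ?c * bilateral_sum a (q powi n * u)" .
    have e: "- (3 * (n + 1)\<^sup>2 + (n + 1)) = - (3 * n\<^sup>2 + n) + - (4 + 6 * n)"
      "- 6 * (n + 1) = - 6 * n + - 6"
      by (simp_all add: power2_eq_square algebra_simps)
    have 2: "q powi (- (3 * (n + 1)\<^sup>2 + (n + 1))) = q powi (- (3 * n\<^sup>2 + n)) / q powi (4 + 6 * n)"
      unfolding e(1) by (subst power_int_add) (simp_all only: q_nz simp_thms power_int_minus divide_inverse)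
    have 3: "u powi (- 6 * (n + 1)) = u powi (- 6 * n) / u ^ 6"
      unfolding e(2) using assms power_int_minus[of u 6]
      by (subst power_int_add) (simp_all add: divide_inverse)
    have "q powi (4 + 6 * n) \<noteq> 0" by simp
    thus ?thesis unfolding 1 2 3 using assms by (simp add: field_simps)
  qed
  show ?thesis
  proof (induction n rule: int_induct[where k = 0])
    case base show ?case by simp
  next
    case (step1 i) thus ?case using step[of i] by simp
  next
    case (step2 i) thus ?case using step[of "i - 1"] by simp
  qed
qed

text \<open>If \<open>u\<^sup>2 = q powi k\<close>, then \<open>1 / u\<close> lies on the orbit of
  \<open>u\<close> under \<open>q\<close>. The shift formula and the inversion formula then give
  values for the sum at \<open>1 / u\<close> that differ in sign only.\<close>

lemma bilateral_sum_zero: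
  assumes "u \<noteq> 0" "theta (u\<^sup>2) = 0"
  shows "bilateral_sum a u = 0"
proof -
  obtain k :: int where k: "u\<^sup>2 = q powi k"
    using assms theta_eq_0_iff[of "u\<^sup>2"] by auto
  have i: "1 / u = q powi (- k) * u"
    unfolding power_int_minus k[symmetric] using assms by (simp add: power2_eq_square field_simps)
  have "u powi (- 6 * (- k)) = q powi (3 * k\<^sup>2)"
  proof -
    have "u powi (- 6 * (- k)) = (u powi 2) powi (3 * k)"
      using power_int_mult[of u 2 "3 * k"] by simp
    also have "u powi 2 = q powi k" using k by simp
    also have "(q powi k) powi (3 * k) = q powi (3 * k\<^sup>2)"
      by (simp add: power2_eq_square mult_ac flip: power_int_mult)
    finally show ?thesis .
  qed
  moreover have "q powi (- (3 * (- k)\<^sup>2 + - k)) * q powi (3 * k\<^sup>2) = q powi k"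
    by (simp flip: power_int_add)
  ultimately have "bilateral_sum a (1 / u) = u\<^sup>2 * bilateral_sum a u"
    unfolding i bilateral_sum_powi_shift[OF assms(1)] k by simp
  moreover have "bilateral_sum a (1 / u) = - (u\<^sup>2 * bilateral_sum a u)"
    using bilateral_sum_inverse[OF assms(1), of a] by simp
  ultimately have "- (u\<^sup>2 * bilateral_sum a u) = u\<^sup>2 * bilateral_sum a u" by simp
  hence "u\<^sup>2 * bilateral_sum a u + u\<^sup>2 * bilateral_sum a u = 0"
    by (simp only: neg_eq_iff_add_eq_0)
  hence "2 * (u\<^sup>2 * bilateral_sum a u) = 0" by (simp only: mult_2)
  thus ?thesis using assms(1) by simp
qed

text \<open>The coefficient \<alpha> is chosen so that the difference \<phi> vanishes at
  \<open>y\<close>, hence, by shift and inversion, at all zeros of \<open>theta_pm y\<close>.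
  Together with the zeros from \<open>bilateral_sum_zero\<close> these are the zeros of
  \<open>D\<close>. The condition on \<open>theta (y\<^sup>2)\<close> keeps them simple, so \<phi>
  is a multiple of \<open>D\<close>.\<close>

lemma bilateral_sum_expansion:
  assumes a: "\<And>j. j \<in> {1..6} \<Longrightarrow> a j \<noteq> 0" and pr: "(\<Prod>j=1..6. a j) = q"
    and xy: "x \<noteq> 0" "y \<noteq> 0" and y2: "theta (y\<^sup>2) \<noteq> 0" and pm: "theta_pm x y \<noteq> 0"
  obtains \<alpha> \<beta> where "\<And>u. u \<noteq> 0 \<Longrightarrow>
    bilateral_sum a u = theta (u\<^sup>2) / u\<^sup>2 * (\<alpha> * theta_pm x u + \<beta> * theta_pm y u)"
proof -
  define \<alpha> where "\<alpha> = bilateral_sum a y * y\<^sup>2 / (theta (y\<^sup>2) * theta_pm x y)"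
  define m where "m = (\<lambda>u. 1 / (q ^ 4 * u ^ 6))"
  define \<phi> where "\<phi> = (\<lambda>u. bilateral_sum a u - theta (u\<^sup>2) / u\<^sup>2 * (\<alpha> * theta_pm x u))"
  define D where "D = (\<lambda>u. 1 / u\<^sup>2 * (theta (u\<^sup>2) * theta_pm y u))"
  have S: "bilateral_sum a holomorphic_on -{0}" by (rule bilateral_sum_holomorphic[OF a pr])
  have hol: "\<phi> holomorphic_on -{0}" "D holomorphic_on -{0}"
    unfolding \<phi>_def D_def using xy by (auto intro!: holomorphic_intros S)
  have th: "theta ((q * z)\<^sup>2) / (q * z)\<^sup>2 * theta_pm w (q * z) = m z * (theta (z\<^sup>2) / z\<^sup>2 * theta_pm w z)"
    if "z \<noteq> 0" "w \<noteq> 0" for z w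
    unfolding m_def theta_sq_q[OF that(1)] theta_pm_q[OF that(2,1)] using that
    by (simp add: field_simps power2_eq_square power4_eq_xxxx eval_nat_numeral)
  have q\<phi>: "\<phi> (q * z) = m z * \<phi> z" if "z \<noteq> 0" for z
  proof -
    have "\<phi> (q * z) = m z * bilateral_sum a z - \<alpha> * (theta ((q * z)\<^sup>2) / (q * z)\<^sup>2 * theta_pm x (q * z))"
      unfolding \<phi>_def bilateral_sum_shift[OF that] m_def by simp
    thus ?thesis unfolding th[OF that xy(1)] by (simp add: \<phi>_def algebra_simps)
  qed
  have qD: "D (q * z) = m z * D z" if "z \<noteq> 0" for z
    using th[OF that xy(2)] by (simp add: D_def)
  have mnz: "m z \<noteq> 0" if "z \<noteq> 0" for z using that by (simp add: m_def)
  have \<phi>0: "\<phi> z = 0" if "theta_pm y z = 0" "z \<noteq> 0" for z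
  proof -
    have "\<phi> y = 0" unfolding \<phi>_def \<alpha>_def using y2 pm xy by simp
    moreover have "\<phi> (1 / y) = - y\<^sup>2 * \<phi> y"
      unfolding \<phi>_def bilateral_sum_inverse[OF xy(2)] theta_sq_inverse[OF xy(2)] theta_pm_inverse
      using xy by (simp add: field_simps)
    ultimately have "\<phi> (1 / y) = 0" by simp
    have sh: "\<phi> (q powi k * w) = 0" if "\<phi> w = 0" "w \<noteq> 0" for k w
      by (rule multiplier_zeros[where f = \<phi> and m = m]) (use that q\<phi> mnz in auto)
    show ?thesis
    proof (rule theta_pm_eq_0D[OF xy(2) that(2,1)])
      fix k :: int assume "z = q powi k * y"
      thus ?thesis using sh[of y k] \<open>\<phi> y = 0\<close> xy by simp
    next
      fix k :: int assume "z = q powi k / y"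
      thus ?thesis using sh[of "1 / y" k] \<open>\<phi> (1 / y) = 0\<close> xy by simp
    qed
  qed
  obtain c where c: "\<And>z. z \<noteq> 0 \<Longrightarrow> \<phi> z = c * D z"
  proof (rule quasiperiodic_eq_cmult[where m = m, OF q_nz q_lt hol])
    fix z :: complex assume z: "z \<noteq> 0" and "D z = 0"
    hence or: "theta (z\<^sup>2) = 0 \<or> theta_pm y z = 0" by (auto simp: D_def)
    have nb: "theta (z\<^sup>2) \<noteq> 0 \<or> theta_pm y z \<noteq> 0"
    proof (rule ccontr)
      assume "\<not> ?thesis"
      then obtain k :: int where k: "z\<^sup>2 = q powi k" and 0: "theta_pm y z = 0"
        using theta_eq_0_iff[of "z\<^sup>2"] z by auto
      have psq: "(q powi l)\<^sup>2 = q powi (l + l)" for l :: int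
        unfolding power2_eq_square by (rule power_int_add[symmetric]) simp
      have "\<exists>l::int. y\<^sup>2 = q powi l"
      proof (rule theta_pm_eq_0D[OF xy(2) z 0])
        fix l :: int assume "z = q powi l * y"
        hence "y\<^sup>2 = q powi k / (q powi l)\<^sup>2" using k by (simp add: power_mult_distrib field_simps)
        also have "\<dots> = q powi (k - (l + l))"
          unfolding psq by (rule power_int_diff[symmetric]) simp
        finally show ?thesis by blast
      next
        fix l :: int assume "z = q powi l / y"
        hence "y = q powi l / z" using xy z by (simp add: field_simps)
        hence "y\<^sup>2 = (q powi l)\<^sup>2 / q powi k" unfolding k[symmetric] by (simp only: power_divide)
        also have "\<dots> = q powi (l + l - k)"
          unfolding psq by (rule power_int_diff[symmetric]) simp
        finally show ?thesis by blast
      qed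
      thus False using y2 theta_eq_0_iff[of "y\<^sup>2"] xy by auto
    qed
    show "\<phi> z = 0 \<and> deriv D z \<noteq> 0"
    proof
      show "\<phi> z = 0"
        using or \<phi>0[OF _ z] bilateral_sum_zero[OF z] by (auto simp: \<phi>_def)
      define H where "H = (\<lambda>z. theta (z\<^sup>2) * theta_pm y z)"
      have fd1: "(\<lambda>z. theta (z\<^sup>2)) field_differentiable at z"
        by (rule holomorphic_on_imp_differentiable_at[of _ "-{0}"]) (use z in \<open>auto intro!: holomorphic_intros\<close>)
      have fd2: "theta_pm y field_differentiable at z"
        by (rule holomorphic_on_imp_differentiable_at[of _ "-{0}"]) (use z xy in \<open>auto intro!: holomorphic_intros\<close>)
      have fd3: "(\<lambda>z. 1 / z\<^sup>2) field_differentiable at z"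
        by (rule holomorphic_on_imp_differentiable_at[of _ "-{0}"]) (use z in \<open>auto intro!: holomorphic_intros\<close>)
      have H: "H z = 0" "H field_differentiable at z"
        unfolding H_def using or by (auto intro!: field_differentiable_mult fd1 fd2)
      have "theta (z\<^sup>2) = 0 \<Longrightarrow> deriv (\<lambda>z. theta (z\<^sup>2)) z \<noteq> 0"
        by (rule theta_compose_simple_zeros[where h' = "2 * z"])
           (use z in \<open>auto intro!: derivative_eq_intros\<close>)
      hence "deriv H z \<noteq> 0"
        unfolding H_def using nb or z theta_pm_simple_zeros[OF xy(2) z y2]
        by (intro deriv_mult_at_simple_zero fd1 fd2) auto
      hence "deriv (\<lambda>z. 1 / z\<^sup>2 * H z) z \<noteq> 0"
        using H z fd3 by (intro deriv_mult_at_simple_zero) auto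
      thus "deriv D z \<noteq> 0" unfolding D_def H_def .
    qed
  qed (use q\<phi> qD mnz in auto)
  have "bilateral_sum a u = theta (u\<^sup>2) / u\<^sup>2 * (\<alpha> * theta_pm x u + c * theta_pm y u)" if "u \<noteq> 0" for u
    using c[OF that] by (simp add: \<phi>_def D_def algebra_simps add_divide_distrib)
  thus ?thesis by (rule that)
qed

subsection \<open>Moving the Nassrallah-Rahman contour towards 0\<close>

text \<open>Under this condition the poles \<open>a j * q ^ k\<close> of the Nassrallah-Rahman
  integrand are simple and the denominators of the partial fractions do not vanish. A perturbation
  removes it at the end.\<close>

definition generic_pairs :: "(nat \<Rightarrow> complex) \<Rightarrow> bool" where
  "generic_pairs a \<longleftrightarrow> (\<forall>j\<in>{1..6}. a j \<noteq> 0 \<and> theta ((a j)\<^sup>2) \<noteq> 0) \<and>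
     (\<forall>i\<in>{1..6}. \<forall>j\<in>{1..6}. i \<noteq> j \<longrightarrow> theta_pm (a i) (a j) \<noteq> 0)"

text \<open>The quotient of the Nassrallah-Rahman integrand by \<open>bilateral_term a 0\<close>:
  completing every denominator to a theta function leaves a quotient of theta functions, which is
  quasi-periodic.\<close>

definition nr_kernel :: "(nat \<Rightarrow> complex) \<Rightarrow> complex \<Rightarrow> complex" where
  "nr_kernel a w = theta (w\<^sup>2) / (\<Prod>j=1..5. theta_pm (a j) w)"

lemma prod_1_5: "(\<Prod>j=1..5. f j) = f 1 * f 2 * f 3 * f 4 * (f 5 :: complex)" for f :: "nat \<Rightarrow> complex"
  by (simp add: eval_nat_numeral prod.nat_ivl_Suc' mult_ac)

lemma prod_1_6: "(\<Prod>j=1..6. f j) = f 1 * f 2 * f 3 * f 4 * f 5 * (f 6 :: complex)" for f :: "nat \<Rightarrow> complex"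
  by (simp add: eval_nat_numeral prod.nat_ivl_Suc' mult_ac)

lemma nr_integrand_eq_kernel:
  assumes a: "\<And>j. j \<in> {1..6} \<Longrightarrow> a j \<noteq> 0" and pr: "(\<Prod>j=1..6. a j) = q"
    and w: "w \<noteq> 0" "\<And>j. j \<in> {1..5} \<Longrightarrow> theta_pm (a j) w \<noteq> 0"
  shows "nr_integrand (a 1) (a 2) (a 3) (a 4) (a 5) w = nr_kernel a w * bilateral_term a 0 w"
proof -
  have A: "a 1 * a 2 * a 3 * a 4 * a 5 = q / a 6" "a 6 \<noteq> 0"
    using pr a[of 6] unfolding prod_1_6 by (simp_all add: field_simps)
  have c: "qp (q / (a j * w)) * qp (q * w / a j) / theta_pm (a j) w = 1 / (qp (a j * w) * qp (a j / w))"
    if "j \<in> {1..5}" for j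
    using w(2)[OF that] by (simp add: theta_pm_def theta_def mult_ac)
  have "bilateral_factor a w / (\<Prod>j=1..5. theta_pm (a j) w) =
      (\<Prod>j=1..5. qp (q / (a j * w)) * qp (q * w / a j) / theta_pm (a j) w) * (qp (q / (a 6 * w)) * qp (q * w / a 6))"
    unfolding bilateral_factor_def prod_1_6 prod_dividef prod_1_5 by simp
  also have "(\<Prod>j=1..5. qp (q / (a j * w)) * qp (q * w / a j) / theta_pm (a j) w) =
      (\<Prod>j=1..5. 1 / (qp (a j * w) * qp (a j / w)))"
    by (intro prod.cong refl c)
  finally have e: "bilateral_factor a w / (\<Prod>j=1..5. theta_pm (a j) w) =
      (\<Prod>j=1..5. 1 / (qp (a j * w) * qp (a j / w))) * (qp (q / (a 6 * w)) * qp (q * w / a 6))" .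
  have t: "theta (w\<^sup>2) * (1 - 1 / w\<^sup>2) = qp (w\<^sup>2) * qp (1 / w\<^sup>2)"
    using qp_rec[of "1 / w\<^sup>2"] by (simp add: theta_def)
  have "nr_kernel a w * bilateral_term a 0 w =
      (theta (w\<^sup>2) * (1 - 1 / w\<^sup>2)) * (bilateral_factor a w / (\<Prod>j=1..5. theta_pm (a j) w))"
    by (simp add: nr_kernel_def bilateral_term_def)
  also have "\<dots> = nr_integrand (a 1) (a 2) (a 3) (a 4) (a 5) w"
    unfolding e t unfolding nr_integrand_def A(1) prod_1_5 by (simp add: mult_ac)
  finally show ?thesis by simp
qed

text \<open>The multiplier of the kernel is inverse to that of the bilateral terms. Hence the
  integrand at \<open>q ^ n * w\<close> is the kernel at \<open>w\<close> times the term of index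
  \<open>- n\<close>, and the residues along an orbit become the terms of the series.\<close>

lemma nr_kernel_shift:
  assumes "\<And>j. j \<in> {1..5} \<Longrightarrow> a j \<noteq> 0" "w \<noteq> 0"
  shows "nr_kernel a (q * w) * bilateral_term a (m + 1) (q * w) = nr_kernel a w * bilateral_term a m w"
proof -
  have "(\<Prod>j=1..5. theta_pm (a j) (q * w)) = (\<Prod>j=1..5. theta_pm (a j) w) / (q * w\<^sup>2) ^ 5"
    using assms by (simp add: theta_pm_q prod_dividef)
  hence "nr_kernel a (q * w) = q ^ 4 * w ^ 6 * nr_kernel a w"
    unfolding nr_kernel_def theta_sq_q[OF assms(2)] using assms
    by (simp add: power_mult_distrib eval_nat_numeral)
  thus ?thesis using assms unfolding bilateral_term_shift[OF assms(2)] by simp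
qed

lemma nr_integrand_power_shift:
  assumes a: "\<And>j. j \<in> {1..6} \<Longrightarrow> a j \<noteq> 0" and pr: "(\<Prod>j=1..6. a j) = q"
    and w: "w \<noteq> 0" "\<And>j. j \<in> {1..5} \<Longrightarrow> theta_pm (a j) w \<noteq> 0"
  shows "nr_integrand (a 1) (a 2) (a 3) (a 4) (a 5) (q ^ n * w) = nr_kernel a w * bilateral_term a (- int n) w"
proof -
  have nz: "theta_pm (a j) (q ^ n * w) \<noteq> 0" if "j \<in> {1..5}" for j
  proof (induction n)
    case (Suc n)
    thus ?case using theta_pm_q[of "a j" "q ^ n * w"] a[of j] w(1) that by (simp add: mult_ac)
  qed (use w that in simp)
  have "nr_kernel a (q ^ n * w) * bilateral_term a (m + int n) (q ^ n * w) = nr_kernel a w * bilateral_term a m w" for m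
  proof (induction n)
    case (Suc n)
    have "nr_kernel a (q * (q ^ n * w)) * bilateral_term a (m + int n + 1) (q * (q ^ n * w)) =
        nr_kernel a (q ^ n * w) * bilateral_term a (m + int n) (q ^ n * w)"
      using a w by (intro nr_kernel_shift) auto
    thus ?case using Suc by (simp add: mult_ac add_ac)
  qed simp
  from this[of "- int n"] show ?thesis
    using nr_integrand_eq_kernel[OF a pr _ nz] w by simp
qed

text \<open>One factor has the argument \<open>q powi (1 - m)\<close>, a power with exponent at most
  0, where \<open>qp\<close> vanishes. So at \<open>a j\<close> only the indices
  \<open>m \<le> 0\<close> survive, in accordance with the poles \<open>a j * q ^ k\<close> for
  \<open>k \<ge> 0\<close>.\<close>

lemma bilateral_term_eq_0:
  assumes "j \<in> {1..6}" "a j \<noteq> 0" "m > 0"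
  shows "bilateral_term a m (a j) = 0"
proof -
  have "q * (a j * q powi (- m)) / a j * q ^ nat (m - 1) = q powi (1 + - m + (m - 1))"
    using assms unfolding power_int_add[OF disjI1[OF q_nz]] by (simp add: power_int_def)
  also have "\<dots> = 1" by simp
  finally have "qp (q * (a j * q powi (- m)) / a j) = 0"
    unfolding qp_eq_0_iff by blast
  hence "bilateral_factor a (a j * q powi (- m)) = 0"
    unfolding bilateral_factor_def using assms(1)
    by (intro prod_zero bexI[of _ j]) (simp_all only: mult_eq_0_iff finite_atLeastAtMost simp_thms)
  thus ?thesis by (simp add: bilateral_term_def)
qed

lemma bilateral_sum_sums:
  assumes a: "\<And>j. j \<in> {1..6} \<Longrightarrow> a j \<noteq> 0" and pr: "(\<Prod>j=1..6. a j) = q" and j: "j \<in> {1..6}"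
  shows "(\<lambda>n. bilateral_term a (- int n) (a j)) sums bilateral_sum a (a j)"
proof -
  have "compact (a ` {1..6})" "a ` {1..6} \<subseteq> -{0}" using a by (auto intro: finite_imp_compact)
  then obtain r where r: "r > 0" "\<And>w. w \<in> a ` {1..6} \<Longrightarrow> 1 / r \<le> norm w \<and> norm w \<le> r"
    using annulus_bounds by metis
  have le: "norm (bilateral_term a m (a j)) \<le> bilateral_bound r * norm q ^ nat \<bar>m\<bar>" for m
    by (rule norm_bilateral_term_le) (use r j pr in auto)
  have "(\<lambda>m. norm (bilateral_term a m (a j))) summable_on UNIV"
    by (rule summable_on_comparison_test[OF summable_on_int_geometric[of "norm q" "bilateral_bound r"]])
       (use q_lt le in auto)
  hence "(\<lambda>m. bilateral_term a m (a j)) summable_on UNIV" by (rule abs_summable_summable)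
  hence "((\<lambda>m. bilateral_term a m (a j)) has_sum bilateral_sum a (a j)) UNIV"
    unfolding bilateral_sum_def by (rule has_sum_infsum)
  hence "((\<lambda>m. bilateral_term a m (a j)) has_sum bilateral_sum a (a j)) (range (\<lambda>n. - int n))"
  proof (rule has_sum_cong_neutral[THEN iffD1, rotated -1])
    fix m assume "m \<in> UNIV - range (\<lambda>n. - int n)"
    hence "m > 0" by (metis DiffE minus_minus nonneg_int_cases not_le range_eqI neg_0_le_iff_le)
    thus "bilateral_term a m (a j) = 0" using bilateral_term_eq_0[of j a m] j a by simp
  qed auto
  hence "((\<lambda>n. bilateral_term a (- int n) (a j)) has_sum bilateral_sum a (a j)) UNIV"
    by (subst (asm) has_sum_reindex) (auto simp: o_def inj_on_def)
  thus ?thesis by (rule has_sum_imp_sums)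
qed

text \<open>Including the points \<open>q / a j\<close> makes the contour separate the forward orbit of each
  \<open>a j\<close> from its backward orbit, so the curve and its image under \<open>q ^ n\<close> differ by exactly
  \<open>n\<close> poles of each family.\<close>

lemma nr_integral_eq_bilateral_sums:
  assumes gen: "generic_pairs a" and pr: "(\<Prod>j=1..6. a j) = q"
    and g: "separates (a ` {1..5} \<union> (\<lambda>j. q / a j) ` {1..5}) g"
  shows "nr_integral g (a 1) (a 2) (a 3) (a 4) (a 5) =
    2 * of_real pi * \<i> * (\<Sum>j=1..5. bilateral_sum a (a j) /
       ((qp q)\<^sup>2 * (\<Prod>i\<in>{1..5}-{j}. theta_pm (a i) (a j))))"
proof -
  define T where "T = a ` {1..5} \<union> (\<lambda>j. q / a j) ` {1..5}"
  note g = g[folded T_def]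
  have T: "finite T" by (simp add: T_def)
  have Ta: "a j \<in> T" "q / a j \<in> T" if "j \<in> {1..5}" for j using that by (auto simp: T_def)
  have a: "a j \<noteq> 0" if "j \<in> {1..6}" for j using gen that by (simp add: generic_pairs_def)
  have a5: "a j \<noteq> 0" if "j \<in> {1..5}" for j using a[of j] that by simp
  have pmn: "theta_pm (a i) (a j) \<noteq> 0" if "i \<in> {1..5}" "j \<in> {1..5}" "i \<noteq> j" for i j
    using gen that by (simp add: generic_pairs_def)
  have sqn: "theta ((a j)\<^sup>2) \<noteq> 0" if "j \<in> {1..5}" for j
    using gen that by (simp add: generic_pairs_def)
  define G where "G = nr_integrand (a 1) (a 2) (a 3) (a 4) (a 5)"
  define \<kappa> where "\<kappa> = (\<lambda>j. 1 / ((qp q)\<^sup>2 * (\<Prod>i\<in>{1..5}-{j}. theta_pm (a i) (a j))))"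
  have g': "valid_path g" "pathfinish g = pathstart g" "path_image g \<subseteq> regular_set T"
    using g by (auto simp: separates_def)
  have wn1: "winding_number g (a j * q ^ k) = 1" if "j \<in> {1..5}" for j k
  proof -
    have "a j / (a j * q ^ k) * q ^ k = 1" using a5[OF that] by simp
    hence "qp (a j / (a j * q ^ k)) = 0" unfolding qp_eq_0_iff by blast
    thus ?thesis using g Ta[OF that] a5[OF that] unfolding separates_def by auto
  qed
  have wn2: "winding_number g (a j * q ^ k / q ^ n) = 0 \<and> a j * q ^ k / q ^ n \<notin> regular_set T"
    if "j \<in> {1..5}" "k < n" for j k n
  proof -
    have "q / a j * (a j * q ^ k / q ^ n) * q ^ (n - k - 1) = q ^ (1 + k + (n - k - 1)) / q ^ n"
      using a5[OF that(1)] unfolding power_add by simp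
    also have "1 + k + (n - k - 1) = n" using that by simp
    finally have "qp (q / a j * (a j * q ^ k / q ^ n)) = 0"
      unfolding qp_eq_0_iff by (intro exI[of _ "n - k - 1"]) simp
    moreover have "a j * q ^ k / q ^ n \<noteq> 0" using a5[OF that(1)] by simp
    ultimately show ?thesis using g Ta(2)[OF that(1)] unfolding separates_def regular_set_def by blast
  qed
  have reg_theta: "theta_pm (a j) u \<noteq> 0" if "u \<in> regular_set T" "j \<in> {1..5}" for u j
  proof -
    have "u \<noteq> 0" "qp (a j * u) \<noteq> 0" "qp (a j / u) \<noteq> 0" "qp (q / a j * u) \<noteq> 0" "qp (q / a j / u) \<noteq> 0"
      using that(1) Ta[OF that(2)] unfolding regular_set_def by auto
    thus ?thesis using a5[OF that(2)] by (simp add: theta_pm_def theta_def)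
  qed
  define P where "P = (\<lambda>n. (\<lambda>(j, k). a j * q ^ k) ` ({1..5} \<times> {..<n}))"
  \<comment> \<open>In \<open>S n\<close> the inner sequences start at \<open>q ^ n * a j\<close>.
    The earlier points, collected in \<open>P n\<close>, count as isolated singularities; they are
    what lies between the curve and its image under \<open>q ^ n\<close>.\<close>
  define S where "S = (\<lambda>n::nat. {u. u \<noteq> 0 \<and> (\<forall>j\<in>{1..5}. qp (a j * u) \<noteq> 0 \<and> qp (q ^ n * a j / u) \<noteq> 0)})"
  have finP: "finite (P n)" for n by (simp add: P_def)
  have PE: "\<exists>j\<in>{1..5}. \<exists>k<n. u = a j * q ^ k" if "u \<in> P n" for u n
    using that by (auto simp: P_def)
  have regS: "regular_set T \<subseteq> S n" for n
    unfolding S_def regular_set_def using Ta qp_q_power_mult_neq_0[of "a _ / _" n] by auto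
  have openS: "open (S n)" for n
  proof -
    have "open (-{0} \<inter> (\<lambda>u. \<Prod>j=1..5. qp (a j * u) * qp (q ^ n * a j / u)) -` (-{0}))"
      by (rule continuous_open_preimage) (auto intro!: continuous_intros)
    also have "-{0} \<inter> (\<lambda>u. \<Prod>j=1..5. qp (a j * u) * qp (q ^ n * a j / u)) -` (-{0}) = S n"
      by (auto simp: S_def)
    finally show ?thesis .
  qed
  have connS: "connected (S n)" for n
  proof -
    have "countable (- S n)"
      by (rule countable_subset[OF _ countable_Compl_regular_set[OF T]]) (use regS in auto)
    thus ?thesis using path_connected_complement_countable[of "- S n"]
      by (simp add: path_connected_imp_connected)
  qed
  have SP: "qp (a j / u) \<noteq> 0" if "u \<in> S n - P n" "j \<in> {1..5}" for u j n
  proof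
    assume "qp (a j / u) = 0"
    then obtain k where k: "a j / u * q ^ k = 1" by (auto simp: qp_eq_0_iff)
    have "u \<noteq> 0" using that by (auto simp: S_def)
    hence u: "u = a j * q ^ k" using k by (simp add: field_simps)
    show False
    proof (cases "k < n")
      case True
      thus False using that u by (auto simp: P_def)
    next
      case False
      hence "q ^ n * a j / u * q ^ (k - n) = 1"
        using u a5[OF that(2)] by (simp add: power_add[symmetric])
      hence "qp (q ^ n * a j / u) = 0" unfolding qp_eq_0_iff by blast
      thus False using that by (auto simp: S_def)
    qed
  qed
  have holG: "(\<lambda>u. G u / u) holomorphic_on S n - P n" for n
  proof -
    have "u \<in> regular_set {a 1, a 2, a 3, a 4, a 5}" if "u \<in> S n - P n" for u
      using SP[OF that] that unfolding S_def regular_set_def by auto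
    moreover have "regular_set {a 1, a 2, a 3, a 4, a 5} \<subseteq> -{0}" by (auto simp: regular_set_def)
    moreover have "(\<lambda>u. G u / u) holomorphic_on regular_set {a 1, a 2, a 3, a 4, a 5}"
      unfolding G_def by (intro holomorphic_intros nr_integrand_holomorphic) (auto simp: regular_set_def)
    ultimately show ?thesis by (meson holomorphic_on_subset subsetI)
  qed
  have inS: "a j * q ^ k \<in> S n" if "j \<in> {1..5}" "k < n" for j k n
  proof -
    have "qp (a i * (a j * q ^ k)) \<noteq> 0 \<and> qp (q ^ n * a i / (a j * q ^ k)) \<noteq> 0" if i: "i \<in> {1..5}" for i
    proof
      have "theta (a i * a j) \<noteq> 0"
        using pmn[OF i \<open>j \<in> _\<close>] sqn[OF i] by (cases "i = j") (auto simp: theta_pm_def power2_eq_square)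
      hence "qp (a i * a j) \<noteq> 0" using a5 i \<open>j \<in> _\<close> by (auto simp: theta_def)
      thus "qp (a i * (a j * q ^ k)) \<noteq> 0"
        using qp_q_power_mult_neq_0[of "a i * a j" k] by (simp add: mult_ac)
      have e: "q ^ n * a i / (a j * q ^ k) = q ^ (n - k - 1) * (q * a i / a j)"
      proof -
        have "q ^ n = q ^ (n - k - 1) * q * q ^ k"
          using \<open>k < n\<close> by (simp add: power_add[symmetric] power_Suc2[symmetric] del: power_Suc)
        thus ?thesis by simp
      qed
      have "qp (q * a i / a j) \<noteq> 0"
      proof (cases "i = j")
        case True
        thus ?thesis using a5[OF i] by simp
      next
        case False
        have "theta (a j / a i) \<noteq> 0" using pmn[OF \<open>j \<in> _\<close> i] False by (auto simp: theta_pm_def)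
        thus ?thesis by (auto simp: theta_def)
      qed
      thus "qp (q ^ n * a i / (a j * q ^ k)) \<noteq> 0"
        unfolding e by (rule qp_q_power_mult_neq_0)
    qed
    thus ?thesis using a5[OF that(1)] by (simp add: S_def)
  qed
  have res: "residue (\<lambda>u. G u / u) (a j * q ^ k) = \<kappa> j * bilateral_term a (- int k) (a j)"
    if j: "j \<in> {1..5}" and k: "k < n" for j k n
  proof -
    let ?p = "a j * q ^ k"
    \<comment> \<open>In the limit, \<open>theta (w\<^sup>2)\<close> cancels
      \<open>theta (a j * w)\<close>, and \<open>theta (a j / w)\<close> is
      \<open>(w - a j) / w\<close> times a factor that tends to \<open>(qp q)^2\<close>. This is how
      \<open>\<kappa> j\<close> arises.\<close>
    define Nu where "Nu = (\<lambda>w. theta (w\<^sup>2) * bilateral_term a (- int k) w)"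
    define De where "De = (\<lambda>w. (\<Prod>i\<in>{1..5}-{j}. theta_pm (a i) w) * theta (a j * w) *
        (qp (q * a j / w) * qp (q * w / a j)))"
    have Nu: "isCont Nu (a j)" unfolding Nu_def
      by (rule holomorphic_on_imp_isCont[of _ "-{0}"])
         (use a5[OF j] in \<open>auto intro!: holomorphic_intros bilateral_term_holomorphic a\<close>)
    have De: "isCont De (a j)" unfolding De_def
      by (rule holomorphic_on_imp_isCont[of _ "-{0}"])
         (use a5[OF j] in \<open>auto intro!: holomorphic_intros a5\<close>)
    have De0: "De (a j) \<noteq> 0"
      unfolding De_def using pmn[OF _ j] sqn[OF j] a5[OF j] by (auto simp: power2_eq_square)
    have t1: "((\<lambda>w. Nu w / De w) \<longlongrightarrow> Nu (a j) / De (a j)) (at (a j))"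
      using Nu De De0 by (intro tendsto_divide) (auto simp: isCont_def)
    have t2: "Nu (a j) / De (a j) = \<kappa> j * bilateral_term a (- int k) (a j)"
      using sqn[OF j] a5[OF j] by (simp add: Nu_def De_def \<kappa>_def power2_eq_square)
    have t3: "\<forall>\<^sub>F w in at (a j). Nu w / De w = G (q ^ k * w) * ((w - a j) / w)"
    proof -
      have "\<forall>\<^sub>F w in at (a j). De w \<noteq> 0"
        using isCont_eventually_nonzero[OF De De0] by (simp add: eventually_at_filter eventually_mono)
      moreover have "\<forall>\<^sub>F w in at (a j). w \<noteq> 0"
        by (rule tendsto_imp_eventually_ne[OF tendsto_ident_at a5[OF j]])
      moreover have "\<forall>\<^sub>F w in at (a j). w \<noteq> a j" by (simp add: eventually_at_filter)
      ultimately show ?thesis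
      proof eventually_elim
        case (elim w)
        have th: "theta (a j / w) = ((w - a j) / w) * (qp (q * a j / w) * qp (q * w / a j))"
          using elim qp_rec[of "a j / w"] by (simp add: theta_def diff_divide_distrib)
        have pmj: "theta_pm (a j) w = theta (a j * w) * ((w - a j) / w) * (qp (q * a j / w) * qp (q * w / a j))"
          unfolding theta_pm_def th by (simp only: mult_ac)
        have nz: "theta_pm (a i) w \<noteq> 0" if "i \<in> {1..5}" for i
          using elim that pmj by (cases "i = j") (auto simp: De_def)
        have "(\<Prod>i=1..5. theta_pm (a i) w) = theta_pm (a j) w * (\<Prod>i\<in>{1..5}-{j}. theta_pm (a i) w)"
          using j by (intro prod.remove) auto
        also have "\<dots> = ((w - a j) / w) * De w"
          unfolding pmj De_def by (simp only: mult_ac)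
        finally have e1: "nr_kernel a w = theta (w\<^sup>2) / (((w - a j) / w) * De w)"
          unfolding nr_kernel_def by simp
        have e2: "G (q ^ k * w) = nr_kernel a w * bilateral_term a (- int k) w"
          unfolding G_def by (rule nr_integrand_power_shift[OF a pr elim(2) nz])
        have nzx: "(w - a j) / w \<noteq> 0" using elim by simp
        have "t * b / d = t / (x * d) * b * x" if "x \<noteq> 0" for t b d x :: complex
          using that by simp
        thus ?case unfolding Nu_def e2 e1 using nzx by blast
      qed
    qed
    have "((\<lambda>w. G (q ^ k * w) * ((w - a j) / w)) \<longlongrightarrow> \<kappa> j * bilateral_term a (- int k) (a j)) (at (a j))"
      using Lim_transform_eventually[OF t1 t3] unfolding t2 .
    moreover have "filterlim (\<lambda>u. u / q ^ k) (at (a j)) (at ?p)"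
    proof (rule filterlim_atI)
      show "((\<lambda>u. u / q ^ k) \<longlongrightarrow> a j) (at ?p)"
        by (rule tendsto_eq_intros refl)+ auto
      show "\<forall>\<^sub>F u in at ?p. u / q ^ k \<noteq> a j"
        by (auto simp: eventually_at_filter field_simps)
    qed
    ultimately have "((\<lambda>u. G (q ^ k * (u / q ^ k)) * ((u / q ^ k - a j) / (u / q ^ k))) \<longlongrightarrow>
        \<kappa> j * bilateral_term a (- int k) (a j)) (at ?p)"
      by (rule filterlim_compose)
    also have "(\<lambda>u. G (q ^ k * (u / q ^ k)) * ((u / q ^ k - a j) / (u / q ^ k))) = (\<lambda>u. G u / u * (u - ?p))"
    proof
      fix u
      have e: "u / q ^ k - a j = (u - ?p) / q ^ k" by (simp add: diff_divide_distrib)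
      show "G (q ^ k * (u / q ^ k)) * ((u / q ^ k - a j) / (u / q ^ k)) = G u / u * (u - ?p)"
        unfolding e by simp
    qed
    finally show ?thesis
    proof (rule residue_simple'[rotated 3])
      show "open (S n - (P n - {?p}))"
        using openS finP by (intro open_Diff finite_imp_closed) auto
      show "?p \<in> S n - (P n - {?p})" using inS[OF j k] by simp
      show "(\<lambda>u. G u / u) holomorphic_on S n - (P n - {?p}) - {?p}"
        by (rule holomorphic_on_subset[OF holG[of n]]) auto
    qed
  qed
  have inj: "inj_on (\<lambda>(j, k). a j * q ^ k) ({1..5} \<times> {..<n})" for n :: nat
  proof (rule inj_onI, clarify)
    fix i j k l assume ij: "i \<in> {1..5}" "j \<in> {1..5}" and eq: "a i * q ^ k = a j * q ^ l"
    have "i = j"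
    proof (rule ccontr)
      assume "i \<noteq> j"
      have "a i / a j = q powi (int l - int k)"
        using eq a5[OF ij(2)] by (simp add: power_int_diff field_simps)
      hence "theta (a i / a j) = 0" using theta_eq_0_iff[of "a i / a j"] a5 ij by auto
      thus False using pmn[OF ij \<open>i \<noteq> j\<close>] by (simp add: theta_pm_def)
    qed
    moreover have "norm q ^ k = norm q ^ l"
      using eq a5[OF ij(1)] \<open>i = j\<close> by (simp flip: norm_power)
    hence "k = l" using q_lt by (simp add: power_inject_exp')
    ultimately show "i = j \<and> k = l" by simp
  qed
  have main: "contour_integral g (\<lambda>u. G u / u) - contour_integral g (\<lambda>u. nr_kernel a u / u * bilateral_term a (- int n) u)
     = 2 * of_real pi * \<i> * (\<Sum>j=1..5. \<Sum>k<n. \<kappa> j * bilateral_term a (- int k) (a j))" for n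
  proof -
    define h where "h = (\<lambda>t. q ^ n * g t)"
    have h: "valid_path h" "pathfinish h = pathstart h"
      unfolding h_def using g' by (auto intro!: valid_path_scale simp: pathfinish_def pathstart_def)
    have wh: "winding_number h z = winding_number g (z / q ^ n)" if "z / q ^ n \<notin> regular_set T" for z
      using winding_number_scale[OF g'(1), of "q ^ n" "z / q ^ n"] that g'(3) by (auto simp: h_def)
    have gim: "path_image g \<subseteq> S n - P n"
    proof
      fix u assume "u \<in> path_image g"
      hence u: "u \<in> regular_set T" using g' by auto
      have "u \<notin> P n"
      proof
        assume "u \<in> P n"
        then obtain j k where jk: "j \<in> {1..5}" "u = a j * q ^ k" using PE by blast
        have "a j / u * q ^ k = 1" using jk a5[OF jk(1)] by simp
        hence "qp (a j / u) = 0" unfolding qp_eq_0_iff by blast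
        thus False using u Ta(1)[OF jk(1)] by (auto simp: regular_set_def)
      qed
      thus "u \<in> S n - P n" using u regS by auto
    qed
    have him: "path_image h \<subseteq> S n - P n"
    proof
      fix u assume "u \<in> path_image h"
      then obtain v where v: "v \<in> path_image g" "u = q ^ n * v"
        unfolding h_def path_image_scale by auto
      hence v': "v \<in> regular_set T" using g' by auto
      have "u \<notin> P n"
      proof
        assume "u \<in> P n"
        then obtain j k where jk: "j \<in> {1..5}" "k < n" "u = a j * q ^ k" using PE by blast
        hence "v = a j * q ^ k / q ^ n" using v by (simp add: field_simps)
        thus False using wn2[OF jk(1,2)] v' by simp
      qed
      moreover have "qp (a j * u) \<noteq> 0 \<and> qp (q ^ n * a j / u) \<noteq> 0" if "j \<in> {1..5}" for j
      proof -
        have "qp (a j * v) \<noteq> 0" "qp (a j / v) \<noteq> 0"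
          using v' Ta(1)[OF that] by (auto simp: regular_set_def)
        moreover have "a j * u = q ^ n * (a j * v)" "q ^ n * a j / u = a j / v" using v by auto
        ultimately show ?thesis using qp_q_power_mult_neq_0 by metis
      qed
      moreover have "u \<noteq> 0" using v v' by (auto simp: regular_set_def)
      ultimately show "u \<in> S n - P n" by (simp add: S_def)
    qed
    have weq: "winding_number g z = winding_number h z" if zS: "z \<notin> S n" for z
    proof -
      consider "z = 0" | j where "z \<noteq> 0" "j \<in> {1..5}" "qp (a j * z) = 0"
        | j where "z \<noteq> 0" "j \<in> {1..5}" "qp (q ^ n * a j / z) = 0"
        using zS unfolding S_def by blast
      thus ?thesis
      proof cases
        case 1
        thus ?thesis using wh[of 0] by (simp add: regular_set_def)
      next
        case (2 j)
        have "a j * z = q ^ n * (a j * (z / q ^ n))" by simp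
        hence 0: "qp (a j * (z / q ^ n)) = 0" using qp_q_power_mult_neq_0 2 by metis
        moreover have "z / q ^ n \<noteq> 0" using 2 by simp
        ultimately have "z / q ^ n \<notin> regular_set T" "winding_number g (z / q ^ n) = 0" "winding_number g z = 0"
          using g Ta(1)[OF 2(2)] 2(1,3) unfolding separates_def regular_set_def by blast+
        thus ?thesis using wh by simp
      next
        case (3 j)
        have "q ^ n * a j / z = q ^ n * (a j / z)" "q ^ n * a j / z = a j / (z / q ^ n)" by simp_all
        hence 0: "qp (a j / (z / q ^ n)) = 0" "qp (a j / z) = 0" using qp_q_power_mult_neq_0 3 by metis+
        moreover have "z / q ^ n \<noteq> 0" using 3 by simp
        ultimately have "z / q ^ n \<notin> regular_set T" "winding_number g (z / q ^ n) = 1" "winding_number g z = 1"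
          using g Ta(1)[OF 3(2)] 3(1) unfolding separates_def regular_set_def by blast+
        thus ?thesis using wh by simp
      qed
    qed
    have "contour_integral h (\<lambda>u. G u / u) = contour_integral g (\<lambda>u. q ^ n * (G (q ^ n * u) / (q ^ n * u)))"
      unfolding h_def using g' by (intro contour_integral_scale) auto
    also have "\<dots> = contour_integral g (\<lambda>u. nr_kernel a u / u * bilateral_term a (- int n) u)"
    proof (rule contour_integral_cong[OF refl])
      fix u assume "u \<in> path_image g"
      hence u: "u \<in> regular_set T" using g' by auto
      hence "u \<noteq> 0" by (simp add: regular_set_def)
      from nr_integrand_power_shift[OF a pr this reg_theta[OF u], of n]
      show "q ^ n * (G (q ^ n * u) / (q ^ n * u)) = nr_kernel a u / u * bilateral_term a (- int n) u"
        unfolding G_def by simp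
    qed
    finally have "contour_integral g (\<lambda>u. G u / u) - contour_integral g (\<lambda>u. nr_kernel a u / u * bilateral_term a (- int n) u)
      = 2 * pi * \<i> * (\<Sum>p\<in>P n. (winding_number g p - winding_number h p) * residue (\<lambda>u. G u / u) p)"
      using contour_integral_diff_residues[OF openS connS finP holG g'(1,2) gim h him weq] by simp
    also have "(\<Sum>p\<in>P n. (winding_number g p - winding_number h p) * residue (\<lambda>u. G u / u) p) =
      (\<Sum>(j,k)\<in>{1..5} \<times> {..<n}. \<kappa> j * bilateral_term a (- int k) (a j))"
      unfolding P_def
    proof (subst sum.reindex[OF inj], rule sum.cong[OF refl])
      fix x assume "x \<in> {1..5::nat} \<times> {..<n}"
      then obtain j k where jk: "j \<in> {1..5::nat}" "k < n" "x = (j, k)" by auto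
      hence "winding_number h (a j * q ^ k) = 0" using wn2[of j k n] wh[of "a j * q ^ k"] by simp
      thus "((\<lambda>p. (winding_number g p - winding_number h p) * residue (\<lambda>u. G u / u) p) \<circ> (\<lambda>(j, k). a j * q ^ k)) x =
        (case x of (j, k) \<Rightarrow> \<kappa> j * bilateral_term a (- int k) (a j))"
        using jk(3) wn1[OF jk(1), of k] res[OF jk(1,2)] by simp
    qed
    finally show ?thesis by (simp add: sum.cartesian_product)
  qed
  \<comment> \<open>Pulled back to \<open>g\<close>, the integral over the scaled curve contains a
    fixed kernel and the term of index \<open>- n\<close>, which decays like
    \<open>norm q ^ n\<close> uniformly near the path.\<close>
  have lim0: "(\<lambda>n. contour_integral g (\<lambda>u. nr_kernel a u / u * bilateral_term a (- int n) u)) \<longlonglongrightarrow> 0"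
  proof -
    have "open (UNIV \<times> regular_set T :: (complex \<times> complex) set)"
      using open_regular_set[OF T] by (intro open_Times) auto
    then obtain d V where V: "d > 0" "open V" "path_image g \<subseteq> V" "compact (closure V)"
        "cball 0 d \<times> closure V \<subseteq> (UNIV \<times> regular_set T :: (complex \<times> complex) set)"
      using path_image_tube[of g "UNIV \<times> regular_set T" 0] g' valid_path_imp_path by blast
    have Vr: "closure V \<subseteq> regular_set T"
    proof
      fix x assume "x \<in> closure V"
      hence "(0, x) \<in> cball (0 :: complex) d \<times> closure V" using V(1) by simp
      thus "x \<in> regular_set T" using V(5) by blast
    qed
    have r0: "regular_set T \<subseteq> -{0}" by (auto simp: regular_set_def)
    have kh: "(\<lambda>u. nr_kernel a u / u) holomorphic_on regular_set T"
      unfolding nr_kernel_def using reg_theta a5 r0 by (intro holomorphic_intros) auto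
    have "compact ((\<lambda>u. nr_kernel a u / u) ` closure V)"
      using V(4) Vr by (intro compact_continuous_image holomorphic_on_imp_continuous_on holomorphic_on_subset[OF kh])
    then obtain B where B: "\<And>u. u \<in> closure V \<Longrightarrow> norm (nr_kernel a u / u) \<le> B" "B > 0"
      by (metis (mono_tags, lifting) bounded_pos compact_imp_bounded image_eqI)
    have "compact (closure V \<union> a ` {1..6})"
      by (rule compact_Un[OF V(4) finite_imp_compact]) simp
    moreover have "closure V \<union> a ` {1..6} \<subseteq> -{0}" using a r0 Vr by auto
    ultimately obtain r where r: "r > 0" "\<And>w. w \<in> closure V \<union> a ` {1..6} \<Longrightarrow> 1 / r \<le> norm w \<and> norm w \<le> r"
      using annulus_bounds by metis
    have bd: "norm (nr_kernel a u / u * bilateral_term a (- int n) u) \<le> B * (bilateral_bound r * norm q ^ n)"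
      if "u \<in> V" for u n
    proof -
      have uV: "u \<in> closure V" using that closure_subset by blast
      have "norm (bilateral_term a (- int n) u) \<le> bilateral_bound r * norm q ^ nat \<bar>- int n\<bar>"
        by (rule norm_bilateral_term_le) (use r uV pr in auto)
      thus ?thesis unfolding norm_mult using B uV by (intro mult_mono) auto
    qed
    have "(\<lambda>n. contour_integral g (\<lambda>u. nr_kernel a u / u * bilateral_term a (- int n) u)) \<longlonglongrightarrow> contour_integral g (\<lambda>u. 0)"
    proof (rule contour_integral_uniform_limit_holomorphic[OF V(2) g'(1) V(3)])
      show "\<forall>\<^sub>F n in sequentially. (\<lambda>u. nr_kernel a u / u * bilateral_term a (- int n) u) holomorphic_on V"
      proof (intro always_eventually allI holomorphic_on_mult)
        show "(\<lambda>u. nr_kernel a u / u) holomorphic_on V"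
          by (rule holomorphic_on_subset[OF kh]) (use Vr closure_subset in blast)
        show "bilateral_term a (- int n) holomorphic_on V" for n
          by (rule holomorphic_on_subset[OF bilateral_term_holomorphic]) (use a Vr r0 closure_subset in blast)+
      qed
      show "uniform_limit V (\<lambda>n u. nr_kernel a u / u * bilateral_term a (- int n) u) (\<lambda>u. 0) sequentially"
      proof (rule uniform_limitI)
        fix e :: real assume "e > 0"
        have "(\<lambda>n. B * (bilateral_bound r * norm q ^ n)) \<longlonglongrightarrow> 0"
          using q_lt by (intro tendsto_mult_right_zero LIMSEQ_power_zero) auto
        hence "\<forall>\<^sub>F n in sequentially. B * (bilateral_bound r * norm q ^ n) < e"
          using \<open>e > 0\<close> by (rule order_tendstoD)
        thus "\<forall>\<^sub>F n in sequentially. \<forall>u\<in>V. dist (nr_kernel a u / u * bilateral_term a (- int n) u) 0 < e"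
          by eventually_elim (use bd in \<open>auto intro: le_less_trans\<close>)
      qed
    qed auto
    thus ?thesis by simp
  qed
  have lim1: "(\<lambda>n. 2 * of_real pi * \<i> * (\<Sum>j=1..5. \<Sum>k<n. \<kappa> j * bilateral_term a (- int k) (a j))) \<longlonglongrightarrow>
     2 * of_real pi * \<i> * (\<Sum>j=1..5. \<kappa> j * bilateral_sum a (a j))"
    unfolding sum_distrib_left[symmetric]
    by (intro tendsto_intros bilateral_sum_sums[unfolded sums_def] a pr) auto
  have lim2: "(\<lambda>n. contour_integral g (\<lambda>u. G u / u) - contour_integral g (\<lambda>u. nr_kernel a u / u * bilateral_term a (- int n) u))
     \<longlonglongrightarrow> contour_integral g (\<lambda>u. G u / u) - 0"
    by (intro tendsto_intros lim0)
  have "contour_integral g (\<lambda>u. G u / u) = 2 * of_real pi * \<i> * (\<Sum>j=1..5. \<kappa> j * bilateral_sum a (a j))"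
    using LIMSEQ_unique[OF lim2[unfolded main] lim1] by simp
  thus ?thesis unfolding nr_integral_def G_def \<kappa>_def by simp
qed

text \<open>The point \<open>t\<close> is an inner point of its own sequence. If
  \<open>qp (t * t')\<close> vanished, it would also be an outer point for \<open>t'\<close>, and
  the winding number would have to be both 1 and 0.\<close>

lemma separates_qp_neq_0:
  assumes g: "separates T g" and t: "t \<in> T" "t' \<in> T" "t \<noteq> 0"
  shows "qp (t * t') \<noteq> 0"
proof
  assume "qp (t * t') = 0"
  hence "qp (t' * t) = 0" by (simp add: mult.commute)
  hence "winding_number g t = 0" using g t unfolding separates_def by blast
  moreover have "qp (t / t) = 0" using t by (simp add: qp_eq_0_iff exI[of _ 0])
  hence "winding_number g t = 1" using g t unfolding separates_def by blast
  ultimately show False by simp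
qed

text \<open>With a sixth parameter \<open>b\<close> that completes the product to \<open>q\<close>,
  the product of all \<open>t\<close>s except \<open>t1\<close> is \<open>q / (t1*b)\<close>, and so
  on. This brings the closed form into the shape of the final answer.\<close>

lemma nr_value:
  assumes g: "separates {t1, t2, t3, t4, t5} g"
    and nz: "t1 \<noteq> 0" "t2 \<noteq> 0" "t3 \<noteq> 0" "t4 \<noteq> 0" "t5 \<noteq> 0" "b \<noteq> 0"
    and pr: "t1 * t2 * t3 * t4 * t5 * b = q"
  shows "nr_integral g t1 t2 t3 t4 t5 = 4 * of_real pi * \<i> / qp q *
    (qp (q / (t1*b)) * qp (q / (t2*b)) * qp (q / (t3*b)) * qp (q / (t4*b)) * qp (q / (t5*b))) /
    (qp (t1*t2) * qp (t1*t3) * qp (t1*t4) * qp (t1*t5) * qp (t2*t3) * qp (t2*t4) * qp (t2*t5) *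
       qp (t3*t4) * qp (t3*t5) * qp (t4*t5))"
proof -
  have c: "t2*t3*t4*t5 = q / (t1*b)" "t1*t3*t4*t5 = q / (t2*b)" "t1*t2*t4*t5 = q / (t3*b)"
    "t1*t2*t3*t5 = q / (t4*b)" "t1*t2*t3*t4 = q / (t5*b)"
    unfolding pr[symmetric] using nz by simp_all
  have 0: "qp (t1*t2) \<noteq> 0" "qp (t1*t3) \<noteq> 0" "qp (t1*t4) \<noteq> 0" "qp (t1*t5) \<noteq> 0" "qp (t2*t3) \<noteq> 0"
    "qp (t2*t4) \<noteq> 0" "qp (t2*t5) \<noteq> 0" "qp (t3*t4) \<noteq> 0" "qp (t3*t5) \<noteq> 0" "qp (t4*t5) \<noteq> 0"
    by (rule separates_qp_neq_0[OF g]; use nz in simp)+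
  have i: "nr_integral g 0 0 0 0 0 = 4 * of_real pi * \<i> / qp q"
    using nr_constant[of g] separates_subset[OF g, of "{0}"] by (simp add: field_simps)
  show ?thesis
    using nr_product[OF g] 0 unfolding c i by (simp add: field_simps)
qed

text \<open>One Nassrallah-Rahman integral, with parameters \<open>a 1\<close> to
  \<open>a 5\<close>, is evaluated twice: in closed form, and by residues in terms of \<alpha> and
  \<beta>. In the \<alpha> part \<open>theta_pm (a 4)\<close> cancels and the index 4 drops out,
  which leaves a partial fraction sum over the indices 1, 2, 3, 5; the \<beta> part is the one over
  1, 2, 3, 4.\<close>

lemma bailey_sum:
  assumes gen: "generic_pairs a" and pr: "(\<Prod>j=1..6. a j) = q"
    and ex: "\<And>u. u \<noteq> 0 \<Longrightarrow>
      bilateral_sum a u = theta (u\<^sup>2) / u\<^sup>2 * (\<alpha> * theta_pm (a 4) u + \<beta> * theta_pm (a 5) u)"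
  shows "\<alpha> * (theta (a 1*a 4) * theta (a 2*a 4) * theta (a 3*a 4) * theta (a 5*a 4) * theta (a 6*a 4)) +
         \<beta> * (theta (a 1*a 5) * theta (a 2*a 5) * theta (a 3*a 5) * theta (a 4*a 5) * theta (a 6*a 5)) =
         - qp q * (\<Prod>j=1..6. \<Prod>k=j+1..6. qp (q / (a j * a k)))"
proof -
  define x1 x2 x3 x4 x5 x6 where x: "x1 = a 1" "x2 = a 2" "x3 = a 3" "x4 = a 4" "x5 = a 5" "x6 = a 6"
  have nz: "x1 \<noteq> 0" "x2 \<noteq> 0" "x3 \<noteq> 0" "x4 \<noteq> 0" "x5 \<noteq> 0" "x6 \<noteq> 0"
    using gen unfolding generic_pairs_def x by auto
  have sq: "theta (x1\<^sup>2) \<noteq> 0" "theta (x2\<^sup>2) \<noteq> 0" "theta (x3\<^sup>2) \<noteq> 0" "theta (x4\<^sup>2) \<noteq> 0" "theta (x5\<^sup>2) \<noteq> 0"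
    using gen unfolding generic_pairs_def x by auto
  have pm: "theta_pm (a i) (a j) \<noteq> 0" if "i \<in> {1..6}" "j \<in> {1..6}" "i \<noteq> j" for i j
    using gen that unfolding generic_pairs_def by blast
  have pmx: "theta_pm x1 x2 \<noteq> 0" "theta_pm x1 x3 \<noteq> 0" "theta_pm x1 x4 \<noteq> 0" "theta_pm x1 x5 \<noteq> 0"
    "theta_pm x2 x3 \<noteq> 0" "theta_pm x2 x4 \<noteq> 0" "theta_pm x2 x5 \<noteq> 0" "theta_pm x3 x4 \<noteq> 0" "theta_pm x3 x5 \<noteq> 0"
    "theta_pm x4 x5 \<noteq> 0" "theta_pm x5 x4 \<noteq> 0"
    unfolding x by (rule pm; simp)+
  have prx: "x1 * x2 * x3 * x4 * x5 * x6 = q" using pr unfolding prod_1_6 x .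
  define T where "T = a ` {1..5} \<union> (\<lambda>j. q / a j) ` {1..5}"
  have an: "a j \<noteq> 0" if "j \<in> {1..5}" for j using gen that unfolding generic_pairs_def by simp
  have pn: "t * t' * q ^ n \<noteq> 1" if "theta (t * t') \<noteq> 0" "t \<noteq> 0" "t' \<noteq> 0" for t t' n
  proof
    assume "t * t' * q ^ n = 1"
    hence "qp (t * t') = 0" unfolding qp_eq_0_iff by blast
    thus False using that by (simp add: theta_def)
  qed
  have qn: "q ^ Suc n \<noteq> 1" for n
  proof
    assume "q ^ Suc n = 1"
    hence "qp q = 0" unfolding qp_eq_0_iff by (intro exI[of _ n]) simp
    thus False by simp
  qed
  obtain g where g: "separates T g"
  proof (rule separates_exists)
    show "finite T" by (simp add: T_def)
    show "t \<noteq> 0" if "t \<in> T" for t using that an by (auto simp: T_def)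
    have th: "theta (a i * a j) \<noteq> 0" if "i \<in> {1..5}" "j \<in> {1..5}" for i j
    proof (cases "i = j")
      case True
      thus ?thesis using gen that unfolding generic_pairs_def by (auto simp: power2_eq_square)
    next
      case False
      thus ?thesis using pm[of i j] that by (auto simp: theta_pm_def)
    qed
    have th2: "a i * (q / a j) * q ^ n \<noteq> 1" if ij: "i \<in> {1..5}" "j \<in> {1..5}" for i j n
    proof (cases "i = j")
      case True
      thus ?thesis using qn[of n] an[OF ij(1)] by simp
    next
      case False
      hence "theta (a i / a j) \<noteq> 0" using pm[of i j] that by (auto simp: theta_pm_def)
      hence "qp (a i / a j) \<noteq> 0" by (simp add: theta_def)
      hence "a i / a j * q ^ Suc n \<noteq> 1" unfolding qp_eq_0_iff by blast
      thus ?thesis by (simp add: mult.assoc)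
    qed
    have th3: "q / a i * (q / a j) * q ^ n \<noteq> 1" if ij: "i \<in> {1..5}" "j \<in> {1..5}" for i j n
    proof -
      have "qp (q / (a i * a j)) \<noteq> 0" using th[OF ij] by (simp add: theta_def)
      hence "q / (a i * a j) * q ^ Suc n \<noteq> 1" unfolding qp_eq_0_iff by blast
      thus ?thesis by (simp add: mult.assoc)
    qed
    show "t * t' * q ^ n \<noteq> 1" if tt: "t \<in> T" "t' \<in> T" for t t' n
    proof -
      from tt consider i j where "i \<in> {1..5}" "j \<in> {1..5}" "t = a i" "t' = a j"
        | i j where "i \<in> {1..5}" "j \<in> {1..5}" "t = a i" "t' = q / a j"
        | i j where "i \<in> {1..5}" "j \<in> {1..5}" "t = q / a i" "t' = a j"
        | i j where "i \<in> {1..5}" "j \<in> {1..5}" "t = q / a i" "t' = q / a j"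
        unfolding T_def by blast
      thus ?thesis
      proof cases
        case 1 thus ?thesis using pn[OF th] an by simp
      next
        case 2 thus ?thesis using th2 by simp
      next
        case (3 i j) thus ?thesis using th2[of j i n] by (simp add: mult_ac)
      next
        case 4 thus ?thesis using th3 by simp
      qed
    qed
  qed
  have g5: "separates {x1, x2, x3, x4, x5} g"
    by (rule separates_subset[OF g]) (auto simp: x T_def)
  define Q where "Q = qp (x1*x2) * qp (x1*x3) * qp (x1*x4) * qp (x1*x5) * qp (x2*x3) * qp (x2*x4) * qp (x2*x5) *
       qp (x3*x4) * qp (x3*x5) * qp (x4*x5)"
  define R where "R = qp (q/(x1*x2)) * qp (q/(x1*x3)) * qp (q/(x1*x4)) * qp (q/(x1*x5)) * qp (q/(x2*x3)) *
       qp (q/(x2*x4)) * qp (q/(x2*x5)) * qp (q/(x3*x4)) * qp (q/(x3*x5)) * qp (q/(x4*x5))"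
  define C where "C = qp (q / (x1*x6)) * qp (q / (x2*x6)) * qp (q / (x3*x6)) * qp (q / (x4*x6)) * qp (q / (x5*x6))"
  have Q: "Q \<noteq> 0"
  proof -
    have "qp (x1*x2) \<noteq> 0" "qp (x1*x3) \<noteq> 0" "qp (x1*x4) \<noteq> 0" "qp (x1*x5) \<noteq> 0" "qp (x2*x3) \<noteq> 0"
      "qp (x2*x4) \<noteq> 0" "qp (x2*x5) \<noteq> 0" "qp (x3*x4) \<noteq> 0" "qp (x3*x5) \<noteq> 0" "qp (x4*x5) \<noteq> 0"
      by (rule separates_qp_neq_0[OF g5]; use nz in simp)+
    thus ?thesis by (simp add: Q_def)
  qed
  define Z1 where "Z1 = - 2 * theta (x1 * x2 * x3 * x5) /
      (theta (x1*x2) * theta (x1*x3) * theta (x1*x5) * theta (x2*x3) * theta (x2*x5) * theta (x3*x5))"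
  define Z2 where "Z2 = - 2 * theta (x1 * x2 * x3 * x4) /
      (theta (x1*x2) * theta (x1*x3) * theta (x1*x4) * theta (x2*x3) * theta (x2*x4) * theta (x3*x4))"
  have sets: "{1..5} - {1} = {2,3,4,5::nat}" "{1..5} - {2} = {1,3,4,5::nat}" "{1..5} - {3} = {1,2,4,5::nat}"
    "{1..5} - {4} = {1,2,3,5::nat}" "{1..5} - {5} = {1,2,3,4::nat}" by auto
  have sum5: "(\<Sum>j=1..5. f j) = f 1 + f 2 + f 3 + f 4 + (f 5 :: complex)" for f :: "nat \<Rightarrow> complex"
    by (simp add: eval_nat_numeral sum.nat_ivl_Suc' add_ac)
  define S where "S = (\<lambda>u. theta (u\<^sup>2) / u\<^sup>2 * (\<alpha> * theta_pm x4 u + \<beta> * theta_pm x5 u))"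
  have "nr_integral g x1 x2 x3 x4 x5 = 2 * of_real pi * \<i> / (qp q)\<^sup>2 *
     (S x1 / (theta_pm x2 x1 * theta_pm x3 x1 * theta_pm x4 x1 * theta_pm x5 x1) +
      S x2 / (theta_pm x1 x2 * theta_pm x3 x2 * theta_pm x4 x2 * theta_pm x5 x2) +
      S x3 / (theta_pm x1 x3 * theta_pm x2 x3 * theta_pm x4 x3 * theta_pm x5 x3) +
      S x4 / (theta_pm x1 x4 * theta_pm x2 x4 * theta_pm x3 x4 * theta_pm x5 x4) +
      S x5 / (theta_pm x1 x5 * theta_pm x2 x5 * theta_pm x3 x5 * theta_pm x4 x5))"
  proof -
    have Sx: "bilateral_sum a x1 = S x1" "bilateral_sum a x2 = S x2" "bilateral_sum a x3 = S x3"
      "bilateral_sum a x4 = S x4" "bilateral_sum a x5 = S x5"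
      using nz ex[folded x] by (simp_all add: S_def)
    have ps: "(\<Prod>i\<in>{2,3,4,5}. theta_pm (a i) w) = theta_pm x2 w * theta_pm x3 w * theta_pm x4 w * theta_pm x5 w"
      "(\<Prod>i\<in>{1,3,4,5}. theta_pm (a i) w) = theta_pm x1 w * theta_pm x3 w * theta_pm x4 w * theta_pm x5 w"
      "(\<Prod>i\<in>{1,2,4,5}. theta_pm (a i) w) = theta_pm x1 w * theta_pm x2 w * theta_pm x4 w * theta_pm x5 w"
      "(\<Prod>i\<in>{1,2,3,5}. theta_pm (a i) w) = theta_pm x1 w * theta_pm x2 w * theta_pm x3 w * theta_pm x5 w"
      "(\<Prod>i\<in>{1,2,3,4}. theta_pm (a i) w) = theta_pm x1 w * theta_pm x2 w * theta_pm x3 w * theta_pm x4 w" for w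
      by (simp_all add: x mult_ac)
    have fac: "K * (s1/(D*p1) + s2/(D*p2) + s3/(D*p3) + s4/(D*p4) + s5/(D*p5)) =
        K / D * (s1/p1 + s2/p2 + s3/p3 + s4/p4 + s5/p5)" for K D s1 s2 s3 s4 s5 p1 p2 p3 p4 p5 :: complex
      by (simp add: distrib_left)
    show ?thesis
      using nr_integral_eq_bilateral_sums[OF gen pr g[unfolded T_def], folded x]
      unfolding sum5 sets ps x[symmetric] Sx fac .
  qed
  also have "S x1 / (theta_pm x2 x1 * theta_pm x3 x1 * theta_pm x4 x1 * theta_pm x5 x1) +
      S x2 / (theta_pm x1 x2 * theta_pm x3 x2 * theta_pm x4 x2 * theta_pm x5 x2) +
      S x3 / (theta_pm x1 x3 * theta_pm x2 x3 * theta_pm x4 x3 * theta_pm x5 x3) +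
      S x4 / (theta_pm x1 x4 * theta_pm x2 x4 * theta_pm x3 x4 * theta_pm x5 x4) +
      S x5 / (theta_pm x1 x5 * theta_pm x2 x5 * theta_pm x3 x5 * theta_pm x4 x5) = \<alpha> * Z1 + \<beta> * Z2"
  proof -
    have 4: "theta_pm x4 x1 \<noteq> 0" "theta_pm x4 x2 \<noteq> 0" "theta_pm x4 x3 \<noteq> 0"
      "theta_pm x5 x1 \<noteq> 0" "theta_pm x5 x2 \<noteq> 0" "theta_pm x5 x3 \<noteq> 0"
      unfolding x by (rule pm; simp)+
    have s: "S u / (p * theta_pm x4 u * theta_pm x5 u) =
       \<alpha> * (theta (u\<^sup>2) / (u\<^sup>2 * (p * theta_pm x5 u))) + \<beta> * (theta (u\<^sup>2) / (u\<^sup>2 * (p * theta_pm x4 u)))"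
      if "theta_pm x4 u \<noteq> 0" "theta_pm x5 u \<noteq> 0" for u p
    proof -
      have "S u / (p * theta_pm x4 u * theta_pm x5 u) =
        theta (u\<^sup>2) / (u\<^sup>2 * p) * ((\<alpha> * theta_pm x4 u + \<beta> * theta_pm x5 u) / (theta_pm x4 u * theta_pm x5 u))"
        by (simp add: S_def)
      also have "(\<alpha> * theta_pm x4 u + \<beta> * theta_pm x5 u) / (theta_pm x4 u * theta_pm x5 u) =
        \<alpha> / theta_pm x5 u + \<beta> / theta_pm x4 u"
        using that by (simp add: add_divide_distrib)
      finally show ?thesis by (simp add: distrib_left add_divide_distrib mult_ac)
    qed
    have s4: "S x4 / (p * theta_pm x5 x4) = \<beta> * (theta (x4\<^sup>2) / (x4\<^sup>2 * p))" for p
      using nz pmx by (simp add: S_def)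
    have s5: "S x5 / (p * theta_pm x4 x5) = \<alpha> * (theta (x5\<^sup>2) / (x5\<^sup>2 * p))" for p
      using nz pmx by (simp add: S_def)
    have z1: "theta (x1\<^sup>2) / (x1\<^sup>2 * (theta_pm x2 x1 * theta_pm x3 x1 * theta_pm x5 x1)) +
         theta (x2\<^sup>2) / (x2\<^sup>2 * (theta_pm x1 x2 * theta_pm x3 x2 * theta_pm x5 x2)) +
         theta (x3\<^sup>2) / (x3\<^sup>2 * (theta_pm x1 x3 * theta_pm x2 x3 * theta_pm x5 x3)) +
         theta (x5\<^sup>2) / (x5\<^sup>2 * (theta_pm x1 x5 * theta_pm x2 x5 * theta_pm x3 x5)) = Z1"
      unfolding Z1_def by (rule theta_partial_fractions) (use nz sq pmx in auto)
    have z2: "theta (x1\<^sup>2) / (x1\<^sup>2 * (theta_pm x2 x1 * theta_pm x3 x1 * theta_pm x4 x1)) +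
         theta (x2\<^sup>2) / (x2\<^sup>2 * (theta_pm x1 x2 * theta_pm x3 x2 * theta_pm x4 x2)) +
         theta (x3\<^sup>2) / (x3\<^sup>2 * (theta_pm x1 x3 * theta_pm x2 x3 * theta_pm x4 x3)) +
         theta (x4\<^sup>2) / (x4\<^sup>2 * (theta_pm x1 x4 * theta_pm x2 x4 * theta_pm x3 x4)) = Z2"
      unfolding Z2_def by (rule theta_partial_fractions) (use nz sq pmx in auto)
    show ?thesis
      unfolding s[OF 4(1,4)] s[OF 4(2,5)] s[OF 4(3,6)] s4 s5 z1[symmetric] z2[symmetric]
      by (simp only: distrib_left add_ac)
  qed
  finally have N1: "nr_integral g x1 x2 x3 x4 x5 = 2 * of_real pi * \<i> / (qp q)\<^sup>2 * (\<alpha> * Z1 + \<beta> * Z2)" .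
  have N2: "nr_integral g x1 x2 x3 x4 x5 = 4 * of_real pi * \<i> / qp q * C / Q"
    unfolding C_def Q_def by (rule nr_value[OF g5 nz prx])
  have "\<alpha> * Z1 + \<beta> * Z2 = 2 * qp q * C / Q"
  proof -
    have "2 * of_real pi * \<i> / (qp q)\<^sup>2 * (\<alpha> * Z1 + \<beta> * Z2) = 2 * of_real pi * \<i> / (qp q)\<^sup>2 * (2 * qp q * C / Q)"
      unfolding N1[symmetric] N2 by (simp add: power2_eq_square)
    thus ?thesis by (subst (asm) mult_left_cancel) auto
  qed
  define \<Theta> where "\<Theta> = theta (x1*x2) * theta (x1*x3) * theta (x1*x4) * theta (x1*x5) * theta (x2*x3) * theta (x2*x4) *
       theta (x2*x5) * theta (x3*x4) * theta (x3*x5) * theta (x4*x5)"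
  have \<Theta>: "\<Theta> = Q * R" unfolding \<Theta>_def Q_def R_def theta_def by (simp only: mult_ac)
  have thn: "theta (x1*x2) \<noteq> 0" "theta (x1*x3) \<noteq> 0" "theta (x1*x4) \<noteq> 0" "theta (x1*x5) \<noteq> 0" "theta (x2*x3) \<noteq> 0"
    "theta (x2*x4) \<noteq> 0" "theta (x2*x5) \<noteq> 0" "theta (x3*x4) \<noteq> 0" "theta (x3*x5) \<noteq> 0" "theta (x4*x5) \<noteq> 0"
    using pmx by (auto simp: theta_pm_def)
  \<comment> \<open>Since six parameters multiply to \<open>q\<close>, a theta function of four of
    them equals that of the other two. In this way \<open>x6\<close> enters, and the products for
    \<alpha> and \<beta> become complete.\<close>
  have "x1*x2*x3*x5 = q / (x6*x4)" "x1*x2*x3*x4 = q / (x6*x5)"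
    unfolding prx[symmetric] using nz by simp_all
  hence t: "theta (x1*x2*x3*x5) = theta (x6*x4)" "theta (x1*x2*x3*x4) = theta (x6*x5)"
    using nz by (simp_all add: theta_q_div)
  have zt: "Z1 * \<Theta> = - 2 * (theta (x1*x4) * theta (x2*x4) * theta (x3*x4) * theta (x5*x4) * theta (x6*x4))"
    "Z2 * \<Theta> = - 2 * (theta (x1*x5) * theta (x2*x5) * theta (x3*x5) * theta (x4*x5) * theta (x6*x5))"
    unfolding Z1_def Z2_def \<Theta>_def t using thn by (simp_all add: mult_ac)
  have "(\<alpha> * Z1 + \<beta> * Z2) * \<Theta> = 2 * qp q * C * R"
    unfolding \<open>\<alpha> * Z1 + \<beta> * Z2 = _\<close> \<Theta> using Q by simp
  hence "\<alpha> * (Z1 * \<Theta>) + \<beta> * (Z2 * \<Theta>) = 2 * qp q * C * R" by (simp add: algebra_simps)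
  hence "- 2 * (\<alpha> * (theta (x1*x4) * theta (x2*x4) * theta (x3*x4) * theta (x5*x4) * theta (x6*x4)) +
         \<beta> * (theta (x1*x5) * theta (x2*x5) * theta (x3*x5) * theta (x4*x5) * theta (x6*x5))) = - 2 * (- qp q * (C * R))"
    unfolding zt by (simp add: algebra_simps)
  hence "\<alpha> * (theta (x1*x4) * theta (x2*x4) * theta (x3*x4) * theta (x5*x4) * theta (x6*x4)) +
         \<beta> * (theta (x1*x5) * theta (x2*x5) * theta (x3*x5) * theta (x4*x5) * theta (x6*x5)) = - qp q * (C * R)"
    by (subst (asm) mult_left_cancel) auto
  moreover have "C * R = (\<Prod>j=1..6. \<Prod>k=j+1..6. qp (q / (a j * a k)))"
    unfolding C_def R_def x by (simp add: eval_nat_numeral prod.nat_ivl_Suc' mult_ac)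
  ultimately show ?thesis unfolding x by simp
qed

text \<open>Each theta function sheds a monomial by \<open>theta_powi\<close>. The mixed exponents
  combine because the sum of the \<open>n\<close>s is \<open>- m\<close>, and the
  \<open>x powi m\<close> multiply to \<open>(q / y) powi m\<close>. The last bracket on the left is
  symmetric in all six parameters, while the prefactor involves \<open>y\<close> and
  \<open>m\<close> only; hence the same bracket arises with \<open>a 4\<close> or \<open>a 5\<close>
  in the role of \<open>y\<close>.\<close>

lemma theta_powi_product:
  fixes n1 n2 n3 n4 n5 m :: int
  defines "\<tau> \<equiv> \<lambda>n::int. n * (n - 1) div 2"
  assumes nz: "x1 \<noteq> 0" "x2 \<noteq> 0" "x3 \<noteq> 0" "x4 \<noteq> 0" "x5 \<noteq> 0" "y \<noteq> 0"
    and pr: "x1 * x2 * x3 * x4 * x5 * y = q" and sm: "n1 + n2 + n3 + n4 + n5 + m = 0"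
  shows "q powi (m * (m - 1)) * y powi (2 * m) *
    (theta (q powi n1 * x1 * (q powi m * y)) * theta (q powi n2 * x2 * (q powi m * y)) *
     theta (q powi n3 * x3 * (q powi m * y)) * theta (q powi n4 * x4 * (q powi m * y)) *
     theta (q powi n5 * x5 * (q powi m * y))) *
    (q powi \<tau> n1 * x1 powi n1 * (q powi \<tau> n2 * x2 powi n2) * (q powi \<tau> n3 * x3 powi n3) *
     (q powi \<tau> n4 * x4 powi n4) * (q powi \<tau> n5 * x5 powi n5) * (q powi \<tau> m * y powi m)) =
    theta (x1 * y) * theta (x2 * y) * theta (x3 * y) * theta (x4 * y) * theta (x5 * y)"
proof -
  \<comment> \<open>For one theta function with exponent \<open>n\<close>, the base of the
    \<open>n\<close>-th power is \<open>w\<close>, and \<open>c\<close> is what depends neither on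
    \<open>n\<close> nor on \<open>x\<close>.\<close>
  define w where "w = - 1 / (q powi m * y)"
  define c where "c = (-1) powi m / (q powi \<tau> m * y powi m)"
  have w: "w \<noteq> 0" using nz by (simp add: w_def)
  have wn: "w powi n = (-1) powi n / ((q powi m) powi n * y powi n)" for n
    by (simp only: w_def power_int_divide_distrib power_int_mult_distrib)
  have tau: "n * (n - 1) = 2 * \<tau> n" for n
    unfolding \<tau>_def by (cases "even n") auto
  have fac: "theta (q powi n * x * (q powi m * y)) * (q powi \<tau> n * x powi n) =
      c * w powi n * (1 / x powi m) * theta (x * y)" if "x \<noteq> 0" for n x
  proof -
    have "2 * \<tau> (n + m) = 2 * (\<tau> n + (\<tau> m + n * m))"
      unfolding distrib_left[of 2] tau[symmetric] by (simp add: algebra_simps)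
    hence t: "\<tau> (n + m) = \<tau> n + (\<tau> m + n * m)" by simp
    have eq: "q powi n * x * (q powi m * y) = q powi (n + m) * (x * y)"
      by (simp add: power_int_add mult_ac)
    have "theta (q powi n * x * (q powi m * y)) =
        (-1) powi (n + m) * q powi (- \<tau> (n + m)) * (x * y) powi (- (n + m)) * theta (x * y)"
      unfolding \<tau>_def eq by (rule theta_powi) (use that nz in simp)
    also have "q powi (- \<tau> (n + m)) = 1 / (q powi \<tau> n * (q powi \<tau> m * (q powi m) powi n))"
    proof -
      have "(q powi m) powi n = q powi (n * m)" by (simp add: power_int_mult mult.commute)
      thus ?thesis unfolding t power_int_minus by (simp add: power_int_add divide_inverse)
    qed
    also have "(x * y) powi (- (n + m)) = 1 / (x powi n * x powi m * (y powi n * y powi m))"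
      unfolding power_int_minus power_int_mult_distrib using that nz
      by (simp add: power_int_add divide_inverse)
    also have "(-1 :: complex) powi (n + m) = (-1) powi n * (-1) powi m"
      by (rule power_int_add) simp
    finally have e: "theta (q powi n * x * (q powi m * y)) =
      (-1) powi n * (-1) powi m * (1 / (q powi \<tau> n * (q powi \<tau> m * (q powi m) powi n))) *
      (1 / (x powi n * x powi m * (y powi n * y powi m))) * theta (x * y)" .
    show ?thesis unfolding e wn c_def using that nz by (simp add: field_simps)
  qed
  have "w powi n1 * w powi n2 * w powi n3 * w powi n4 * w powi n5 = w powi (n1 + n2 + n3 + n4 + n5)"
    using w by (simp add: power_int_add)
  also have "n1 + n2 + n3 + n4 + n5 = - m" using sm by simp
  also have "w powi (- m) = (-1) powi m * q powi (m * m) * y powi m"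
  proof -
    have "(q powi m) powi m = q powi (m * m)" by (simp add: power_int_mult)
    moreover have "((-1::complex) powi m) * (-1) powi m = 1"
      by (metis power_int_minus_one_mult_self)
    hence "inverse ((-1::complex) powi m) = (-1) powi m" by (rule inverse_unique)
    ultimately show ?thesis
      unfolding power_int_minus wn by (simp add: divide_inverse)
  qed
  finally have W: "w powi n1 * w powi n2 * w powi n3 * w powi n4 * w powi n5 = (-1) powi m * q powi (m * m) * y powi m" .
  have "x1 powi m * x2 powi m * x3 powi m * x4 powi m * x5 powi m = (x1 * x2 * x3 * x4 * x5) powi m"
    by (simp add: power_int_mult_distrib)
  also have "x1 * x2 * x3 * x4 * x5 = q / y" using pr nz by (simp add: field_simps)
  finally have X: "x1 powi m * x2 powi m * x3 powi m * x4 powi m * x5 powi m = q powi m / y powi m"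
    by (simp add: power_int_divide_distrib)
  let ?th = "theta (x1 * y) * theta (x2 * y) * theta (x3 * y) * theta (x4 * y) * theta (x5 * y)"
  have "q powi (m * (m - 1)) * y powi (2 * m) *
    (theta (q powi n1 * x1 * (q powi m * y)) * theta (q powi n2 * x2 * (q powi m * y)) *
     theta (q powi n3 * x3 * (q powi m * y)) * theta (q powi n4 * x4 * (q powi m * y)) *
     theta (q powi n5 * x5 * (q powi m * y))) *
    (q powi \<tau> n1 * x1 powi n1 * (q powi \<tau> n2 * x2 powi n2) * (q powi \<tau> n3 * x3 powi n3) *
     (q powi \<tau> n4 * x4 powi n4) * (q powi \<tau> n5 * x5 powi n5) * (q powi \<tau> m * y powi m)) =
    q powi (m * (m - 1)) * y powi (2 * m) * (q powi \<tau> m * y powi m) *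
    ((theta (q powi n1 * x1 * (q powi m * y)) * (q powi \<tau> n1 * x1 powi n1)) *
     (theta (q powi n2 * x2 * (q powi m * y)) * (q powi \<tau> n2 * x2 powi n2)) *
     (theta (q powi n3 * x3 * (q powi m * y)) * (q powi \<tau> n3 * x3 powi n3)) *
     (theta (q powi n4 * x4 * (q powi m * y)) * (q powi \<tau> n4 * x4 powi n4)) *
     (theta (q powi n5 * x5 * (q powi m * y)) * (q powi \<tau> n5 * x5 powi n5)))"
    by (simp only: mult_ac)
  also have "\<dots> = q powi (m * (m - 1)) * y powi (2 * m) * (q powi \<tau> m * y powi m) * (c ^ 5 *
      (w powi n1 * w powi n2 * w powi n3 * w powi n4 * w powi n5) /
      (x1 powi m * x2 powi m * x3 powi m * x4 powi m * x5 powi m) * ?th)"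
    unfolding fac[OF nz(1)] fac[OF nz(2)] fac[OF nz(3)] fac[OF nz(4)] fac[OF nz(5)]
    by (simp add: eval_nat_numeral mult_ac)
  also have "\<dots> = ?th"
  proof -
    define e where "e = (-1 :: complex) powi m"
    define K where "K = q powi \<tau> m"
    define Y where "Y = y powi m"
    have e: "e * e = 1" unfolding e_def by (metis power_int_minus_one_mult_self)
    have K: "K \<noteq> 0" and Y: "Y \<noteq> 0" using nz by (auto simp: K_def Y_def)
    have KK: "q powi (m * (m - 1)) = K * K"
      unfolding tau K_def mult_2 by (rule power_int_add) simp
    have "m * m = m * (m - 1) + m" by (simp add: algebra_simps)
    hence KM: "q powi (m * m) = K * K * q powi m"
      unfolding KK[symmetric] by (simp only: power_int_add q_nz simp_thms)
    have YY: "y powi (2 * m) = Y * Y"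
      unfolding Y_def mult_2 by (rule power_int_add) (use nz in simp)
    have "e ^ 5 * e = 1" using e by (simp add: eval_nat_numeral mult.assoc)
    hence ee: "e ^ 5 * (e * z) = z" for z by (simp add: mult.assoc[symmetric])
    have k5: "K ^ 5 = K * K * K * K * K" "Y ^ 5 = Y * Y * Y * Y * Y" by (simp_all add: eval_nat_numeral)
    show ?thesis
      unfolding W X c_def KK KM YY e_def[symmetric] K_def[symmetric] Y_def[symmetric]
      using K Y by (simp add: power_divide power_mult_distrib ee k5)
  qed
  finally show ?thesis .
qed

subsection \<open>The weighted integral of the bilateral sum\<close>

text \<open>What all the integrands share after the substitution \<open>u = s powi m * z\<close>;
  the division by \<open>u\<close> is the one in \<open>dz / z\<close>.\<close>

definition weight :: "(nat \<Rightarrow> complex) \<Rightarrow> complex \<Rightarrow> complex" where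
  "weight b u = (1 - u\<^sup>2) / (\<Prod>j=1..6. qp (b j * u) * qp (b j / u)) / u"

definition rhs_value :: "(nat \<Rightarrow> complex) \<Rightarrow> (nat \<Rightarrow> int) \<Rightarrow> complex" where
  "rhs_value a N = 2 / (\<Prod>j=1..6. q powi (N j * (N j - 1) div 2) * a j powi N j)
           * (\<Prod>j=1..6. \<Prod>k=j+1..6. qp (q / (a j * a k)) / qp (a j * a k * q powi (N j + N k)))"

lemma theta_pm_powi:
  assumes "x \<noteq> 0" "u \<noteq> 0"
  shows "theta_pm x u = q powi (n * (n - 1)) * x powi (2 * n) * theta_pm (q powi n * x) u"
proof -
  define t where "t = n * (n - 1) div 2"
  have t: "n * (n - 1) = t + t" unfolding t_def by (cases "even n") auto
  have "theta (q powi n * (x * u)) = (-1) powi n * q powi (- t) * (x * u) powi (- n) * theta (x * u)"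
    "theta (q powi n * (x / u)) = (-1) powi n * q powi (- t) * (x / u) powi (- n) * theta (x / u)"
    unfolding t_def using assms by (intro theta_powi; simp)+
  hence "theta_pm (q powi n * x) u = ((-1) powi n * (-1) powi n) * (q powi (- t) * q powi (- t)) *
      ((x * u) powi (- n) * (x / u) powi (- n)) * theta_pm x u"
    by (simp add: theta_pm_def mult_ac)
  also have "(-1 :: complex) powi n * (-1) powi n = 1" by (metis power_int_minus_one_mult_self)
  also have "(x * u) powi (- n) * (x / u) powi (- n) = 1 / x powi (2 * n)"
  proof -
    have "x powi (2 * n) = x powi n * x powi n"
      unfolding mult_2 by (rule power_int_add) (use assms in simp)
    thus ?thesis unfolding power_int_minus power_int_mult_distrib power_int_divide_distrib
      using assms by (simp add: field_simps)
  qed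
  also have "q powi (- t) * q powi (- t) = 1 / q powi (n * (n - 1))"
  proof -
    have "q powi (n * (n - 1)) = q powi t * q powi t"
      unfolding t by (rule power_int_add) simp
    thus ?thesis by (simp add: power_int_minus divide_inverse)
  qed
  finally show ?thesis using assms by simp
qed

text \<open>\<open>theta_pm b u\<close> cancels the two denominators with parameter \<open>b\<close>
  and leaves numerators with parameter \<open>q / b\<close>, the product of the other five: a
  Nassrallah-Rahman integrand. In its value the factors \<open>qp (q / (t1*b))\<close> and so on are
  completed to theta functions.\<close>

lemma weighted_theta_integral:
  assumes g: "separates {t1, t2, t3, t4, t5, b} g"
    and nz: "t1 \<noteq> 0" "t2 \<noteq> 0" "t3 \<noteq> 0" "t4 \<noteq> 0" "t5 \<noteq> 0" "b \<noteq> 0"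
    and pr: "t1 * t2 * t3 * t4 * t5 * b = q"
  shows "contour_integral g (\<lambda>u. qp (u\<^sup>2) * qp (1 / u\<^sup>2) * theta_pm b u /
      (qp (t1*u) * qp (t1/u) * qp (t2*u) * qp (t2/u) * qp (t3*u) * qp (t3/u) * qp (t4*u) * qp (t4/u) *
       qp (t5*u) * qp (t5/u) * qp (b*u) * qp (b/u)) / u) =
    4 * of_real pi * \<i> / qp q * (theta (t1*b) * theta (t2*b) * theta (t3*b) * theta (t4*b) * theta (t5*b)) /
    (qp (t1*t2) * qp (t1*t3) * qp (t1*t4) * qp (t1*t5) * qp (t2*t3) * qp (t2*t4) * qp (t2*t5) *
       qp (t3*t4) * qp (t3*t5) * qp (t4*t5) * qp (t1*b) * qp (t2*b) * qp (t3*b) * qp (t4*b) * qp (t5*b))"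
    (is "contour_integral g ?f = _")
proof -
  have A: "t1 * t2 * t3 * t4 * t5 = q / b" using pr nz by (simp add: field_simps)
  have g5: "separates {t1, t2, t3, t4, t5} g" by (rule separates_subset[OF g]) auto
  have "contour_integral g ?f = nr_integral g t1 t2 t3 t4 t5"
    unfolding nr_integral_def
  proof (rule contour_integral_cong[OF refl])
    fix u assume "u \<in> path_image g"
    hence "u \<noteq> 0" "qp (b * u) \<noteq> 0" "qp (b / u) \<noteq> 0"
      using g by (auto simp: separates_def regular_set_def)
    moreover have "theta_pm b u = qp (b * u) * qp (b / u) * (qp (q / b * u) * qp (q / b / u))"
      by (simp add: theta_pm_def theta_def mult_ac)
    ultimately show "?f u = nr_integrand t1 t2 t3 t4 t5 u / u"
      unfolding nr_integrand_def A by (simp add: mult_ac)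
  qed
  moreover have "qp (t1*b) \<noteq> 0" "qp (t2*b) \<noteq> 0" "qp (t3*b) \<noteq> 0" "qp (t4*b) \<noteq> 0" "qp (t5*b) \<noteq> 0"
    by (rule separates_qp_neq_0[OF g]; use nz in simp)+
  ultimately show ?thesis
    unfolding nr_value[OF g5 nz pr] by (simp add: theta_def mult_ac)
qed

lemma prod_pairs_1_6: "(\<Prod>j=1..6. \<Prod>k=j+1..6. f j k) =
    f 1 2 * f 1 3 * f 1 4 * f 1 5 * f 1 6 * f 2 3 * f 2 4 * f 2 5 * f 2 6 * f 3 4 * f 3 5 * f 3 6 *
    f 4 5 * f 4 6 * (f 5 6 :: complex)" for f :: "nat \<Rightarrow> nat \<Rightarrow> complex"
  by (simp add: eval_nat_numeral prod.nat_ivl_Suc' mult_ac)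

text \<open>The theta functions of the expansion belong to \<open>a 4\<close> and
  \<open>a 5\<close>, the denominators of the weight to \<open>b 4\<close> and \<open>b 5\<close>.
  The factors \<open>C 4\<close> and \<open>C 5\<close> pass from one to the other, after which each
  term is a case of \<open>weighted_theta_integral\<close>.\<close>

lemma weighted_bilateral_sum_integral_generic:
  assumes gen: "generic_pairs a" and pr: "(\<Prod>j=1..6. a j) = q" and N: "(\<Sum>j=1..6. N j) = 0"
    and g: "separates ((\<lambda>j. q powi N j * a j) ` {1..6}) g"
  shows "contour_integral g (\<lambda>u. weight (\<lambda>j. q powi N j * a j) u * bilateral_sum a u) =
    2 * of_real pi * \<i> * rhs_value a N"
proof -
  define b where "b = (\<lambda>j. q powi N j * a j)"
  have a: "a j \<noteq> 0" if "j \<in> {1..6}" for j using gen that unfolding generic_pairs_def by blast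
  have b0: "b j \<noteq> 0" if "j \<in> {1..6}" for j using a[OF that] by (simp add: b_def)
  have "theta ((a 5)\<^sup>2) \<noteq> 0" "theta_pm (a 4) (a 5) \<noteq> 0" using gen unfolding generic_pairs_def by auto
  then obtain \<alpha> \<beta> where ex: "\<And>u. u \<noteq> 0 \<Longrightarrow>
      bilateral_sum a u = theta (u\<^sup>2) / u\<^sup>2 * (\<alpha> * theta_pm (a 4) u + \<beta> * theta_pm (a 5) u)"
    using bilateral_sum_expansion[OF a pr, of "a 4" "a 5"] a[of 4] a[of 5] by auto
  have img: "(\<lambda>j. b j) ` {1..6} = {b 1, b 2, b 3, b 4, b 5, b 6}"
  proof -
    have "{1..6} = {1, 2, 3, 4, 5, 6 :: nat}" by auto
    thus ?thesis by simp
  qed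
  have g': "separates {b 1, b 2, b 3, b 4, b 5, b 6} g" using g[folded b_def] unfolding img .
  have prN: "(\<Prod>j=1..6. q powi N j) = 1"
  proof -
    have "N 1 + N 2 + N 3 + N 4 + N 5 + N 6 = 0"
      using N by (simp add: eval_nat_numeral sum.nat_ivl_Suc' add_ac)
    moreover have "(\<Prod>j=1..6. q powi N j) = q powi (N 1 + N 2 + N 3 + N 4 + N 5 + N 6)"
      unfolding prod_1_6 by (simp add: power_int_add)
    ultimately show ?thesis by simp
  qed
  have prb: "b 1 * b 2 * b 3 * b 4 * b 5 * b 6 = q"
  proof -
    have "(\<Prod>j=1..6. b j) = q" unfolding b_def prod.distrib prN pr by simp
    thus ?thesis unfolding prod_1_6 .
  qed
  define den where "den = (\<lambda>u. \<Prod>j=1..6. qp (b j * u) * qp (b j / u))"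
  define f where "f = (\<lambda>k u. qp (u\<^sup>2) * qp (1 / u\<^sup>2) * theta_pm (b k) u / den u / u)"
  define C where "C = (\<lambda>k. q powi (N k * (N k - 1)) * a k powi (2 * N k))"
  define \<Omega> where "\<Omega> = (\<Prod>j=1..6. \<Prod>k=j+1..6. qp (b j * b k))"
  define \<Delta> where "\<Delta> = (\<Prod>j=1..6. q powi (N j * (N j - 1) div 2) * a j powi N j)"
  have \<Delta>: "\<Delta> \<noteq> 0" unfolding \<Delta>_def using a by (simp add: prod_zero_iff)
  have bb: "b j * b k = a j * a k * q powi (N j + N k)" for j k
    by (simp add: b_def power_int_add)
  have f4: "contour_integral g (f 4) = 4 * of_real pi * \<i> / qp q *
     (theta (b 1*b 4) * theta (b 2*b 4) * theta (b 3*b 4) * theta (b 5*b 4) * theta (b 6*b 4)) / \<Omega>"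
  proof -
    have s: "separates {b 1, b 2, b 3, b 5, b 6, b 4} g"
      using g' by (rule separates_subset) auto
    have p: "b 1 * b 2 * b 3 * b 5 * b 6 * b 4 = q" using prb by (simp only: mult_ac)
    have d: "den u = qp (b 1*u) * qp (b 1/u) * qp (b 2*u) * qp (b 2/u) * qp (b 3*u) * qp (b 3/u) * qp (b 5*u) * qp (b 5/u) *
       qp (b 6*u) * qp (b 6/u) * qp (b 4*u) * qp (b 4/u)" for u
      unfolding den_def prod_1_6 by (simp only: mult_ac)
    show ?thesis
      unfolding f_def d \<Omega>_def prod_pairs_1_6
      by (subst weighted_theta_integral[OF s _ _ _ _ _ _ p]) (use b0 in \<open>simp_all add: mult_ac\<close>)
  qed
  have f5: "contour_integral g (f 5) = 4 * of_real pi * \<i> / qp q *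
     (theta (b 1*b 5) * theta (b 2*b 5) * theta (b 3*b 5) * theta (b 4*b 5) * theta (b 6*b 5)) / \<Omega>"
  proof -
    have s: "separates {b 1, b 2, b 3, b 4, b 6, b 5} g"
      using g' by (rule separates_subset) auto
    have p: "b 1 * b 2 * b 3 * b 4 * b 6 * b 5 = q" using prb by (simp only: mult_ac)
    have d: "den u = qp (b 1*u) * qp (b 1/u) * qp (b 2*u) * qp (b 2/u) * qp (b 3*u) * qp (b 3/u) * qp (b 4*u) * qp (b 4/u) *
       qp (b 6*u) * qp (b 6/u) * qp (b 5*u) * qp (b 5/u)" for u
      unfolding den_def prod_1_6 by (simp only: mult_ac)
    show ?thesis
      unfolding f_def d \<Omega>_def prod_pairs_1_6
      by (subst weighted_theta_integral[OF s _ _ _ _ _ _ p]) (use b0 in \<open>simp_all add: mult_ac\<close>)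
  qed
  have a': "a 1 \<noteq> 0" "a 2 \<noteq> 0" "a 3 \<noteq> 0" "a 4 \<noteq> 0" "a 5 \<noteq> 0" "a 6 \<noteq> 0" using a by auto
  have N': "N 1 + N 2 + N 3 + N 5 + N 6 + N 4 = 0" "N 1 + N 2 + N 3 + N 4 + N 6 + N 5 = 0"
    using N by (simp_all add: eval_nat_numeral sum.nat_ivl_Suc' add_ac)
  have pr': "a 1 * a 2 * a 3 * a 5 * a 6 * a 4 = q" "a 1 * a 2 * a 3 * a 4 * a 6 * a 5 = q"
    using pr unfolding prod_1_6 by (simp_all only: mult_ac)
  \<comment> \<open>Here and for index 5 the correction is the same \<open>\<Delta>\<close>.
    Therefore the two integrals enter in precisely the combination that \<open>bailey_sum\<close>
    evaluates.\<close>
  have C4: "C 4 * (theta (b 1*b 4) * theta (b 2*b 4) * theta (b 3*b 4) * theta (b 5*b 4) * theta (b 6*b 4)) * \<Delta> =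
      theta (a 1*a 4) * theta (a 2*a 4) * theta (a 3*a 4) * theta (a 5*a 4) * theta (a 6*a 4)"
    using theta_powi_product[OF a'(1-3) a'(5,6,4) pr'(1) N'(1)]
    unfolding C_def b_def \<Delta>_def prod_1_6 by (simp only: mult_ac)
  have C5: "C 5 * (theta (b 1*b 5) * theta (b 2*b 5) * theta (b 3*b 5) * theta (b 4*b 5) * theta (b 6*b 5)) * \<Delta> =
      theta (a 1*a 5) * theta (a 2*a 5) * theta (a 3*a 5) * theta (a 4*a 5) * theta (a 6*a 5)"
    using theta_powi_product[OF a'(1-4) a'(6,5) pr'(2) N'(2)]
    unfolding C_def b_def \<Delta>_def prod_1_6 by (simp only: mult_ac)
  have fi: "f k contour_integrable_on g" if "k \<in> {1..6}" for k
  proof (rule contour_integrable_holomorphic_simple)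
    show "f k holomorphic_on regular_set (b ` {1..6})"
      unfolding f_def den_def using b0[OF that]
      by (intro holomorphic_intros) (auto simp: regular_set_def)
  qed (use g in \<open>auto simp: separates_def open_regular_set b_def\<close>)
  have "contour_integral g (\<lambda>u. weight b u * bilateral_sum a u) =
    contour_integral g (\<lambda>u. - (\<alpha> * C 4) * f 4 u - (\<beta> * C 5) * f 5 u)"
  proof (rule contour_integral_cong[OF refl])
    fix u assume "u \<in> path_image g"
    hence u: "u \<noteq> 0" using g' separates_nonzero by blast
    have p: "theta_pm (a k) u = C k * theta_pm (b k) u" if "k \<in> {1..6}" for k
      unfolding C_def b_def using theta_pm_powi[OF a[OF that] u, of "N k"] by simp
    \<comment> \<open>The sign stems from \<open>(1 - u^2) / u^2 = - (1 - 1 / u^2)\<close> and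
      cancels the one in \<open>bailey_sum\<close>.\<close>
    have t: "(1 - u\<^sup>2) * (theta (u\<^sup>2) / u\<^sup>2) = - (qp (u\<^sup>2) * qp (1 / u\<^sup>2))"
      unfolding theta_def qp_rec[of "1 / u\<^sup>2"] using u by (simp add: field_simps)
    have "weight b u * bilateral_sum a u = ((1 - u\<^sup>2) * (theta (u\<^sup>2) / u\<^sup>2)) *
        (\<alpha> * (C 4 * theta_pm (b 4) u) + \<beta> * (C 5 * theta_pm (b 5) u)) / den u / u"
      unfolding weight_def den_def ex[OF u] using p by (simp add: mult_ac)
    also have "\<dots> = - (\<alpha> * C 4) * f 4 u - (\<beta> * C 5) * f 5 u"
      unfolding t f_def by (simp add: algebra_simps add_divide_distrib diff_divide_distrib)
    finally show "weight b u * bilateral_sum a u = - (\<alpha> * C 4) * f 4 u - (\<beta> * C 5) * f 5 u" .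
  qed
  also have "\<dots> = - (\<alpha> * C 4) * contour_integral g (f 4) - (\<beta> * C 5) * contour_integral g (f 5)"
    using fi by (intro contour_integral_lincomb) auto
  finally have tot: "contour_integral g (\<lambda>u. weight b u * bilateral_sum a u) =
    - (\<alpha> * C 4) * contour_integral g (f 4) - (\<beta> * C 5) * contour_integral g (f 5)" .
  have lin: "(- (\<alpha> * c4) * (k * p4 / w) - (\<beta> * c5) * (k * p5 / w)) * d =
      - (k / w) * (\<alpha> * (c4 * p4 * d) + \<beta> * (c5 * p5 * d))" for c4 c5 k p4 p5 w d
    by (simp add: diff_divide_distrib add_divide_distrib algebra_simps)
  have "contour_integral g (\<lambda>u. weight b u * bilateral_sum a u) * \<Delta> = - (4 * of_real pi * \<i> / qp q / \<Omega>) *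
      (\<alpha> * (theta (a 1*a 4) * theta (a 2*a 4) * theta (a 3*a 4) * theta (a 5*a 4) * theta (a 6*a 4)) +
       \<beta> * (theta (a 1*a 5) * theta (a 2*a 5) * theta (a 3*a 5) * theta (a 4*a 5) * theta (a 6*a 5)))"
    unfolding tot f4 f5 C4[symmetric] C5[symmetric] by (rule lin)
  also have "\<dots> = 4 * of_real pi * \<i> / \<Omega> * (\<Prod>j=1..6. \<Prod>k=j+1..6. qp (q / (a j * a k)))"
  proof -
    have "\<alpha> * (theta (a 1*a 4) * theta (a 2*a 4) * theta (a 3*a 4) * theta (a 5*a 4) * theta (a 6*a 4)) +
       \<beta> * (theta (a 1*a 5) * theta (a 2*a 5) * theta (a 3*a 5) * theta (a 4*a 5) * theta (a 6*a 5)) =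
       - qp q * (\<Prod>j=1..6. \<Prod>k=j+1..6. qp (q / (a j * a k)))"
      by (rule bailey_sum[OF gen pr]) (rule ex)
    thus ?thesis by (simp only:) simp
  qed
  finally have "contour_integral g (\<lambda>u. weight b u * bilateral_sum a u) =
      4 * of_real pi * \<i> / \<Omega> * (\<Prod>j=1..6. \<Prod>k=j+1..6. qp (q / (a j * a k))) / \<Delta>"
    using \<Delta> by (intro eq_divide_imp)
  also have "\<dots> = 2 * of_real pi * \<i> * rhs_value a N"
    unfolding rhs_value_def \<Omega>_def \<Delta>_def bb by (simp add: prod_dividef mult_ac)
  finally show ?thesis unfolding b_def .
qed

section \<open>Termwise integration of the bilateral series\<close>

lemma weight_holomorphic:
  "(\<And>j. j \<in> {1..6} \<Longrightarrow> b j \<in> T) \<Longrightarrow> weight b holomorphic_on regular_set T"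
  unfolding weight_def by (intro holomorphic_intros) (auto simp: regular_set_def)

text \<open>On a neighbourhood of the path with compact closure the weight is bounded and the terms
  have the majorant \<open>norm q ^ nat \<bar>m\<bar>\<close>. The convergence is uniform along
  finite index sets, as unconditional summation over the integers requires.\<close>

lemma weighted_terms_has_sum:
  assumes a: "\<And>j. j \<in> {1..6} \<Longrightarrow> a j \<noteq> 0" and pr: "(\<Prod>j=1..6. a j) = q"
    and g: "separates (b ` {1..6}) g"
  shows "((\<lambda>m. contour_integral g (\<lambda>u. weight b u * bilateral_term a m u)) has_sum
    contour_integral g (\<lambda>u. weight b u * bilateral_sum a u)) UNIV"
proof -
  define T where "T = b ` {1..6}"
  have g': "valid_path g" "path_image g \<subseteq> regular_set T" using g by (auto simp: separates_def T_def)
  have "open (UNIV \<times> regular_set T :: (complex \<times> complex) set)"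
    by (intro open_Times open_regular_set) (auto simp: T_def)
  then obtain d V where V: "d > 0" "open V" "path_image g \<subseteq> V" "compact (closure V)"
      "cball 0 d \<times> closure V \<subseteq> (UNIV \<times> regular_set T :: (complex \<times> complex) set)"
    using path_image_tube[of g "UNIV \<times> regular_set T" 0] g' valid_path_imp_path by blast
  have Vr: "closure V \<subseteq> regular_set T"
  proof
    fix x assume "x \<in> closure V"
    hence "(0, x) \<in> cball (0 :: complex) d \<times> closure V" using V(1) by simp
    thus "x \<in> regular_set T" using V(5) by blast
  qed
  have r0: "regular_set T \<subseteq> -{0}" by (auto simp: regular_set_def)
  have wh: "weight b holomorphic_on regular_set T" by (rule weight_holomorphic) (auto simp: T_def)
  have "compact (weight b ` closure V)"
    using V(4) Vr by (intro compact_continuous_image holomorphic_on_imp_continuous_on holomorphic_on_subset[OF wh])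
  then obtain B where B: "\<And>u. u \<in> closure V \<Longrightarrow> norm (weight b u) \<le> B" "B > 0"
    by (metis (mono_tags, lifting) bounded_pos compact_imp_bounded image_eqI)
  have "compact (closure V \<union> a ` {1..6})"
    by (rule compact_Un[OF V(4) finite_imp_compact]) simp
  moreover have "closure V \<union> a ` {1..6} \<subseteq> -{0}" using a r0 Vr by auto
  ultimately obtain r where r: "r > 0" "\<And>w. w \<in> closure V \<union> a ` {1..6} \<Longrightarrow> 1 / r \<le> norm w \<and> norm w \<le> r"
    using annulus_bounds by metis
  have bd: "norm (weight b u * bilateral_term a m u) \<le> (B * bilateral_bound r) * norm q ^ nat \<bar>m\<bar>"
    if "u \<in> V" for u m
  proof -
    have uV: "u \<in> closure V" using that closure_subset by blast
    have "norm (bilateral_term a m u) \<le> bilateral_bound r * norm q ^ nat \<bar>m\<bar>"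
      by (rule norm_bilateral_term_le) (use r uV pr in auto)
    thus ?thesis unfolding norm_mult mult.assoc using B uV by (intro mult_mono) auto
  qed
  have ul: "uniform_limit V (\<lambda>X u. \<Sum>m\<in>X. weight b u * bilateral_term a m u)
      (\<lambda>u. \<Sum>\<^sub>\<infinity>m. weight b u * bilateral_term a m u) (finite_subsets_at_top UNIV)"
    by (rule Weierstrass_m_test_general[OF bd summable_on_int_geometric]) (use q_lt in auto)
  have hV: "f holomorphic_on V" if "f holomorphic_on regular_set T" for f :: "complex \<Rightarrow> complex"
    using that by (rule holomorphic_on_subset) (use Vr closure_subset in blast)
  have ht: "(\<lambda>u. weight b u * bilateral_term a m u) holomorphic_on V" for m
    by (intro hV holomorphic_on_mult wh holomorphic_on_subset[OF bilateral_term_holomorphic[of a]] a r0)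
  have "((\<lambda>X. contour_integral g (\<lambda>u. \<Sum>m\<in>X. weight b u * bilateral_term a m u)) \<longlongrightarrow>
      contour_integral g (\<lambda>u. weight b u * bilateral_sum a u)) (finite_subsets_at_top UNIV)"
  proof (rule contour_integral_uniform_limit_holomorphic[OF V(2) g'(1) V(3)])
    show "\<forall>\<^sub>F X in finite_subsets_at_top UNIV. (\<lambda>u. \<Sum>m\<in>X. weight b u * bilateral_term a m u) holomorphic_on V"
      by (intro always_eventually allI holomorphic_on_sum ht)
    show "(\<lambda>u. weight b u * bilateral_sum a u) holomorphic_on V"
      by (intro hV holomorphic_on_mult wh holomorphic_on_subset[OF bilateral_sum_holomorphic[of a]] a r0 pr)
    show "uniform_limit V (\<lambda>X u. \<Sum>m\<in>X. weight b u * bilateral_term a m u)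
      (\<lambda>u. weight b u * bilateral_sum a u) (finite_subsets_at_top UNIV)"
      using ul unfolding infsum_cmult_right' bilateral_sum_def .
  qed
  moreover have "\<forall>\<^sub>F X in finite_subsets_at_top UNIV.
      contour_integral g (\<lambda>u. \<Sum>m\<in>X. weight b u * bilateral_term a m u) =
      (\<Sum>m\<in>X. contour_integral g (\<lambda>u. weight b u * bilateral_term a m u))"
  proof (rule eventually_finite_subsets_at_top_weakI)
    fix X :: "int set" assume "finite X"
    thus "contour_integral g (\<lambda>u. \<Sum>m\<in>X. weight b u * bilateral_term a m u) =
      (\<Sum>m\<in>X. contour_integral g (\<lambda>u. weight b u * bilateral_term a m u))"
      by (rule contour_integral_sum) (intro contour_integrable_holomorphic_simple[OF ht V(2) g'(1) V(3)])
  qed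
  ultimately show ?thesis
    unfolding has_sum_def by (rule Lim_transform_eventually)
qed

subsection \<open>Perturbation of the parameters\<close>

text \<open>The exponents add up to \<open>0\<close>, while no sum of two of them and no difference of two distinct
  ones vanishes. So \<open>perturb\<close> preserves the product of the parameters but moves every
  \<open>a i * a j\<close> and every \<open>a i / a j\<close>.\<close>

definition perturb_exponent :: "nat \<Rightarrow> real" where
  "perturb_exponent j = (if j = 6 then - 15 else real j)"

definition perturb :: "(nat \<Rightarrow> complex) \<Rightarrow> complex \<Rightarrow> nat \<Rightarrow> complex" where
  "perturb a \<epsilon> j = a j * exp (\<epsilon> * of_real (perturb_exponent j))"

lemma perturb_0 [simp]: "perturb a 0 = a"
  by (simp add: perturb_def fun_eq_iff)

lemma perturb_eq_0_iff [simp]: "perturb a \<epsilon> j = 0 \<longleftrightarrow> a j = 0"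
  by (simp add: perturb_def)

lemma prod_perturb: "(\<Prod>j=1..6. perturb a \<epsilon> j) = (\<Prod>j=1..6. a j)"
proof -
  have "(\<Prod>j=1..6. exp (\<epsilon> * of_real (perturb_exponent j))) = 1"
    unfolding prod_1_6 by (simp add: perturb_exponent_def exp_add[symmetric] algebra_simps)
  thus ?thesis by (simp add: perturb_def prod.distrib)
qed

text \<open>For real \<open>t\<close> the norm of the argument already determines \<open>t\<close>,
  so every zero \<open>q powi l\<close> excludes at most one value.\<close>

lemma countable_theta_zeros_exp:
  assumes "p \<noteq> 0" "k \<noteq> 0"
  shows "countable {t :: real. theta (p * exp (of_real t * of_real k)) = 0}"
proof (rule countable_subset)
  show "{t. theta (p * exp (of_real t * of_real k)) = 0} \<subseteq>
    range (\<lambda>l::int. ln (norm q powi l / norm p) / k)"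
  proof
    fix t :: real assume "t \<in> {t. theta (p * exp (of_real t * of_real k)) = 0}"
    then obtain l :: int where "p * exp (of_real t * of_real k) = q powi l"
      using theta_eq_0_iff[of "p * exp (of_real t * of_real k)"] assms by auto
    hence "norm p * exp (t * k) = norm q powi l"
      by (metis Re_complex_of_real norm_exp_eq_Re norm_mult norm_power_int of_real_mult)
    hence "exp (t * k) = norm q powi l / norm p" using assms by (simp add: field_simps)
    hence "t * k = ln (norm q powi l / norm p)" by (metis ln_exp)
    hence "t = ln (norm q powi l / norm p) / k" using assms by (simp add: field_simps)
    thus "t \<in> range (\<lambda>l::int. ln (norm q powi l / norm p) / k)" by blast
  qed
qed auto

lemma generic_perturbation_sequence:
  assumes a: "\<And>j. j \<in> {1..6} \<Longrightarrow> a j \<noteq> 0"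
  obtains e where "e \<longlonglongrightarrow> 0" "\<And>n :: nat. generic_pairs (perturb a (e n))"
proof -
  let ?c = perturb_exponent
  define Z where "Z = (\<lambda>p k. {t :: real. theta (p * exp (of_real t * of_real k)) = 0})"
  define Bad where "Bad = (\<Union>i\<in>{1..6}. \<Union>j\<in>{1..6}. Z (a i * a j) (?c i + ?c j)) \<union>
     (\<Union>i\<in>{1..6}. \<Union>j\<in>{1..6}-{i}. Z (a i / a j) (?c i - ?c j))"
  have "?c i + ?c j \<noteq> 0" if "i \<in> {1..6}" "j \<in> {1..6}" for i j
    using that by (auto simp: perturb_exponent_def)
  moreover have "?c i - ?c j \<noteq> 0" if "i \<in> {1..6}" "j \<in> {1..6} - {i}" for i j
    using that by (auto simp: perturb_exponent_def)
  ultimately have "countable Bad"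
    unfolding Bad_def Z_def using a
    by (intro countable_Un countable_UN countable_theta_zeros_exp) (auto intro: countable_finite)
  have "\<exists>t. 0 < t \<and> t < 1 / real (Suc n) \<and> t \<notin> Bad" for n
  proof -
    have "uncountable {0<..<1 / real (Suc n)}" by (simp add: uncountable_open_interval)
    hence "\<not> {0<..<1 / real (Suc n)} \<subseteq> Bad" using \<open>countable Bad\<close> countable_subset by blast
    thus ?thesis by auto
  qed
  then obtain t where t: "\<And>n. 0 < t n \<and> t n < 1 / real (Suc n) \<and> t n \<notin> Bad" by metis
  have "t \<longlonglongrightarrow> 0"
    by (rule real_tendsto_sandwich[of "\<lambda>_. 0" t _ "\<lambda>n. 1 / real (Suc n)"])
       (use t lim_1_over_n[THEN LIMSEQ_Suc] in \<open>auto intro!: always_eventually less_imp_le\<close>)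
  hence lim: "(\<lambda>n. of_real (t n) :: complex) \<longlonglongrightarrow> 0"
    using tendsto_of_real[of t 0 sequentially] by simp
  have m: "perturb a (of_real \<tau>) i * perturb a (of_real \<tau>) j = a i * a j * exp (of_real \<tau> * of_real (?c i + ?c j))" for \<tau> i j
    by (simp add: perturb_def exp_add distrib_left)
  have d: "perturb a (of_real \<tau>) i / perturb a (of_real \<tau>) j = a i / a j * exp (of_real \<tau> * of_real (?c i - ?c j))" for \<tau> i j
    by (simp add: perturb_def exp_diff right_diff_distrib)
  have "generic_pairs (perturb a (of_real (t n)))" for n
  proof -
    have 1: "theta (perturb a (of_real (t n)) i * perturb a (of_real (t n)) j) \<noteq> 0"
      if "i \<in> {1..6}" "j \<in> {1..6}" for i j
      unfolding m using t[of n] that unfolding Bad_def Z_def by blast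
    have 2: "theta (perturb a (of_real (t n)) i / perturb a (of_real (t n)) j) \<noteq> 0"
      if "i \<in> {1..6}" "j \<in> {1..6}" "i \<noteq> j" for i j
      unfolding d using t[of n] that unfolding Bad_def Z_def by blast
    show ?thesis
      unfolding generic_pairs_def theta_pm_def using 1 2 a by (auto simp: power2_eq_square)
  qed
  thus ?thesis using that[OF lim] by blast
qed

text \<open>The perturbed parameters keep the product \<open>q\<close>, so the term bound holds with
  a single \<open>r\<close> near each point, and uniform convergence yields continuity jointly in
  the perturbation and in \<open>u\<close>.\<close>

lemma bilateral_sum_perturb_continuous:
  assumes a: "\<And>j. j \<in> {1..6} \<Longrightarrow> a j \<noteq> 0" and pr: "(\<Prod>j=1..6. a j) = q"
  shows "continuous_on {p. snd p \<noteq> 0} (\<lambda>p. bilateral_sum (perturb a (fst p)) (snd p))"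
proof -
  have o: "open {p :: complex \<times> complex. snd p \<noteq> 0}" by (intro open_Collect_neq continuous_intros)
  have "isCont (\<lambda>p. bilateral_sum (perturb a (fst p)) (snd p)) p0" if "snd p0 \<noteq> 0" for p0
  proof -
    have "p0 \<in> {p :: complex \<times> complex. snd p \<noteq> 0}" using that by simp
    from open_contains_cball[THEN iffD1, OF o, rule_format, OF this]
    obtain d where d: "d > 0" "cball p0 d \<subseteq> {p :: complex \<times> complex. snd p \<noteq> 0}" by blast
    define L where "L = snd ` cball p0 d \<union> (\<Union>j\<in>{1..6}. (\<lambda>p. perturb a (fst p) j) ` cball p0 d)"
    have pc: "continuous_on X (\<lambda>p. perturb a (fst p) j)" for X :: "(complex \<times> complex) set" and j
      unfolding perturb_def by (intro continuous_intros)
    have "compact L" unfolding L_def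
      by (intro compact_Un compact_UN compact_continuous_image continuous_intros pc) auto
    moreover have "L \<subseteq> -{0}" using d a by (auto simp: L_def)
    ultimately obtain r where r: "r > 0" "\<And>w. w \<in> L \<Longrightarrow> 1 / r \<le> norm w \<and> norm w \<le> r"
      using annulus_bounds by metis
    have "uniform_limit (cball p0 d) (\<lambda>X p. \<Sum>m\<in>X. bilateral_term (perturb a (fst p)) m (snd p))
      (\<lambda>p. bilateral_sum (perturb a (fst p)) (snd p)) (finite_subsets_at_top UNIV)"
    proof (rule bilateral_sum_uniform_limit[of _ r])
      fix p assume p: "p \<in> cball p0 d"
      show "1 / r \<le> norm (snd p) \<and> norm (snd p) \<le> r"
        using p by (intro r(2)) (simp add: L_def)
      show "1 / r \<le> norm (perturb a (fst p) j) \<and> norm (perturb a (fst p) j) \<le> r" if "j \<in> {1..6}" for j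
        unfolding L_def by (intro r(2)[unfolded L_def] UnI2 UN_I[OF that] image_eqI[OF refl p])
      show "(\<Prod>j=1..6. perturb a (fst p) j) = q" unfolding prod_perturb by (rule pr)
    qed (rule r)
    moreover have "\<forall>\<^sub>F X in finite_subsets_at_top UNIV.
        continuous_on (cball p0 d) (\<lambda>p. \<Sum>m\<in>X. bilateral_term (perturb a (fst p)) m (snd p))"
      using d a by (intro always_eventually allI continuous_on_sum bilateral_term_continuous pc continuous_intros) auto
    ultimately have "continuous_on (cball p0 d) (\<lambda>p. bilateral_sum (perturb a (fst p)) (snd p))"
      by (intro uniform_limit_theorem) auto
    thus ?thesis using d by (auto simp: continuous_on_interior[of "cball p0 d"] intro: continuous_on_interior)
  qed
  thus ?thesis by (intro continuous_at_imp_continuous_on) auto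
qed

text \<open>The contour stays fixed while infinitely many poles move. The common denominator is
  nonzero on a tube around the path, which gives one radius \<open>d\<close> good for all poles at
  once. While the parameter runs along the segment from 0 to \<epsilon>, a pole never meets the
  path, so its winding number is constant.\<close>

lemma perturbed_contour:
  assumes a: "\<And>j. j \<in> {1..6} \<Longrightarrow> a j \<noteq> 0" and pr: "(\<Prod>j=1..6. a j) = q"
    and g: "separates ((\<lambda>j. q powi N j * a j) ` {1..6}) g"
  shows "((\<lambda>\<epsilon>. contour_integral g (\<lambda>u. weight (\<lambda>j. q powi N j * perturb a \<epsilon> j) u * bilateral_sum (perturb a \<epsilon>) u))
      \<longlongrightarrow> contour_integral g (\<lambda>u. weight (\<lambda>j. q powi N j * a j) u * bilateral_sum a u)) (nhds 0)"
    (is ?limit)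
    and "\<forall>\<^sub>F \<epsilon> in nhds 0. separates ((\<lambda>j. q powi N j * perturb a \<epsilon> j) ` {1..6}) g"
proof -
  define b where "b = (\<lambda>\<epsilon> j. q powi N j * perturb a \<epsilon> j)"
  define den where "den = (\<lambda>p. \<Prod>j=1..6. qp (b (fst p) j * snd p) * qp (b (fst p) j / snd p))"
  define W where "W = {p :: complex \<times> complex. snd p \<noteq> 0} \<inter> den -` (-{0})"
  have o: "open {p :: complex \<times> complex. snd p \<noteq> 0}" by (intro open_Collect_neq continuous_intros)
  have W: "open W" unfolding W_def
    by (rule continuous_open_preimage[OF _ o])
       (auto simp: den_def b_def perturb_def intro!: continuous_intros)
  have g': "valid_path g" "pathfinish g = pathstart g" using g by (auto simp: separates_def)
  have im: "(0, z) \<in> W" if "z \<in> path_image g" for z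
  proof -
    have "z \<in> regular_set (b 0 ` {1..6})" using g that by (auto simp: separates_def b_def)
    thus ?thesis by (auto simp: W_def den_def regular_set_def)
  qed
  have c: "continuous_on W (\<lambda>(\<epsilon>, u). weight (b \<epsilon>) u * bilateral_sum (perturb a \<epsilon>) u)"
    unfolding case_prod_unfold
  proof (intro continuous_on_mult)
    show "continuous_on W (\<lambda>p. bilateral_sum (perturb a (fst p)) (snd p))"
      by (rule continuous_on_subset[OF bilateral_sum_perturb_continuous[OF a pr]]) (auto simp: W_def)
    show "continuous_on W (\<lambda>p. weight (b (fst p)) (snd p))"
      unfolding weight_def b_def perturb_def
      by (intro continuous_intros) (auto simp: W_def den_def b_def perturb_def)
  qed
  have h: "(\<lambda>u. weight (b \<epsilon>) u * bilateral_sum (perturb a \<epsilon>) u) holomorphic_on {u. (\<epsilon>, u) \<in> W}" for \<epsilon>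
  proof (intro holomorphic_on_mult)
    show "weight (b \<epsilon>) holomorphic_on {u. (\<epsilon>, u) \<in> W}"
      by (rule holomorphic_on_subset[OF weight_holomorphic[of _ "b \<epsilon> ` {1..6}"]])
         (auto simp: W_def den_def regular_set_def)
    show "bilateral_sum (perturb a \<epsilon>) holomorphic_on {u. (\<epsilon>, u) \<in> W}"
      by (rule holomorphic_on_subset[OF bilateral_sum_holomorphic])
         (use a pr in \<open>auto simp: W_def prod_perturb[simplified]\<close>)
  qed
  show ?limit
    using contour_integral_param_tendsto[OF g'(1) W im c h] unfolding b_def by simp
  obtain d V where d: "d > 0" "path_image g \<subseteq> V" "cball 0 d \<times> closure V \<subseteq> W"
    using path_image_tube[OF valid_path_imp_path[OF g'(1)] W im] by metis
  have inW: "(\<epsilon>, z) \<in> W" if "norm \<epsilon> \<le> d" "z \<in> path_image g" for \<epsilon> z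
  proof -
    have "z \<in> closure V" using that d closure_subset by blast
    hence "(\<epsilon>, z) \<in> cball 0 d \<times> closure V" using that by simp
    thus ?thesis using d by blast
  qed
  have wn: "winding_number g (f 1) = winding_number g (f 0)"
    if "continuous_on {0..1} f" "f ` {0..1} \<inter> path_image g = {}" for f :: "real \<Rightarrow> complex"
  proof -
    have "connected (f ` {0..1})" by (intro connected_continuous_image that) auto
    from winding_number_constant[OF valid_path_imp_path[OF g'(1)] g'(2) this that(2)] show ?thesis
      unfolding constant_on_def by auto
  qed
  have "separates (b \<epsilon> ` {1..6}) g" if e: "norm \<epsilon> \<le> d" for \<epsilon>
    unfolding separates_def
  proof (intro conjI ballI allI impI g')
    show "path_image g \<subseteq> regular_set (b \<epsilon> ` {1..6})"
      using inW[OF e] by (fastforce simp: W_def den_def regular_set_def)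
    show "winding_number g 0 = 1" using g by (simp add: separates_def)
  next
    fix t z assume "t \<in> b \<epsilon> ` {1..6}" and z: "z \<noteq> 0" "qp (t / z) = 0"
    then obtain j k where j: "j \<in> {1..6}" "t = b \<epsilon> j" and k: "t / z * q ^ k = 1"
      by (auto simp: qp_eq_0_iff)
    hence zk: "z = b \<epsilon> j * q ^ k" using z by (simp add: field_simps)
    \<comment> \<open>The trajectory of the pole with the same \<open>j\<close> and
      \<open>k\<close>, from the unperturbed position at time 0 to \<open>z\<close> at time
      1.\<close>
    define f where "f = (\<lambda>\<tau>::real. b (of_real \<tau> * \<epsilon>) j * q ^ k)"
    have bn: "b \<epsilon>' j \<noteq> 0" for \<epsilon>' using a j by (simp add: b_def)
    have qf: "qp (b (of_real \<tau> * \<epsilon>) j / f \<tau>) = 0" for \<tau>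
      unfolding qp_eq_0_iff f_def using bn by (intro exI[of _ k]) simp
    have "f ` {0..1} \<inter> path_image g = {}"
    proof (rule ccontr)
      assume "f ` {0..1} \<inter> path_image g \<noteq> {}"
      then obtain \<tau> where \<tau>: "\<tau> \<in> {0..1}" "f \<tau> \<in> path_image g" by blast
      have "norm (of_real \<tau> * \<epsilon>) \<le> 1 * d"
        unfolding norm_mult using \<tau> e d by (intro mult_mono) auto
      hence "(of_real \<tau> * \<epsilon>, f \<tau>) \<in> W" using inW \<tau> by simp
      thus False using qf[of \<tau>] j by (auto simp: W_def den_def)
    qed
    moreover have "continuous_on {0..1} f"
      unfolding f_def b_def perturb_def by (intro continuous_intros)
    ultimately have "winding_number g (f 1) = winding_number g (f 0)" by (intro wn)
    moreover have "winding_number g (f 0) = 1"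
    proof -
      have "f 0 \<noteq> 0" using bn by (simp add: f_def)
      thus ?thesis using g qf[of 0] j unfolding separates_def by (auto simp: b_def)
    qed
    ultimately show "winding_number g z = 1" using zk by (simp add: f_def)
  next
    fix t z assume "t \<in> b \<epsilon> ` {1..6}" and z: "z \<noteq> 0" "qp (t * z) = 0"
    then obtain j k where j: "j \<in> {1..6}" "t = b \<epsilon> j" and k: "t * z * q ^ k = 1"
      by (auto simp: qp_eq_0_iff)
    have bn: "b \<epsilon>' j \<noteq> 0" for \<epsilon>' using a j by (simp add: b_def)
    have zk: "z = 1 / (b \<epsilon> j * q ^ k)" using k bn[of \<epsilon>] unfolding j(2) by (simp add: field_simps)
    define f where "f = (\<lambda>\<tau>::real. 1 / (b (of_real \<tau> * \<epsilon>) j * q ^ k))"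
    have qf: "qp (b (of_real \<tau> * \<epsilon>) j * f \<tau>) = 0" for \<tau>
      unfolding qp_eq_0_iff f_def using bn by (intro exI[of _ k]) simp
    have "f ` {0..1} \<inter> path_image g = {}"
    proof (rule ccontr)
      assume "f ` {0..1} \<inter> path_image g \<noteq> {}"
      then obtain \<tau> where \<tau>: "\<tau> \<in> {0..1}" "f \<tau> \<in> path_image g" by blast
      have "norm (of_real \<tau> * \<epsilon>) \<le> 1 * d"
        unfolding norm_mult using \<tau> e d by (intro mult_mono) auto
      hence "(of_real \<tau> * \<epsilon>, f \<tau>) \<in> W" using inW \<tau> by simp
      thus False using qf[of \<tau>] j by (auto simp: W_def den_def)
    qed
    moreover have "continuous_on {0..1} f"
      unfolding f_def using bn unfolding b_def perturb_def by (intro continuous_intros) auto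
    ultimately have "winding_number g (f 1) = winding_number g (f 0)" by (intro wn)
    moreover have "winding_number g (f 0) = 0"
    proof -
      have "f 0 \<noteq> 0" using bn by (simp add: f_def)
      thus ?thesis using g qf[of 0] j unfolding separates_def by (auto simp: b_def)
    qed
    ultimately show "winding_number g z = 0" using zk by (simp add: f_def)
  qed
  hence "\<forall>\<^sub>F \<epsilon> in nhds 0. separates (b \<epsilon> ` {1..6}) g"
    unfolding eventually_nhds_metric using d(1) by (intro exI[of _ d]) auto
  thus "\<forall>\<^sub>F \<epsilon> in nhds 0. separates ((\<lambda>j. q powi N j * perturb a \<epsilon> j) ` {1..6}) g"
    unfolding b_def .
qed

lemma rhs_value_tendsto:
  assumes x: "\<And>j. j \<in> {1..6} \<Longrightarrow> ((\<lambda>n. x n j) \<longlongrightarrow> a j) F" and a: "\<And>j. j \<in> {1..6} \<Longrightarrow> a j \<noteq> 0"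
    and nz: "\<And>j k. j \<in> {1..6} \<Longrightarrow> k \<in> {1..6} \<Longrightarrow> qp (a j * a k * q powi (N j + N k)) \<noteq> 0"
  shows "((\<lambda>n. rhs_value (x n) N) \<longlongrightarrow> rhs_value a N) F"
  unfolding rhs_value_def
  by (intro tendsto_intros tendsto_prod x) (use a nz in auto)

text \<open>Both sides are continuous at the perturbation 0, with the same contour throughout, and
  they agree along a sequence of generic perturbations tending to 0.\<close>

lemma weighted_bilateral_sum_integral:
  assumes a: "\<And>j. j \<in> {1..6} \<Longrightarrow> a j \<noteq> 0" and pr: "(\<Prod>j=1..6. a j) = q" and N: "(\<Sum>j=1..6. N j) = 0"
    and g: "separates ((\<lambda>j. q powi N j * a j) ` {1..6}) g"
  shows "contour_integral g (\<lambda>u. weight (\<lambda>j. q powi N j * a j) u * bilateral_sum a u) =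
    2 * of_real pi * \<i> * rhs_value a N"
proof -
  define F where "F = (\<lambda>\<epsilon>. contour_integral g (\<lambda>u. weight (\<lambda>j. q powi N j * perturb a \<epsilon> j) u * bilateral_sum (perturb a \<epsilon>) u))"
  obtain e where e: "e \<longlonglongrightarrow> 0" "\<And>n :: nat. generic_pairs (perturb a (e n))"
  proof (rule generic_perturbation_sequence[of a])
    show "a j \<noteq> 0" if "j \<in> {1..6}" for j using that by (rule a)
  qed blast
  have nz: "qp (a j * a k * q powi (N j + N k)) \<noteq> 0" if "j \<in> {1..6}" "k \<in> {1..6}" for j k
  proof -
    have "qp ((q powi N j * a j) * (q powi N k * a k)) \<noteq> 0"
      by (rule separates_qp_neq_0[OF g]) (use a that in auto)
    thus ?thesis by (simp add: power_int_add mult_ac)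
  qed
  have x: "(\<lambda>n. perturb a (e n) j) \<longlonglongrightarrow> a j" for j
    unfolding perturb_def using e(1) by (auto intro!: tendsto_eq_intros)
  have "(\<lambda>n. F (e n)) \<longlonglongrightarrow> F 0"
    using filterlim_compose[OF perturbed_contour(1)[OF a pr g] e(1)] by (simp add: F_def)
  moreover have "\<forall>\<^sub>F n in sequentially. F (e n) = 2 * of_real pi * \<i> * rhs_value (perturb a (e n)) N"
  proof -
    have "\<forall>\<^sub>F n in sequentially. separates ((\<lambda>j. q powi N j * perturb a (e n) j) ` {1..6}) g"
      by (rule eventually_compose_filterlim[OF perturbed_contour(2) e(1)]) (fact a pr g)+
    thus ?thesis
    proof eventually_elim
      case (elim n)
      show ?case unfolding F_def
        by (rule weighted_bilateral_sum_integral_generic[OF e(2) _ N elim]) (unfold prod_perturb, rule pr)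
    qed
  qed
  ultimately have "(\<lambda>n. 2 * of_real pi * \<i> * rhs_value (perturb a (e n)) N) \<longlonglongrightarrow> F 0"
    by (rule Lim_transform_eventually)
  moreover have "(\<lambda>n. 2 * of_real pi * \<i> * rhs_value (perturb a (e n)) N) \<longlonglongrightarrow> 2 * of_real pi * \<i> * rhs_value a N"
    by (intro tendsto_intros rhs_value_tendsto x a nz)
  ultimately have "F 0 = 2 * of_real pi * \<i> * rhs_value a N" by (rule LIMSEQ_unique)
  thus ?thesis by (simp add: F_def)
qed

section \<open>Return to the original contours and integrands\<close>

lemma separating_contour_scale:
  assumes s: "s\<^sup>2 = q" and a: "\<And>j. j \<in> {1..6} \<Longrightarrow> a j \<noteq> 0"
    and \<gamma>: "separating_contour q s a N m \<gamma>"
  shows "separates ((\<lambda>j. q powi N j * a j) ` {1..6}) (\<lambda>t. s powi m * \<gamma> t)"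
proof -
  let ?c = "s powi m"
  have s0: "s \<noteq> 0" using s by auto
  hence c0: "?c \<noteq> 0" by simp
  have \<gamma>': "valid_path \<gamma>" "pathfinish \<gamma> = pathstart \<gamma>"
    and im: "path_image \<gamma> \<inter> ({0} \<union> poles_to_zero q s a N m \<union> poles_to_infinity q s a N m) = {}"
    and w1: "\<And>p. p \<in> {0} \<union> poles_to_zero q s a N m \<Longrightarrow> winding_number \<gamma> p = 1"
    and w0: "\<And>p. p \<in> poles_to_infinity q s a N m \<Longrightarrow> winding_number \<gamma> p = 0"
    using \<gamma> unfolding separating_contour_def by blast+
  have pz: "p \<in> poles_to_zero q s a N m"
    if j: "j \<in> {1..6}" and p: "qp (q powi N j * a j / (?c * p)) = 0" for j p
  proof -
    obtain k where k: "q powi N j * a j / (?c * p) * q ^ k = 1" using p by (auto simp: qp_eq_0_iff)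
    hence "p \<noteq> 0" by auto
    hence "p = q powi N j * s powi (- m) * q ^ k * a j"
      using k c0 by (simp add: power_int_minus field_simps)
    thus ?thesis using j unfolding poles_to_zero_def by blast
  qed
  have pi: "p \<in> poles_to_infinity q s a N m"
    if j: "j \<in> {1..6}" and p: "qp (q powi N j * a j * (?c * p)) = 0" for j p
  proof -
    obtain k where k: "q powi N j * a j * (?c * p) * q ^ k = 1" using p by (auto simp: qp_eq_0_iff)
    hence "p = q powi (- N j) * s powi (- m) * q powi (- int k) / a j"
      using c0 a[OF j] by (simp add: power_int_minus field_simps)
    thus ?thesis using j unfolding poles_to_infinity_def by blast
  qed
  have wn: "winding_number (\<lambda>t. ?c * \<gamma> t) z = winding_number \<gamma> (z / ?c)" if "z / ?c \<notin> path_image \<gamma>" for z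
    using winding_number_scale[OF \<gamma>'(1) c0 that]
    by (simp only: times_divide_eq_right nonzero_mult_div_cancel_left[OF c0])
  show ?thesis
    unfolding separates_def
  proof (intro conjI ballI allI impI)
    show "valid_path (\<lambda>t. ?c * \<gamma> t)" by (rule valid_path_scale[OF \<gamma>'(1)])
    show "pathfinish (\<lambda>t. ?c * \<gamma> t) = pathstart (\<lambda>t. ?c * \<gamma> t)"
      using \<gamma>'(2) by (simp add: pathfinish_def pathstart_def)
    show "path_image (\<lambda>t. ?c * \<gamma> t) \<subseteq> regular_set ((\<lambda>j. q powi N j * a j) ` {1..6})"
    proof
      fix u assume "u \<in> path_image (\<lambda>t. ?c * \<gamma> t)"
      then obtain v where v: "v \<in> path_image \<gamma>" "u = ?c * v" by (auto simp: path_image_scale)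
      thus "u \<in> regular_set ((\<lambda>j. q powi N j * a j) ` {1..6})"
      proof -
        have "v \<noteq> 0" "v \<notin> poles_to_zero q s a N m" "v \<notin> poles_to_infinity q s a N m"
          using im v(1) by blast+
        hence "qp (q powi N j * a j / u) \<noteq> 0" "qp (q powi N j * a j * u) \<noteq> 0" if "j \<in> {1..6}" for j
          using pz[OF that] pi[OF that] unfolding v(2) by blast+
        moreover have "u \<noteq> 0" unfolding v(2) using c0 \<open>v \<noteq> 0\<close> by (rule no_zero_divisors)
        ultimately show ?thesis unfolding regular_set_def by blast
      qed
    qed
    show "winding_number (\<lambda>t. ?c * \<gamma> t) 0 = 1" using wn[of 0] w1[of 0] im by auto
  next
    fix t z assume "t \<in> (\<lambda>j. q powi N j * a j) ` {1..6}" "z \<noteq> 0" "qp (t / z) = 0"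
    hence "z / ?c \<in> poles_to_zero q s a N m" using pz[of _ "z / ?c"] c0 by auto
    thus "winding_number (\<lambda>t. ?c * \<gamma> t) z = 1" using wn[of z] w1[of "z / ?c"] im by auto
  next
    fix t z assume "t \<in> (\<lambda>j. q powi N j * a j) ` {1..6}" "z \<noteq> 0" "qp (t * z) = 0"
    hence "z / ?c \<in> poles_to_infinity q s a N m" using pi[of _ "z / ?c"] c0 by auto
    thus "winding_number (\<lambda>t. ?c * \<gamma> t) z = 0" using wn[of z] w0[of "z / ?c"] im by auto
  qed
qed

text \<open>The leading \<open>s powi m\<close> is the derivative of the substitution
  \<open>u = s powi m * z\<close>, as it appears in \<open>contour_integral_scale\<close>.\<close>

lemma integrand_eq_weight:
  assumes s: "s\<^sup>2 = q" and z: "z \<noteq> 0"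
  shows "s powi m * (weight (\<lambda>j. q powi N j * a j) (s powi m * z) * bilateral_term a m (s powi m * z)) =
    integrand q s a N m z / z"
proof -
  have s0: "s \<noteq> 0" using s by auto
  have qs: "q powi k = s powi (2 * k)" for k
    using power_int_mult[of s 2 k] s by simp
  let ?u = "s powi m * z"
  have u2: "?u\<^sup>2 = q powi m * z\<^sup>2"
  proof -
    have "(s powi m)\<^sup>2 = s powi (m + m)"
      unfolding power2_eq_square by (rule power_int_add[symmetric]) (use s0 in simp)
    thus ?thesis unfolding qs by (simp only: power_mult_distrib mult_2)
  qed
  have v: "?u * q powi (- m) = s powi (- m) * z"
  proof -
    have "s powi m * s powi (2 * - m) = s powi (m + 2 * - m)"
      by (rule power_int_add[symmetric]) (use s0 in simp)
    thus ?thesis unfolding qs by (simp add: mult_ac)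
  qed
  have r: "q powi (2 * m) / ?u\<^sup>2 = q powi m * z powi (- 2)"
  proof -
    have "q powi (2 * m) = q powi m * q powi m"
      unfolding mult_2 by (rule power_int_add) simp
    thus ?thesis unfolding u2 using power_int_minus[of z 2] by (simp add: divide_inverse)
  qed
  have e: "q powi (3 * m\<^sup>2 - m) * ?u powi (- 6 * m) = 1 / (q powi m * z powi (6 * m))"
  proof -
    have "(s powi m) powi (- 6 * m) = s powi (2 * (- 3 * m\<^sup>2))"
      using power_int_mult[of s m "- 6 * m"] by (simp add: power2_eq_square mult_ac)
    also have "\<dots> = q powi (- 3 * m\<^sup>2)" unfolding qs ..
    finally have "q powi (3 * m\<^sup>2 - m) * (s powi m) powi (- 6 * m) = q powi ((3 * m\<^sup>2 - m) + (- 3 * m\<^sup>2))"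
      by (simp only: power_int_add q_nz simp_thms)
    also have "(3 * m\<^sup>2 - m) + (- 3 * m\<^sup>2) = - m" by simp
    finally have "q powi (3 * m\<^sup>2 - m) * (s powi m) powi (- 6 * m) = inverse (q powi m)"
      by (simp only: power_int_minus)
    moreover have "z powi (- 6 * m) = inverse (z powi (6 * m))"
      using power_int_minus[of z "6 * m"] by simp
    ultimately show ?thesis
      unfolding power_int_mult_distrib by (simp add: divide_inverse mult.assoc[symmetric])
  qed
  have B: "bilateral_factor a (s powi (- m) * z) =
      (\<Prod>j=1..6. qp (q * s powi m / (a j * z)) * qp (q * s powi (- m) * z / a j))"
    unfolding bilateral_factor_def
    by (intro prod.cong refl) (simp add: power_int_minus divide_inverse mult_ac)
  have D: "(\<Prod>j=1..6. qp (q powi N j * a j * ?u) * qp (q powi N j * a j / ?u)) =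
      (\<Prod>j=1..6. qp (q powi N j * s powi m * a j * z) * qp (q powi N j * s powi (- m) * a j / z))"
    by (intro prod.cong refl) (simp add: power_int_minus divide_inverse mult_ac)
  have "s powi m * (weight (\<lambda>j. q powi N j * a j) ?u * bilateral_term a m ?u) =
    (bilateral_factor a (s powi (- m) * z) /
      (\<Prod>j=1..6. qp (q powi N j * a j * ?u) * qp (q powi N j * a j / ?u))) *
    ((1 - q powi m * z\<^sup>2) * (1 - q powi m * z powi (- 2)) * (q powi (3 * m\<^sup>2 - m) * ?u powi (- 6 * m))) / z"
    unfolding weight_def bilateral_term_def v r unfolding u2 using s0 z by (simp add: mult_ac)
  also have "\<dots> = integrand q s a N m z / z"
    unfolding integrand_def e B D prod_dividef by simp
  finally show ?thesis .
qed

end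

theorem theorem4p1:
  fixes q s :: complex and a :: "nat \<Rightarrow> complex" and N :: "nat \<Rightarrow> int"
    and \<gamma> :: "int \<Rightarrow> real \<Rightarrow> complex"
  assumes "0 < norm q" and "norm q < 1"
    and "s ^ 2 = q"
    and "\<forall>j\<in>{1..6}. a j \<noteq> 0"
    and "generic_params q a N"
    and "(\<Prod>j=1..6. a j) = q"
    and "(\<Sum>j=1..6. N j) = 0"
    and "\<forall>m. separating_contour q s a N m (\<gamma> m)"
  shows "((\<lambda>m::int. contour_integral (\<gamma> m)
             (\<lambda>z. integrand q s a N m z / (2 * of_real pi * \<i> * z)))
          has_sum
          (2 / (\<Prod>j=1..6. q powi (N j * (N j - 1) div 2) * a j powi N j)
           * (\<Prod>j=1..6. \<Prod>k=j+1..6.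
                qpoch_inf (q / (a j * a k)) q /
                qpoch_inf (a j * a k * q powi (N j + N k)) q))) UNIV"
proof -
  interpret nome q using assms(1,2) by unfold_locales auto
  define b where "b = (\<lambda>j. q powi N j * a j)"
  have a: "a j \<noteq> 0" if "j \<in> {1..6}" for j using assms(4) that by blast
  have s0: "s \<noteq> 0" using assms(1,3) by auto
  \<comment> \<open>After rescaling, the poles no longer depend on \<open>m\<close>: all these
    curves separate the same two families, so each can be exchanged for \<open>\<gamma> 0\<close>,
    and the sum can be taken under a single integral.\<close>
  have sep: "separates (b ` {1..6}) (\<lambda>t. s powi m * \<gamma> m t)" for m
    unfolding b_def using assms(8) by (intro separating_contour_scale[OF assms(3) a]) auto
  have sep0: "separates (b ` {1..6}) (\<gamma> 0)" using sep[of 0] by simp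
  have int: "contour_integral (\<gamma> m) (\<lambda>z. integrand q s a N m z / (2 * of_real pi * \<i> * z)) =
      1 / (2 * of_real pi * \<i>) * contour_integral (\<gamma> 0) (\<lambda>u. weight b u * bilateral_term a m u)" for m
  proof -
    let ?f = "\<lambda>u. 1 / (2 * of_real pi * \<i>) * (weight b u * bilateral_term a m u)"
    have vp: "valid_path (\<gamma> m)" and no0: "0 \<notin> path_image (\<gamma> m)"
      using assms(8) by (auto simp: separating_contour_def)
    have hol: "(\<lambda>u. weight b u * bilateral_term a m u) holomorphic_on regular_set (b ` {1..6})"
      by (intro holomorphic_on_mult weight_holomorphic holomorphic_on_subset[OF bilateral_term_holomorphic])
         (use a in \<open>auto simp: regular_set_def\<close>)
    have "contour_integral (\<gamma> m) (\<lambda>z. integrand q s a N m z / (2 * of_real pi * \<i> * z)) =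
        contour_integral (\<gamma> m) (\<lambda>z. s powi m * ?f (s powi m * z))"
    proof (rule contour_integral_cong[OF refl])
      fix z assume "z \<in> path_image (\<gamma> m)"
      hence "z \<noteq> 0" using no0 by auto
      have "integrand q s a N m z / (2 * of_real pi * \<i> * z) =
          1 / (2 * of_real pi * \<i>) * (integrand q s a N m z / z)"
        by simp
      also have "integrand q s a N m z / z =
          s powi m * (weight b (s powi m * z) * bilateral_term a m (s powi m * z))"
        using integrand_eq_weight[OF assms(3) \<open>z \<noteq> 0\<close>, of m N a] by (simp add: b_def)
      finally have "integrand q s a N m z / (2 * of_real pi * \<i> * z) = 1 / (2 * of_real pi * \<i>) *
        (s powi m * (weight b (s powi m * z) * bilateral_term a m (s powi m * z)))" .
      thus "integrand q s a N m z / (2 * of_real pi * \<i> * z) = s powi m * ?f (s powi m * z)"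
        by (simp only: mult.left_commute)
    qed
    also have "\<dots> = contour_integral (\<lambda>t. s powi m * \<gamma> m t) ?f"
      using vp s0 by (intro contour_integral_scale[symmetric]) auto
    also have "\<dots> = contour_integral (\<gamma> 0) ?f"
      by (rule separates_integral_eq[OF _ sep sep0]) (use hol in \<open>auto intro!: holomorphic_intros\<close>)
    also have "\<dots> = 1 / (2 * of_real pi * \<i>) * contour_integral (\<gamma> 0) (\<lambda>u. weight b u * bilateral_term a m u)"
      using sep0 hol
      by (intro contour_integral_lmul contour_integrable_holomorphic_simple[of _ "regular_set (b ` {1..6})"])
         (auto simp: separates_def open_regular_set)
    finally show ?thesis .
  qed
  have "((\<lambda>m. 1 / (2 * of_real pi * \<i>) * contour_integral (\<gamma> 0) (\<lambda>u. weight b u * bilateral_term a m u)) has_sum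
      1 / (2 * of_real pi * \<i>) * contour_integral (\<gamma> 0) (\<lambda>u. weight b u * bilateral_sum a u)) UNIV"
    by (intro has_sum_cmult_right weighted_terms_has_sum a assms(6) sep0)
  also have "1 / (2 * of_real pi * \<i>) * contour_integral (\<gamma> 0) (\<lambda>u. weight b u * bilateral_sum a u) = rhs_value a N"
    using weighted_bilateral_sum_integral[OF a assms(6,7) sep0[unfolded b_def]] by (simp add: b_def)
  finally show ?thesis
    unfolding int rhs_value_def .
qed

end
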